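(* Let $r$ and $s$ be positive integers with $s \equiv 1 \pmod r$ or $s \equiv -1 \pmod r$. Then $$p(T_{r,s})\leq 2s- 2\Big\lfloor \frac{s}{r} \Big\rfloor +1,$$ where $p(T_{r,s})$ denotes the petal number of the torus knot $T_{r,s}$.
   Context: Knots are tame knots in $\mathbb{R}^3$ (or $S^3$), considered up to ambient isotopy. Multi-crossings: an $n$-crossing of a planar projection of a knot is a point through which exactly $n$ strands of the knot pass, at $n$ pairwise distinct heights, such that each strand bisects the crossing (i.e. among the $2n$ strand ends around the point in cyclic order, each strand joins an end to the opposite one, $n$ positions further). An übercrossing projection of a knot is a projection whose only crossing is a single $n$-crossing, for some $n \ge 1$; outside the crossing the projection consists of $n$ pairwise disjoint loops, each joining two of the $2n$ strand ends. A loop is nesting if it contains (encloses) at least one other loop. A petal projection is an übercrossing projection with no nesting loop; equivalently each of its $n$ loops joins two cyclically adjacent strand ends. (The case $n=1$, a single strand closed up by a single loop, is allowed, so the trivial knot has petal number $1$.) Petal number: every knot has a petal projection, and the petal number $p(K)$ of a knot $K$ is the smallest number of loops (equivalently, of strands through the single multi-crossing) among all petal projections of $K$. Torus knot: let $V$ be a standard (unknotted) solid torus in $S^3$ and $T=\partial V$. A meridian curve on $T$ is a curve that bounds a disc in $V$ but not on $T$; a longitude curve on $T$ is a curve meeting a meridian exactly once. For relatively prime integers $r,s$, the torus knot $T_{r,s}$ is the knot on $T$ that wraps $s$ times in the meridian direction and $r$ times in the longitude direction. *)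

theory Defs
  imports "HOL-Analysis.Analysis" "HOL-Library.Extended_Nat" "HOL-Number_Theory.Cong"
begin

definition ambient_isotopic :: "(real^3) set \<Rightarrow> (real^3) set \<Rightarrow> bool" where
  "ambient_isotopic K L \<longleftrightarrow>
     (\<exists>H :: real \<times> (real^3) \<Rightarrow> real^3.
        continuous_on ({0..1} \<times> UNIV) H \<and>
        (\<forall>t\<in>{0..1}. \<exists>G. homeomorphism UNIV UNIV (\<lambda>x. H (t, x)) G) \<and>
        (\<forall>x. H (0, x) = x) \<and>
        (\<lambda>x. H (1, x)) ` K = L)"

text \<open>A knot is the image of a closed curve of the following kind. Tameness is not required here:
  it is inherited by everything that is ambient isotopic to a tame knot.\<close>

definition knot_curve :: "(real \<Rightarrow> real^3) \<Rightarrow> bool" where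
  "knot_curve \<gamma> \<longleftrightarrow> simple_path \<gamma> \<and> pathfinish \<gamma> = pathstart \<gamma>"

definition planar_proj :: "real^3 \<Rightarrow> complex" where
  "planar_proj x = Complex (x $ 1) (x $ 2)"

definition on_ray :: "real \<Rightarrow> complex \<Rightarrow> bool" where
  "on_ray \<theta> z \<longleftrightarrow> (\<exists>\<rho>\<ge>0. z = of_real \<rho> * cis \<theta>)"

text \<open>The curve starts at the crossing and passes through it at the times
  \<open>0 = t 0 < \<dots> < t n = 1\<close>, where \<open>t 0\<close> and \<open>t n\<close> belong to the same strand (number 0).
  The \<open>n\<close> heights at the crossing are distinct because a knot curve is injective.
  The last conjunct expresses that each strand bisects the crossing: up to a homeomorphism of the
  plane, which gives a meaning to the cyclic order, the strand ends are the rays at the angles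
  \<open>j \<pi> / n\<close> for \<open>j\<close> modulo \<open>2 n\<close>, and strand \<open>i\<close> enters through end \<open>a i + n\<close> and
  leaves through end \<open>a i\<close>. Loop \<open>i\<close> leaves along strand \<open>i\<close> and
  returns along strand \<open>i + 1\<close> modulo \<open>n\<close>. Distinct strand ends
  lie on distinct rays because the projection is injective away from the crossing.\<close>

definition uebercrossing_projection ::
    "nat \<Rightarrow> (real \<Rightarrow> real^3) \<Rightarrow> (nat \<Rightarrow> real) \<Rightarrow> bool" where
  "uebercrossing_projection n \<gamma> t \<longleftrightarrow>
     knot_curve \<gamma> \<and> n \<ge> 1 \<and>
     t 0 = 0 \<and> t n = 1 \<and> strict_mono_on {..n} t \<and>
     (\<forall>u\<in>{0..1}. planar_proj (\<gamma> u) = planar_proj (\<gamma> 0) \<longleftrightarrow> u \<in> t ` {..n}) \<and>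
     inj_on (planar_proj \<circ> \<gamma>) ({0..1} - t ` {..n}) \<and>
     (\<exists>(h :: complex \<Rightarrow> complex) h' (a :: nat \<Rightarrow> nat) \<epsilon>.
        homeomorphism UNIV UNIV h h' \<and> h (planar_proj (\<gamma> 0)) = 0 \<and> \<epsilon> > 0 \<and>
        (\<forall>i<n.
           (\<forall>u\<in>{t i .. t i + \<epsilon>}.
              on_ray (pi * real (a i) / real n) (h (planar_proj (\<gamma> u)))) \<and>
           (\<forall>u\<in>{t (Suc i) - \<epsilon> .. t (Suc i)}.
              on_ray (pi * real (a (Suc i mod n) + n) / real n) (h (planar_proj (\<gamma> u))))))"

definition uber_loop :: "(real \<Rightarrow> real^3) \<Rightarrow> (nat \<Rightarrow> real) \<Rightarrow> nat \<Rightarrow> complex set" where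
  "uber_loop \<gamma> t i = (planar_proj \<circ> \<gamma>) ` {t i .. t (Suc i)}"

definition nesting_loop ::
    "nat \<Rightarrow> (real \<Rightarrow> real^3) \<Rightarrow> (nat \<Rightarrow> real) \<Rightarrow> nat \<Rightarrow> bool" where
  "nesting_loop n \<gamma> t i \<longleftrightarrow>
     (\<exists>j<n. j \<noteq> i \<and>
        uber_loop \<gamma> t j - {planar_proj (\<gamma> 0)} \<subseteq> inside (uber_loop \<gamma> t i))"

definition petal_projection :: "nat \<Rightarrow> (real \<Rightarrow> real^3) \<Rightarrow> bool" where
  "petal_projection n \<gamma> \<longleftrightarrow>
     (\<exists>t. uebercrossing_projection n \<gamma> t \<and> (\<forall>i<n. \<not> nesting_loop n \<gamma> t i))"

text \<open>With values in \<^typ>\<open>enat\<close>, a knot without petal projection would have petal number \<open>\<infinity>\<close>,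
  so a finite upper bound entails that a petal projection exists (on \<^typ>\<open>nat\<close>, the infimum of
  the empty set would be 0).\<close>

definition petal_number :: "(real^3) set \<Rightarrow> enat" where
  "petal_number K =
     Inf {enat n | n. \<exists>\<gamma>. ambient_isotopic K (path_image \<gamma>) \<and> petal_projection n \<gamma>}"

text \<open>The point of the standard torus with longitudinal angle \<open>\<phi>\<close> and meridional angle \<open>\<psi>\<close>:
  a curve of constant \<open>\<phi>\<close> bounds a disc in the solid torus.\<close>

definition torus_point :: "real \<Rightarrow> real \<Rightarrow> real^3" where
  "torus_point \<phi> \<psi> =
     vector [(2 + cos \<psi>) * cos \<phi>, (2 + cos \<psi>) * sin \<phi>, sin \<psi>]"

text \<open>A knot only for relatively prime \<open>r\<close> and \<open>s\<close>: \<open>r\<close> turns in the longitude direction,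
  \<open>s\<close> in the meridian direction.\<close>

definition torus_knot :: "int \<Rightarrow> int \<Rightarrow> (real^3) set" where
  "torus_knot r s =
     (\<lambda>u. torus_point (2 * pi * of_int r * u) (2 * pi * of_int s * u)) ` {0..1}"

end

theory Submission
  imports Defs
begin

text \<open>Isotopies of curves are produced without any smooth machinery. A map on a subset of space whose
  displacement has a small Lipschitz constant extends, coordinate by coordinate, to a map \<open>x \<mapsto> x + D x\<close> of
  the whole space with the same property, and then \<open>x \<mapsto> x + t D x\<close> is a homeomorphism for all \<open>t \<le> 1\<close>.
  Chaining such steps, a family of simple closed curves that is uniformly bi-Lipschitz and varies in a
  Lipschitz way is realised by an ambient isotopy.

  On the torus only the two angles matter. Let the distance from the core grow strictly along the
  knot and drop to 0 at the end, so that the first longitudinal turn runs along the core. Then the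
  angles may be changed by any homotopy of the path \<open>(\<phi>, \<psi>)\<close> that does not meet the place of the drop.
  In the universal cover the straight path of slope \<open>r / s\<close> is deformed into a staircase that passes just
  below it through lattice points; the \<open>\<lfloor>s / r\<rfloor>\<close> meridional turns along the core disappear, and
  \<open>m = s - \<lfloor>s / r\<rfloor>\<close> turns remain. Every turn crosses a fixed line orthogonal to the core twice, at distinct
  heights, and one more crossing comes from the core: these are the \<open>2 m + 1\<close> strands of the petal
  projection along that line. Viewed along the \<open>y\<close>-axis all crossings are ordered by time, as the
  distance from the core increases. So \<open>y\<close> may be replaced by \<open>S x\<close> with a slope \<open>S\<close> that increases along
  the curve, which puts every loop into a sector of its own.\<close>

subsection \<open>Ambient isotopies from Lipschitz families\<close>

text \<open>Homeomorphisms of space come from a contraction argument, so what has to be controlled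
  is the Lipschitz constant of a displacement with respect to chords of the curve, not to its
  parameter. Hence the format of the families: upper bounds on mixed differences in time and
  parameter, set against lower bounds on chords. The curves are built from sine, minimum and
  maximum, which keeps all these bounds elementary. The congruence enters twice. It makes r and s
  coprime, so that between its ends the line of slope r / s misses the lattice points. For s
  \<noteq> 1 it also gives r \<le> s + 1, so that the staircase advances by at most one column per
  row. For s = 1 there is no bound on r; that knot is shown to be trivial in another way. The drop
  towards the core cannot stay in one place: to get rid of turns on the core it must come early in
  the closing turn, while the order of the crossings in the projection forces it into the last part.
  This is why there are two distance profiles and an isotopy between them.\<close>

lemma ambient_isotopic_trans:
  assumes "ambient_isotopic K L" "ambient_isotopic L M"
  shows "ambient_isotopic K M"
proof -
  obtain H :: "real \<times> (real^3) \<Rightarrow> real^3" where H0: "continuous_on ({0..1} \<times> UNIV) H \<and>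
      (\<forall>t\<in>{0..1}. \<exists>G. homeomorphism UNIV UNIV (\<lambda>x. H (t, x)) G) \<and>
      (\<forall>x. H (0, x) = x) \<and> (\<lambda>x. H (1, x)) ` K = L"
    using assms(1) unfolding ambient_isotopic_def ..
  note H = H0[THEN conjunct1] H0[THEN conjunct2, THEN conjunct1]
    H0[THEN conjunct2, THEN conjunct2, THEN conjunct1] H0[THEN conjunct2, THEN conjunct2, THEN conjunct2]
  obtain H' :: "real \<times> (real^3) \<Rightarrow> real^3" where H'0: "continuous_on ({0..1} \<times> UNIV) H' \<and>
      (\<forall>t\<in>{0..1}. \<exists>G. homeomorphism UNIV UNIV (\<lambda>x. H' (t, x)) G) \<and>
      (\<forall>x. H' (0, x) = x) \<and> (\<lambda>x. H' (1, x)) ` L = M"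
    using assms(2) unfolding ambient_isotopic_def ..
  note H' = H'0[THEN conjunct1] H'0[THEN conjunct2, THEN conjunct1]
    H'0[THEN conjunct2, THEN conjunct2, THEN conjunct1] H'0[THEN conjunct2, THEN conjunct2, THEN conjunct2]
  \<comment> \<open>Clamping both time arguments concatenates the isotopies without gluing along t =
    1/2.\<close>
  define J where "J = (\<lambda>(t, x). H' (max 0 (2 * t - 1), H (min 1 (2 * t), x)))"
  have "continuous_on ({0..1} \<times> UNIV) J"
    unfolding J_def case_prod_beta
  proof (rule continuous_on_compose2[OF H'(1)])
    show "continuous_on ({0..1} \<times> UNIV) (\<lambda>p::real \<times> (real^3). (max 0 (2 * fst p - 1), H (min 1 (2 * fst p), snd p)))"
      by (intro continuous_intros continuous_on_compose2[OF H(1)]) (auto simp: min_def)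
  qed (auto simp: max_def)
  moreover have "\<exists>G. homeomorphism UNIV UNIV (\<lambda>x. J (t, x)) G" if t: "t \<in> {0..1}" for t
  proof -
    have "min 1 (2 * t) \<in> {0..1}" "max 0 (2 * t - 1) \<in> {0..1}" using t by auto
    then obtain G G' where "homeomorphism UNIV UNIV (\<lambda>x. H (min 1 (2 * t), x)) G"
        "homeomorphism UNIV UNIV (\<lambda>x. H' (max 0 (2 * t - 1), x)) G'"
      using H(2) H'(2) by meson
    from homeomorphism_compose[OF this] show ?thesis
      unfolding J_def by (auto simp: o_def)
  qed
  moreover have "\<forall>x. J (0, x) = x" by (simp add: J_def H(3) H'(3))
  moreover have "(\<lambda>x. J (1, x)) ` K = M"
    using H(4) H'(4) by (auto simp: J_def image_image)
  ultimately show ?thesis unfolding ambient_isotopic_def by blast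
qed

lemma ambient_isotopic_refl: "ambient_isotopic K K"
  unfolding ambient_isotopic_def
  by (rule exI[of _ snd]) (auto intro!: continuous_intros exI[of _ "\<lambda>x. x"] simp: homeomorphism_def)

text \<open>McShane's formula: the infimum of the cones of slope \<open>k\<close> over the values on
  \<open>K\<close>. The bound on \<open>K\<close> is what keeps the infimum finite and makes it
  agree with \<open>d\<close> there.\<close>

lemma lipschitz_extension:
  fixes d :: "'a::metric_space \<Rightarrow> real"
  assumes k: "k \<ge> 0" and d: "\<And>x y. x \<in> K \<Longrightarrow> y \<in> K \<Longrightarrow> \<bar>d x - d y\<bar> \<le> k * dist x y"
  obtains D where "\<And>x. x \<in> K \<Longrightarrow> D x = d x" "\<And>x y. \<bar>D x - D y\<bar> \<le> k * dist x y"
proof (cases "K = {}")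
  case True
  with that[of "\<lambda>_. 0"] k show ?thesis by simp
next
  case False
  then obtain y0 where y0: "y0 \<in> K" by blast
  define D where "D x = (INF y\<in>K. d y + k * dist x y)" for x
  have bdd: "bdd_below ((\<lambda>y. d y + k * dist x y) ` K)" for x
  proof (rule bdd_belowI2)
    fix y assume "y \<in> K"
    have "d y0 - d y \<le> k * dist y0 y" using d[OF y0 \<open>y \<in> K\<close>] by simp
    also have "\<dots> \<le> k * (dist x y + dist x y0)"
      by (rule mult_left_mono[OF _ k]) (metis dist_commute dist_triangle add.commute)
    finally show "d y0 - k * dist x y0 \<le> d y + k * dist x y" by (simp add: algebra_simps)
  qed
  have le: "D x \<le> D x' + k * dist x x'" for x x'
  proof -
    have "D x - k * dist x x' \<le> D x'"
      unfolding D_def[of x']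
    proof (rule cINF_greatest[OF False])
      fix y assume y: "y \<in> K"
      have "D x \<le> d y + k * dist x y" unfolding D_def by (rule cINF_lower[OF bdd y])
      also have "\<dots> \<le> d y + k * (dist x x' + dist x' y)"
        using mult_left_mono[OF dist_triangle[of x y x'] k] by (simp add: add.commute)
      finally show "D x - k * dist x x' \<le> d y + k * dist x' y" by (simp add: algebra_simps)
    qed
    then show ?thesis by simp
  qed
  have eq: "D x = d x" if x: "x \<in> K" for x
  proof (rule antisym)
    show "D x \<le> d x" using cINF_lower[OF bdd x, of x] by (simp add: D_def)
    show "d x \<le> D x" unfolding D_def
      by (rule cINF_greatest[OF False]) (use d[OF x] in \<open>force simp: abs_le_iff\<close>)
  qed
  show ?thesis
  proof (rule that[of D])
    show "\<bar>D x - D y\<bar> \<le> k * dist x y" for x y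
      using le[of x y] le[of y x] by (simp add: dist_commute abs_le_iff)
  qed (use eq in auto)
qed

text \<open>A preimage of \<open>y\<close> is a fixed point of the contraction that sends
  \<open>x\<close> to \<open>y\<close> minus the displacement at \<open>x\<close>. The lower bound
  on distances gives injectivity and a 2-Lipschitz inverse.\<close>

lemma near_identity_homeomorphism:
  fixes D :: "real^3 \<Rightarrow> real^3"
  assumes D: "\<And>x y. norm (D x - D y) \<le> 1/2 * norm (x - y)" and t: "t \<in> {0..1::real}"
  shows "\<exists>G. homeomorphism UNIV UNIV (\<lambda>x. x + t *\<^sub>R D x) G"
proof -
  define f where "f x = x + t *\<^sub>R D x" for x
  have tD: "norm (t *\<^sub>R D x - t *\<^sub>R D y) \<le> 1/2 * norm (x - y)" for x y
  proof -
    have "norm (t *\<^sub>R D x - t *\<^sub>R D y) = t * norm (D x - D y)"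
      using t by (simp flip: scaleR_diff_right)
    also have "\<dots> \<le> 1 * norm (D x - D y)" using t by (intro mult_right_mono) auto
    finally show ?thesis using D[of x y] by simp
  qed
  have lower: "1/2 * norm (x - y) \<le> norm (f x - f y)" for x y
  proof -
    have "norm (x - y) \<le> norm (f x - f y) + norm (t *\<^sub>R D x - t *\<^sub>R D y)"
      using norm_triangle_ineq4[of "f x - f y" "t *\<^sub>R D x - t *\<^sub>R D y"]
      by (simp add: f_def algebra_simps)
    with tD[of x y] show ?thesis by simp
  qed
  have inj: "x = y" if "f x = f y" for x y
    using lower[of x y] that by simp
  have surj: "\<exists>x. f x = y" for y
  proof -
    have "\<exists>!x. y - t *\<^sub>R D x = x"
    proof (rule banach_fix_type[of "1/2"])
      show "\<forall>x x'. dist (y - t *\<^sub>R D x) (y - t *\<^sub>R D x') \<le> 1/2 * dist x x'"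
        using tD by (simp add: dist_norm norm_minus_commute)
    qed auto
    then show ?thesis by (metis f_def diff_add_cancel)
  qed
  define G where "G = inv f"
  have fG: "f (G y) = y" for y unfolding G_def using surj by (metis f_inv_into_f rangeI)
  have Gf: "G (f x) = x" for x using fG inj by blast
  have "continuous_on UNIV G"
  proof (rule lipschitz_on_continuous_on[of 2])
    show "2-lipschitz_on UNIV G"
      by (rule lipschitz_onI) (use lower[of "G _" "G _", unfolded fG] in \<open>simp_all add: dist_norm field_simps\<close>)
  qed
  moreover have "continuous_on UNIV f"
  proof -
    have "continuous_on UNIV D"
      by (rule lipschitz_on_continuous_on[of "1/2"], rule lipschitz_onI) (use D in \<open>auto simp: dist_norm\<close>)
    then show ?thesis unfolding f_def by (intro continuous_intros)
  qed
  ultimately have "homeomorphism UNIV UNIV f G"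
    unfolding homeomorphism_def using fG Gf by (auto simp: image_def) (metis fG, metis Gf)
  then show ?thesis unfolding f_def by blast
qed

lemma norm_le_3: "norm (x::real^3) \<le> \<bar>x $ 1\<bar> + \<bar>x $ 2\<bar> + \<bar>x $ 3\<bar>"
  using norm_le_l1_cart[of x] by (simp add: sum_3)

text \<open>The constant 1/6 is 1/2 divided among the three coordinates, which are extended
  separately and put together by the l1 bound on the norm.\<close>

lemma ambient_isotopic_near:
  fixes d :: "real^3 \<Rightarrow> real^3"
  assumes d: "\<And>x y i. x \<in> K \<Longrightarrow> y \<in> K \<Longrightarrow> \<bar>d x $ i - d y $ i\<bar> \<le> 1/6 * norm (x - y)"
  shows "ambient_isotopic K ((\<lambda>x. x + d x) ` K)"
proof -
  have "\<exists>D. (\<forall>x\<in>K. D x = d x $ i) \<and> (\<forall>x y. \<bar>D x - D y\<bar> \<le> 1/6 * dist x y)" for i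
    by (rule lipschitz_extension[of "1/6" K "\<lambda>x. d x $ i"]) (use d in \<open>auto simp: dist_norm\<close>)
  then obtain D' where D': "\<And>i x. x \<in> K \<Longrightarrow> D' i x = d x $ i"
      "\<And>i x y. \<bar>D' i x - D' i y\<bar> \<le> 1/6 * dist x y" by metis
  define D :: "real^3 \<Rightarrow> real^3" where "D x = (\<chi> i. D' i x)" for x
  have D: "norm (D x - D y) \<le> 1/2 * norm (x - y)" for x y
    using norm_le_3[of "D x - D y"] D'(2)[of 1 x y] D'(2)[of 2 x y] D'(2)[of 3 x y]
    by (simp add: D_def dist_norm)
  have eq: "D x = d x" if "x \<in> K" for x
    using D'(1)[OF that] by (simp add: D_def vec_eq_iff)
  have contD: "continuous_on UNIV D"
    by (rule lipschitz_on_continuous_on[of "1/2"], rule lipschitz_onI) (use D in \<open>auto simp: dist_norm\<close>)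
  show ?thesis
    unfolding ambient_isotopic_def
  proof (intro exI[of _ "\<lambda>p. snd p + fst p *\<^sub>R D (snd p)"] conjI ballI)
    show "continuous_on ({0..1} \<times> UNIV) (\<lambda>p. snd p + fst p *\<^sub>R D (snd p))"
      by (intro continuous_intros continuous_on_compose2[OF contD]) auto
    show "\<exists>G. homeomorphism UNIV UNIV (\<lambda>x. snd (t, x) + fst (t, x) *\<^sub>R D (snd (t, x))) G"
      if "t \<in> {0..1}" for t :: real
      using near_identity_homeomorphism[of D t] D that by simp
  qed (use eq in auto)
qed

text \<open>The last inequality controls the displacement between the curves at times \<open>t\<close> and \<open>t'\<close> as a Lipschitz
  function of the curve parameter.\<close>

definition lipfam :: "real set \<Rightarrow> (real \<Rightarrow> real \<Rightarrow> real) \<Rightarrow> bool" where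
  "lipfam I f \<longleftrightarrow> (\<exists>M\<ge>0. \<forall>t\<in>{0..1}. \<forall>t'\<in>{0..1}. \<forall>u\<in>I. \<forall>v\<in>I.
     \<bar>f t u\<bar> \<le> M \<and> \<bar>f t u - f t' u\<bar> \<le> M * \<bar>t - t'\<bar> \<and> \<bar>f t u - f t v\<bar> \<le> M * \<bar>u - v\<bar> \<and>
     \<bar>f t u - f t' u - (f t v - f t' v)\<bar> \<le> M * \<bar>t - t'\<bar> * \<bar>u - v\<bar>)"

text \<open>Lower bounds are required only near each parameter and at the seam where the curve
  closes; injectivity and compactness turn them into one constant \<open>c\<close> for all chords
  and times. A time step of length at most \<open>c / (6 * M)\<close> then displaces the curve by a
  map with constant 1/6 relative to chords, and finitely many such steps suffice.\<close>

lemma lipfam_isotopy: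
  fixes F :: "real \<Rightarrow> real \<Rightarrow> real^3"
  assumes ab: "a < b"
    and lip: "\<And>i. lipfam {a..b} (\<lambda>t u. F t u $ i)"
    and closed: "\<And>t. t \<in> {0..1} \<Longrightarrow> F t a = F t b"
    and inj: "\<And>t u v. t \<in> {0..1} \<Longrightarrow> u \<in> {a..b} \<Longrightarrow> v \<in> {a..b} \<Longrightarrow> u < v \<Longrightarrow>
       F t u = F t v \<Longrightarrow> u = a \<and> v = b"
    and loc: "\<And>u0. u0 \<in> {a..b} \<Longrightarrow> \<exists>e>0. \<exists>c>0. \<forall>t\<in>{0..1}. \<forall>u\<in>{a..b}. \<forall>v\<in>{a..b}.
       \<bar>u - u0\<bar> < e \<longrightarrow> \<bar>v - u0\<bar> < e \<longrightarrow> u < v \<longrightarrow> c * (v - u) \<le> norm (F t u - F t v)"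
    and seam: "\<exists>e>0. \<exists>c>0. \<forall>t\<in>{0..1}. \<forall>u\<in>{a..b}. \<forall>v\<in>{a..b}.
       u - a < e \<longrightarrow> b - v < e \<longrightarrow> c * ((u - a) + (b - v)) \<le> norm (F t u - F t v)"
  shows "ambient_isotopic (F 0 ` {a..b}) (F 1 ` {a..b})"
proof -
  have "\<exists>M. \<forall>i. M i \<ge> 0 \<and> (\<forall>t\<in>{0..1}. \<forall>t'\<in>{0..1}. \<forall>u\<in>{a..b}. \<forall>v\<in>{a..b}.
     \<bar>F t u $ i\<bar> \<le> M i \<and> \<bar>F t u $ i - F t' u $ i\<bar> \<le> M i * \<bar>t - t'\<bar> \<and>
     \<bar>F t u $ i - F t v $ i\<bar> \<le> M i * \<bar>u - v\<bar> \<and>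
     \<bar>F t u $ i - F t' u $ i - (F t v $ i - F t' v $ i)\<bar> \<le> M i * \<bar>t - t'\<bar> * \<bar>u - v\<bar>)"
    using lip unfolding lipfam_def by (intro choice) blast
  then obtain M0 where M0: "\<And>i. M0 i \<ge> 0" "\<And>i t t' u v. t \<in> {0..1} \<Longrightarrow> t' \<in> {0..1} \<Longrightarrow> u \<in> {a..b} \<Longrightarrow> v \<in> {a..b} \<Longrightarrow>
     \<bar>F t u $ i\<bar> \<le> M0 i \<and> \<bar>F t u $ i - F t' u $ i\<bar> \<le> M0 i * \<bar>t - t'\<bar> \<and>
     \<bar>F t u $ i - F t v $ i\<bar> \<le> M0 i * \<bar>u - v\<bar> \<and>
     \<bar>F t u $ i - F t' u $ i - (F t v $ i - F t' v $ i)\<bar> \<le> M0 i * \<bar>t - t'\<bar> * \<bar>u - v\<bar>"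
    by blast
  define M where "M = 1 + M0 1 + M0 2 + M0 3"
  have Mi: "M0 i \<le> M" for i
    using M0(1)[of 1] M0(1)[of 2] M0(1)[of 3] exhaust_3[of i] by (auto simp: M_def)
  have M1: "M \<ge> 1" using M0(1)[of 1] M0(1)[of 2] M0(1)[of 3] by (simp add: M_def)
  have Mt: "\<bar>F t u $ i - F t' u $ i\<bar> \<le> M * \<bar>t - t'\<bar>"
    if "t \<in> {0..1}" "t' \<in> {0..1}" "u \<in> {a..b}" for i t t' u
    using M0(2)[OF that that(3), of i] mult_right_mono[OF Mi[of i], of "\<bar>t - t'\<bar>"] by auto
  have Mu: "\<bar>F t u $ i - F t v $ i\<bar> \<le> M * \<bar>u - v\<bar>"
    if "t \<in> {0..1}" "u \<in> {a..b}" "v \<in> {a..b}" for i t u v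
    using M0(2)[OF that(1,1) that(2,3), of i] mult_right_mono[OF Mi[of i], of "\<bar>u - v\<bar>"] by auto
  have Mtu: "\<bar>F t u $ i - F t' u $ i - (F t v $ i - F t' v $ i)\<bar> \<le> M * \<bar>t - t'\<bar> * \<bar>u - v\<bar>"
    if "t \<in> {0..1}" "t' \<in> {0..1}" "u \<in> {a..b}" "v \<in> {a..b}" for i t t' u v
    using M0(2)[OF that, of i] mult_right_mono[OF mult_right_mono[OF Mi[of i], of "\<bar>t - t'\<bar>"], of "\<bar>u - v\<bar>"] by auto
  \<comment> \<open>Distance on the circle obtained by gluing \<open>a\<close> to \<open>b\<close>:
    parameters near opposite ends belong to points that are close on the curve.\<close>
  define \<delta> where "\<delta> u v = min \<bar>u - v\<bar> (b - a - \<bar>u - v\<bar>)" for u v :: real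
  have disp: "\<bar>F t u $ i - F t' u $ i - (F t v $ i - F t' v $ i)\<bar> \<le> M * \<bar>t - t'\<bar> * \<delta> u v"
    if tt: "t \<in> {0..1}" "t' \<in> {0..1}" "u \<in> {a..b}" "v \<in> {a..b}" for i t t' u v
  proof -
    \<comment> \<open>The way through the seam: the displacements at \<open>a\<close> and
      \<open>b\<close> agree because the curve is closed at both times.\<close>
    have *: "\<bar>F t u $ i - F t' u $ i - (F t v $ i - F t' v $ i)\<bar> \<le> M * \<bar>t - t'\<bar> * (b - a - (v - u))"
      if uv: "u \<le> v" "u \<in> {a..b}" "v \<in> {a..b}" for u v
    proof -
      have m: "a \<in> {a..b}" "b \<in> {a..b}" using ab by auto
      have 1: "\<bar>F t u $ i - F t' u $ i - (F t a $ i - F t' a $ i)\<bar> \<le> M * \<bar>t - t'\<bar> * (u - a)"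
        using Mtu[OF tt(1,2) uv(2) m(1), of i] uv by simp
      have 2: "\<bar>F t b $ i - F t' b $ i - (F t v $ i - F t' v $ i)\<bar> \<le> M * \<bar>t - t'\<bar> * (b - v)"
        using Mtu[OF tt(1,2) m(2) uv(3), of i] uv by simp
      have "M * \<bar>t - t'\<bar> * (b - a - (v - u)) = M * \<bar>t - t'\<bar> * (u - a) + M * \<bar>t - t'\<bar> * (b - v)"
        by (simp add: algebra_simps)
      with 1 2 closed[OF tt(1)] closed[OF tt(2)] show ?thesis by (simp add: abs_le_iff)
    qed
    have **: "\<bar>F t u $ i - F t' u $ i - (F t v $ i - F t' v $ i)\<bar> \<le> M * \<bar>t - t'\<bar> * (b - a - \<bar>u - v\<bar>)"
    proof (cases "u \<le> v")
      case True
      then show ?thesis using *[of u v] tt by simp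
    next
      case False
      have "\<bar>F t v $ i - F t' v $ i - (F t u $ i - F t' u $ i)\<bar> \<le> M * \<bar>t - t'\<bar> * (b - a - (u - v))"
        using *[of v u] tt False by simp
      then show ?thesis using False by (simp add: abs_minus_commute)
    qed
    show ?thesis using ** Mtu[OF tt, of i] by (auto simp: \<delta>_def min_def)
  qed
  \<comment> \<open>A sequence of ever worse chords has a limit \<open>(t, u, v)\<close> with
    \<open>F t u = F t v\<close>. Injectivity leaves only the seam or \<open>u = v\<close>, and
    there an assumed bound applies to late members of the sequence.\<close>
  have "\<exists>c>0. \<forall>t\<in>{0..1}. \<forall>u\<in>{a..b}. \<forall>v\<in>{a..b}. u \<le> v \<longrightarrow> c * \<delta> u v \<le> norm (F t u - F t v)"
  proof (rule ccontr)
    assume neg: "\<not> ?thesis"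
    have "\<exists>t u v. t \<in> {0..1} \<and> u \<in> {a..b} \<and> v \<in> {a..b} \<and> u \<le> v \<and> norm (F t u - F t v) < inverse (real (Suc n)) * \<delta> u v" for n
    proof -
      have "inverse (real (Suc n)) > 0" by simp
      with neg show ?thesis by (meson linorder_not_less)
    qed
    then obtain T U V where TUV: "\<And>n. T n \<in> {0..1}" "\<And>n. U n \<in> {a..b}" "\<And>n. V n \<in> {a..b}" "\<And>n. U n \<le> V n"
      "\<And>n. norm (F (T n) (U n) - F (T n) (V n)) < inverse (real (Suc n)) * \<delta> (U n) (V n)" by metis
    have "seq_compact ({0..1::real} \<times> {a..b} \<times> {a..b})"
      unfolding compact_eq_seq_compact_metric[symmetric] by (intro compact_Times) auto
    moreover have "\<forall>n. (T n, U n, V n) \<in> {0..1::real} \<times> {a..b} \<times> {a..b}" using TUV(1-3) by simp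
    ultimately obtain l r where l: "l \<in> {0..1::real} \<times> {a..b} \<times> {a..b}" and r: "strict_mono r"
      and lim: "((\<lambda>n. (T n, U n, V n)) \<circ> r) \<longlonglongrightarrow> l"
      by (rule seq_compactE)
    obtain t u v where ltuv: "l = (t, u, v)" by (cases l) auto
    have tuv: "t \<in> {0..1}" "u \<in> {a..b}" "v \<in> {a..b}" using l ltuv by auto
    have limT: "(\<lambda>n. T (r n)) \<longlonglongrightarrow> t" and limU: "(\<lambda>n. U (r n)) \<longlonglongrightarrow> u" and limV: "(\<lambda>n. V (r n)) \<longlonglongrightarrow> v"
      using tendsto_fst[OF lim] tendsto_fst[OF tendsto_snd[OF lim]] tendsto_snd[OF tendsto_snd[OF lim]]
      by (auto simp: ltuv o_def)
    have uv: "u \<le> v" using LIMSEQ_le[OF limU limV] TUV(4) by blast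
    have limF: "(\<lambda>n. F (T (r n)) (W (r n)) $ i) \<longlonglongrightarrow> F t w $ i"
      if W: "\<And>n. W n \<in> {a..b}" "(\<lambda>n. W (r n)) \<longlonglongrightarrow> w" "w \<in> {a..b}" for W w i
    proof -
      have "(\<lambda>n. M * \<bar>T (r n) - t\<bar> + M * \<bar>W (r n) - w\<bar>) \<longlonglongrightarrow> M * \<bar>t - t\<bar> + M * \<bar>w - w\<bar>"
        by (intro tendsto_intros limT W)
      then have lim0: "(\<lambda>n. M * \<bar>T (r n) - t\<bar> + M * \<bar>W (r n) - w\<bar>) \<longlonglongrightarrow> 0" by simp
      have "(\<lambda>n. F (T (r n)) (W (r n)) $ i - F t w $ i) \<longlonglongrightarrow> 0"
      proof (rule Lim_null_comparison[OF _ lim0], intro always_eventually allI)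
        fix n
        show "norm (F (T (r n)) (W (r n)) $ i - F t w $ i) \<le> M * \<bar>T (r n) - t\<bar> + M * \<bar>W (r n) - w\<bar>"
          using Mt[OF TUV(1)[of "r n"] tuv(1) W(1)[of "r n"], of i] Mu[OF tuv(1) W(1)[of "r n"] W(3), of i] by auto
      qed
      then show ?thesis by (simp add: LIM_zero_iff)
    qed
    have lim_norm: "(\<lambda>n. norm (F (T (r n)) (U (r n)) - F (T (r n)) (V (r n)))) \<longlonglongrightarrow> norm (F t u - F t v)"
      by (intro tendsto_norm tendsto_diff vec_tendstoI limF TUV limU limV tuv)
    have \<delta>le: "\<delta> (U n) (V n) \<le> b - a" for n using TUV(2,3)[of n] by (auto simp: \<delta>_def)
    have "(\<lambda>n. inverse (real (Suc (r n))) * (b - a)) \<longlonglongrightarrow> 0 * (b - a)"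
      by (intro tendsto_intros LIMSEQ_subseq_LIMSEQ[OF LIMSEQ_inverse_real_of_nat r, unfolded o_def])
    then have lim1: "(\<lambda>n. inverse (real (Suc (r n))) * (b - a)) \<longlonglongrightarrow> 0" by simp
    have "norm (F t u - F t v) \<le> 0"
    proof (rule LIMSEQ_le[OF lim_norm lim1], intro exI allI impI)
      fix n
      show "norm (F (T (r n)) (U (r n)) - F (T (r n)) (V (r n))) \<le> inverse (real (Suc (r n))) * (b - a)"
        using less_le_trans[OF TUV(5)[of "r n"] mult_left_mono[OF \<delta>le[of "r n"]]] by simp
    qed
    then have Feq: "F t u = F t v" by simp
    have evinv: "eventually (\<lambda>n. inverse (real (Suc (r n))) < c) sequentially" if "c > 0" for c
      using order_tendstoD(2)[OF LIMSEQ_subseq_LIMSEQ[OF LIMSEQ_inverse_real_of_nat r, unfolded o_def] that] .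
    have evU: "eventually (\<lambda>n. \<bar>U (r n) - u\<bar> < e) sequentially" and evV: "eventually (\<lambda>n. \<bar>V (r n) - v\<bar> < e) sequentially" if "e > 0" for e
      using tendstoD[OF limU that] tendstoD[OF limV that] by (simp_all add: dist_real_def)
    have contr: False if "c > 0" "inverse (real (Suc n)) < c" "c * \<delta>' \<le> norm (F (T n) (U n) - F (T n) (V n))" "\<delta> (U n) (V n) \<le> \<delta>'" for n c \<delta>'
    proof -
      have d0: "\<delta> (U n) (V n) \<ge> 0" using TUV(2,3)[of n] by (auto simp: \<delta>_def)
      have "c * \<delta> (U n) (V n) \<le> c * \<delta>'" using that by (intro mult_left_mono) auto
      also have "\<dots> < inverse (real (Suc n)) * \<delta> (U n) (V n)" using that TUV(5)[of n] by simp
      also have "\<dots> \<le> c * \<delta> (U n) (V n)" using that d0 by (intro mult_right_mono) auto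
      finally show False by simp
    qed
    show False
    proof (cases "u < v")
      case True
      then have uab: "u = a" "v = b" using inj[OF tuv True Feq] by auto
      obtain e c where ec: "e > 0" "c > 0" "\<forall>t\<in>{0..1}. \<forall>u\<in>{a..b}. \<forall>v\<in>{a..b}.
         u - a < e \<longrightarrow> b - v < e \<longrightarrow> c * ((u - a) + (b - v)) \<le> norm (F t u - F t v)" using seam by blast
      from eventually_conj[OF evinv[OF ec(2)] eventually_conj[OF evU[OF ec(1)] evV[OF ec(1)]]]
      obtain n where n: "inverse (real (Suc (r n))) < c" "\<bar>U (r n) - u\<bar> < e" "\<bar>V (r n) - v\<bar> < e"
        using eventually_happens'[OF sequentially_bot] by fast
      have "c * ((U (r n) - a) + (b - V (r n))) \<le> norm (F (T (r n)) (U (r n)) - F (T (r n)) (V (r n)))"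
        using ec(3) TUV(1-3)[of "r n"] n uab by auto
      then show False
        by (rule contr[OF ec(2) n(1)]) (use TUV(4)[of "r n"] in \<open>auto simp: \<delta>_def\<close>)
    next
      case False
      then have uv: "v = u" using uv by simp
      obtain e c where ec: "e > 0" "c > 0" "\<forall>t\<in>{0..1}. \<forall>w\<in>{a..b}. \<forall>v\<in>{a..b}.
         \<bar>w - u\<bar> < e \<longrightarrow> \<bar>v - u\<bar> < e \<longrightarrow> w < v \<longrightarrow> c * (v - w) \<le> norm (F t w - F t v)" using loc[OF tuv(2)] by blast
      from eventually_conj[OF evinv[OF ec(2)] eventually_conj[OF evU[OF ec(1)] evV[OF ec(1)]]]
      obtain n where n: "inverse (real (Suc (r n))) < c" "\<bar>U (r n) - u\<bar> < e" "\<bar>V (r n) - v\<bar> < e"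
        using eventually_happens'[OF sequentially_bot] by fast
      have ne: "U (r n) < V (r n)"
        using TUV(4,5)[of "r n"] ab by (cases "U (r n) = V (r n)") (auto simp: \<delta>_def)
      have "c * (V (r n) - U (r n)) \<le> norm (F (T (r n)) (U (r n)) - F (T (r n)) (V (r n)))"
        using ec(3) TUV(1-3)[of "r n"] n uv ne by auto
      then show False
        by (rule contr[OF ec(2) n(1)]) (use ne in \<open>auto simp: \<delta>_def\<close>)
    qed
  qed
  then obtain c where c: "c > 0" and low': "\<And>t u v. t \<in> {0..1} \<Longrightarrow> u \<in> {a..b} \<Longrightarrow> v \<in> {a..b} \<Longrightarrow> u \<le> v \<Longrightarrow> c * \<delta> u v \<le> norm (F t u - F t v)"
    by blast
  have low: "c * \<delta> u v \<le> norm (F t u - F t v)" if "t \<in> {0..1}" "u \<in> {a..b}" "v \<in> {a..b}" for t u v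
    using low'[OF that] low'[OF that(1,3,2)] by (cases "u \<le> v") (auto simp: \<delta>_def abs_minus_commute norm_minus_commute)
  have step: "ambient_isotopic (F t ` {a..b}) (F t' ` {a..b})"
    if t: "t \<in> {0..1}" "t' \<in> {0..1}" "6 * M * \<bar>t - t'\<bar> \<le> c" for t t'
  proof -
    define g where "g x = (SOME u. u \<in> {a..b} \<and> F t u = x)" for x
    define d where "d x = F t' (g x) - F t (g x)" for x
    have g: "g (F t u) \<in> {a..b} \<and> F t (g (F t u)) = F t u" if "u \<in> {a..b}" for u
      unfolding g_def by (rule someI_ex) (use that in blast)
    \<comment> \<open>\<open>g\<close> picks some parameter of a point, which is unique except at
      the seam. The case \<open>v = u\<close> of this bound shows that the choice does not
      matter.\<close>
    have key: "\<bar>d (F t u) $ i - (F t' v - F t v) $ i\<bar> \<le> 1/6 * norm (F t u - F t v)"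
      if uv: "u \<in> {a..b}" "v \<in> {a..b}" for u v i
    proof -
      let ?u = "g (F t u)"
      have "\<bar>d (F t u) $ i - (F t' v - F t v) $ i\<bar> \<le> M * \<bar>t' - t\<bar> * \<delta> ?u v"
        using disp[OF t(2,1) _ uv(2), of ?u i] g[OF uv(1)] by (simp add: d_def)
      also have "6 * (M * \<bar>t' - t\<bar> * \<delta> ?u v) \<le> c * \<delta> ?u v"
        using mult_right_mono[OF t(3), of "\<delta> ?u v"] g[OF uv(1)] uv
        by (auto simp: \<delta>_def abs_minus_commute mult.assoc)
      then have "M * \<bar>t' - t\<bar> * \<delta> ?u v \<le> 1/6 * (c * \<delta> ?u v)" by simp
      also have "\<dots> \<le> 1/6 * norm (F t u - F t v)" using low[OF t(1) _ uv(2), of ?u] g[OF uv(1)] by simp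
      finally show ?thesis .
    qed
    have dF: "d (F t u) = F t' u - F t u" if "u \<in> {a..b}" for u
      using key[OF that that] by (simp add: vec_eq_iff)
    have "ambient_isotopic (F t ` {a..b}) ((\<lambda>x. x + d x) ` (F t ` {a..b}))"
    proof (rule ambient_isotopic_near)
      fix x y i assume "x \<in> F t ` {a..b}" "y \<in> F t ` {a..b}"
      then show "\<bar>d x $ i - d y $ i\<bar> \<le> 1/6 * norm (x - y)" using key dF by auto
    qed
    moreover have "(\<lambda>x. x + d x) ` (F t ` {a..b}) = F t' ` {a..b}"
      unfolding image_image by (rule image_cong) (use dF in auto)
    ultimately show ?thesis by simp
  qed
  obtain N :: nat where N: "6 * M / c < real N" using reals_Archimedean2 by blast
  have "0 < 6 * M / c" using M1 c by simp
  then have N0: "N > 0" using N by (cases N) auto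
  have "ambient_isotopic (F 0 ` {a..b}) (F (real k / real N) ` {a..b})" if "k \<le> N" for k
    using that
  proof (induction k)
    case 0
    then show ?case by (simp add: ambient_isotopic_refl)
  next
    case (Suc k)
    have "real k / real N - real (Suc k) / real N = - (1 / real N)" using N0 by (simp add: field_simps)
    then have "6 * M * \<bar>real k / real N - real (Suc k) / real N\<bar> = 6 * M / real N" by simp
    also have "\<dots> \<le> c" using N c N0 by (simp add: field_simps)
    finally have "ambient_isotopic (F (real k / real N) ` {a..b}) (F (real (Suc k) / real N) ` {a..b})"
      using Suc.prems N0 by (intro step) (auto simp: field_simps)
    with Suc show ?case by (meson Suc_leD ambient_isotopic_trans)
  qed
  from this[of N] show ?thesis using N0 by simp
qed


section \<open>Closure properties of Lipschitz families\<close>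

lemma lipfamI:
  assumes "M \<ge> 0"
    and "\<And>t t' u v. t \<in> {0..1} \<Longrightarrow> t' \<in> {0..1} \<Longrightarrow> u \<in> I \<Longrightarrow> v \<in> I \<Longrightarrow>
     \<bar>f t u\<bar> \<le> M \<and> \<bar>f t u - f t' u\<bar> \<le> M * \<bar>t - t'\<bar> \<and> \<bar>f t u - f t v\<bar> \<le> M * \<bar>u - v\<bar> \<and>
     \<bar>f t u - f t' u - (f t v - f t' v)\<bar> \<le> M * \<bar>t - t'\<bar> * \<bar>u - v\<bar>"
  shows "lipfam I f"
  unfolding lipfam_def using assms by blast

lemma lipfamE:
  assumes "lipfam I f"
  obtains M where "M \<ge> 0" "\<And>t u. t \<in> {0..1} \<Longrightarrow> u \<in> I \<Longrightarrow> \<bar>f t u\<bar> \<le> M"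
    "\<And>t t' u. t \<in> {0..1} \<Longrightarrow> t' \<in> {0..1} \<Longrightarrow> u \<in> I \<Longrightarrow> \<bar>f t u - f t' u\<bar> \<le> M * \<bar>t - t'\<bar>"
    "\<And>t u v. t \<in> {0..1} \<Longrightarrow> u \<in> I \<Longrightarrow> v \<in> I \<Longrightarrow> \<bar>f t u - f t v\<bar> \<le> M * \<bar>u - v\<bar>"
    "\<And>t t' u v. t \<in> {0..1} \<Longrightarrow> t' \<in> {0..1} \<Longrightarrow> u \<in> I \<Longrightarrow> v \<in> I \<Longrightarrow>
       \<bar>f t u - f t' u - (f t v - f t' v)\<bar> \<le> M * \<bar>t - t'\<bar> * \<bar>u - v\<bar>"
  using assms unfolding lipfam_def by blast

lemma lipfam_const: "lipfam I (\<lambda>t u. c)"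
  by (rule lipfamI[of "\<bar>c\<bar>"]) auto

lemma lipfam_param: "lipfam I (\<lambda>t u. t)"
  by (rule lipfamI[of 1]) auto

lemma lipfam_lipschitz:
  assumes "L \<ge> 0" "\<And>u. u \<in> I \<Longrightarrow> \<bar>g u\<bar> \<le> L" "\<And>u v. u \<in> I \<Longrightarrow> v \<in> I \<Longrightarrow> \<bar>g u - g v\<bar> \<le> L * \<bar>u - v\<bar>"
  shows "lipfam I (\<lambda>t u. g u)"
  by (rule lipfamI[of L]) (use assms in auto)

lemma lipfam_id: "lipfam {a..b} (\<lambda>t u. u)"
  by (rule lipfam_lipschitz[of "1 + \<bar>a\<bar> + \<bar>b\<bar>"])
    (auto intro: order_trans[OF _ mult_right_mono[of 1]])

lemma lipfam_add:
  assumes "lipfam I f" "lipfam I g"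
  shows "lipfam I (\<lambda>t u. f t u + g t u)"
proof -
  obtain M N where M: "M \<ge> 0" "\<And>t u. t \<in> {0..1} \<Longrightarrow> u \<in> I \<Longrightarrow> \<bar>f t u\<bar> \<le> M"
    "\<And>t t' u. t \<in> {0..1} \<Longrightarrow> t' \<in> {0..1} \<Longrightarrow> u \<in> I \<Longrightarrow> \<bar>f t u - f t' u\<bar> \<le> M * \<bar>t - t'\<bar>"
    "\<And>t u v. t \<in> {0..1} \<Longrightarrow> u \<in> I \<Longrightarrow> v \<in> I \<Longrightarrow> \<bar>f t u - f t v\<bar> \<le> M * \<bar>u - v\<bar>"
    "\<And>t t' u v. t \<in> {0..1} \<Longrightarrow> t' \<in> {0..1} \<Longrightarrow> u \<in> I \<Longrightarrow> v \<in> I \<Longrightarrow>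
       \<bar>f t u - f t' u - (f t v - f t' v)\<bar> \<le> M * \<bar>t - t'\<bar> * \<bar>u - v\<bar>"
   and N: "N \<ge> 0" "\<And>t u. t \<in> {0..1} \<Longrightarrow> u \<in> I \<Longrightarrow> \<bar>g t u\<bar> \<le> N"
    "\<And>t t' u. t \<in> {0..1} \<Longrightarrow> t' \<in> {0..1} \<Longrightarrow> u \<in> I \<Longrightarrow> \<bar>g t u - g t' u\<bar> \<le> N * \<bar>t - t'\<bar>"
    "\<And>t u v. t \<in> {0..1} \<Longrightarrow> u \<in> I \<Longrightarrow> v \<in> I \<Longrightarrow> \<bar>g t u - g t v\<bar> \<le> N * \<bar>u - v\<bar>"
    "\<And>t t' u v. t \<in> {0..1} \<Longrightarrow> t' \<in> {0..1} \<Longrightarrow> u \<in> I \<Longrightarrow> v \<in> I \<Longrightarrow>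
       \<bar>g t u - g t' u - (g t v - g t' v)\<bar> \<le> N * \<bar>t - t'\<bar> * \<bar>u - v\<bar>"
    using assms by (elim lipfamE) blast
  have tri: "\<bar>a + b - (a' + b')\<bar> \<le> (x + y) * z" if "\<bar>a - a'\<bar> \<le> x * z" "\<bar>b - b'\<bar> \<le> y * z" for a b a' b' x y z :: real
    using that by (auto simp: distrib_right)
  show ?thesis
  proof (rule lipfamI[of "M + N"])
    show "M + N \<ge> 0" using M(1) N(1) by simp
    fix t t' u v :: real assume *: "t \<in> {0..1}" "t' \<in> {0..1}" "u \<in> I" "v \<in> I"
    have 1: "\<bar>f t u + g t u\<bar> \<le> M + N" using M(2)[OF *(1,3)] N(2)[OF *(1,3)] by linarith
    have 2: "\<bar>f t u + g t u - (f t' u + g t' u)\<bar> \<le> (M + N) * \<bar>t - t'\<bar>"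
      by (rule tri[OF M(3)[OF *(1,2,3)] N(3)[OF *(1,2,3)]])
    have 3: "\<bar>f t u + g t u - (f t v + g t v)\<bar> \<le> (M + N) * \<bar>u - v\<bar>"
      by (rule tri[OF M(4)[OF *(1,3,4)] N(4)[OF *(1,3,4)]])
    have "\<bar>(f t u - f t' u) + (g t u - g t' u) - ((f t v - f t' v) + (g t v - g t' v))\<bar> \<le> (M + N) * (\<bar>t - t'\<bar> * \<bar>u - v\<bar>)"
      by (rule tri) (use M(5)[OF *] N(5)[OF *] in \<open>simp_all add: mult.assoc\<close>)
    then have 4: "\<bar>f t u + g t u - (f t' u + g t' u) - (f t v + g t v - (f t' v + g t' v))\<bar> \<le> (M + N) * \<bar>t - t'\<bar> * \<bar>u - v\<bar>"
      by (simp add: algebra_simps)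
    show "\<bar>f t u + g t u\<bar> \<le> M + N \<and> \<bar>f t u + g t u - (f t' u + g t' u)\<bar> \<le> (M + N) * \<bar>t - t'\<bar> \<and>
       \<bar>f t u + g t u - (f t v + g t v)\<bar> \<le> (M + N) * \<bar>u - v\<bar> \<and>
       \<bar>f t u + g t u - (f t' u + g t' u) - (f t v + g t v - (f t' v + g t' v))\<bar> \<le> (M + N) * \<bar>t - t'\<bar> * \<bar>u - v\<bar>"
      using 1 2 3 4 by blast
  qed
qed

lemma lipfam_mult:
  assumes "lipfam I f" "lipfam I g"
  shows "lipfam I (\<lambda>t u. f t u * g t u)"
proof -
  obtain M N where M: "M \<ge> 0" "\<And>t u. t \<in> {0..1} \<Longrightarrow> u \<in> I \<Longrightarrow> \<bar>f t u\<bar> \<le> M"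
    "\<And>t t' u. t \<in> {0..1} \<Longrightarrow> t' \<in> {0..1} \<Longrightarrow> u \<in> I \<Longrightarrow> \<bar>f t u - f t' u\<bar> \<le> M * \<bar>t - t'\<bar>"
    "\<And>t u v. t \<in> {0..1} \<Longrightarrow> u \<in> I \<Longrightarrow> v \<in> I \<Longrightarrow> \<bar>f t u - f t v\<bar> \<le> M * \<bar>u - v\<bar>"
    "\<And>t t' u v. t \<in> {0..1} \<Longrightarrow> t' \<in> {0..1} \<Longrightarrow> u \<in> I \<Longrightarrow> v \<in> I \<Longrightarrow>
       \<bar>f t u - f t' u - (f t v - f t' v)\<bar> \<le> M * \<bar>t - t'\<bar> * \<bar>u - v\<bar>"
   and N: "N \<ge> 0" "\<And>t u. t \<in> {0..1} \<Longrightarrow> u \<in> I \<Longrightarrow> \<bar>g t u\<bar> \<le> N"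
    "\<And>t t' u. t \<in> {0..1} \<Longrightarrow> t' \<in> {0..1} \<Longrightarrow> u \<in> I \<Longrightarrow> \<bar>g t u - g t' u\<bar> \<le> N * \<bar>t - t'\<bar>"
    "\<And>t u v. t \<in> {0..1} \<Longrightarrow> u \<in> I \<Longrightarrow> v \<in> I \<Longrightarrow> \<bar>g t u - g t v\<bar> \<le> N * \<bar>u - v\<bar>"
    "\<And>t t' u v. t \<in> {0..1} \<Longrightarrow> t' \<in> {0..1} \<Longrightarrow> u \<in> I \<Longrightarrow> v \<in> I \<Longrightarrow>
       \<bar>g t u - g t' u - (g t v - g t' v)\<bar> \<le> N * \<bar>t - t'\<bar> * \<bar>u - v\<bar>"
    using assms by (elim lipfamE) blast
  have pr: "\<bar>x * y\<bar> \<le> X * Y" if "\<bar>x\<bar> \<le> X" "\<bar>y\<bar> \<le> Y" for x y X Y :: real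
    unfolding abs_mult using that by (intro mult_mono) auto
  have le4: "k * (M * N) * z \<le> 4 * (M * N) * z" if "z \<ge> 0" "k \<le> 4" for k z
    using that M(1) N(1) by (intro mult_right_mono) auto
  have diff: "\<bar>a * A - b * B\<bar> \<le> 2 * (M * N) * z"
    if "\<bar>a\<bar> \<le> M" "\<bar>B\<bar> \<le> N" "\<bar>a - b\<bar> \<le> M * z" "\<bar>A - B\<bar> \<le> N * z" for a b A B z
  proof -
    have "a * A - b * B = a * (A - B) + (a - b) * B" by (simp add: algebra_simps)
    then have "\<bar>a * A - b * B\<bar> \<le> \<bar>a * (A - B)\<bar> + \<bar>(a - b) * B\<bar>" by linarith
    also have "\<dots> \<le> M * (N * z) + (M * z) * N" using that by (intro add_mono pr)
    finally show ?thesis by (simp add: algebra_simps)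
  qed
  show ?thesis
  proof (rule lipfamI[of "4 * (M * N)"])
    show "4 * (M * N) \<ge> 0" using M(1) N(1) by simp
    fix t t' u v :: real assume *: "t \<in> {0..1}" "t' \<in> {0..1}" "u \<in> I" "v \<in> I"
    have 1: "\<bar>f t u * g t u\<bar> \<le> 4 * (M * N)"
      using pr[OF M(2)[OF *(1,3)] N(2)[OF *(1,3)]] le4[of 1 1] by simp
    have 2: "\<bar>f t u * g t u - f t' u * g t' u\<bar> \<le> 4 * (M * N) * \<bar>t - t'\<bar>"
      using diff[OF M(2)[OF *(1,3)] N(2)[OF *(2,3)] M(3)[OF *(1,2,3)] N(3)[OF *(1,2,3)]] le4[of "\<bar>t - t'\<bar>" 2] by simp
    have 3: "\<bar>f t u * g t u - f t v * g t v\<bar> \<le> 4 * (M * N) * \<bar>u - v\<bar>"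
      using diff[OF M(2)[OF *(1,3)] N(2)[OF *(1,4)] M(4)[OF *(1,3,4)] N(4)[OF *(1,3,4)]] le4[of "\<bar>u - v\<bar>" 2] by simp
    \<comment> \<open>Product rule for mixed differences: four summands, each at most
      \<open>M * N\<close> times the product of the two increments, whence the factor 4.\<close>
    have "f t u * g t u - f t' u * g t' u - (f t v * g t v - f t' v * g t' v) =
      (f t u - f t' u - (f t v - f t' v)) * g t u + f t' u * (g t u - g t' u - (g t v - g t' v))
      + (f t v - f t' v) * (g t u - g t v) + (f t' u - f t' v) * (g t v - g t' v)"
      by (simp add: algebra_simps)
    also have "\<bar>\<dots>\<bar> \<le> (M * \<bar>t - t'\<bar> * \<bar>u - v\<bar>) * N + M * (N * \<bar>t - t'\<bar> * \<bar>u - v\<bar>)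
      + (M * \<bar>t - t'\<bar>) * (N * \<bar>u - v\<bar>) + (M * \<bar>u - v\<bar>) * (N * \<bar>t - t'\<bar>)"
      using M(2-5) N(2-5) * by (intro order_trans[OF abs_triangle_ineq] add_mono pr) auto
    finally have 4: "\<bar>f t u * g t u - f t' u * g t' u - (f t v * g t v - f t' v * g t' v)\<bar> \<le> 4 * (M * N) * \<bar>t - t'\<bar> * \<bar>u - v\<bar>"
      by (simp add: algebra_simps)
    show "\<bar>f t u * g t u\<bar> \<le> 4 * (M * N) \<and> \<bar>f t u * g t u - f t' u * g t' u\<bar> \<le> 4 * (M * N) * \<bar>t - t'\<bar> \<and>
       \<bar>f t u * g t u - f t v * g t v\<bar> \<le> 4 * (M * N) * \<bar>u - v\<bar> \<and>
       \<bar>f t u * g t u - f t' u * g t' u - (f t v * g t v - f t' v * g t' v)\<bar> \<le> 4 * (M * N) * \<bar>t - t'\<bar> * \<bar>u - v\<bar>"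
      using 1 2 3 4 by blast
  qed
qed

lemma lipfam_diff:
  assumes "lipfam I f" "lipfam I g"
  shows "lipfam I (\<lambda>t u. f t u - g t u)"
  using lipfam_add[OF assms(1) lipfam_mult[OF lipfam_const[of I "-1"] assms(2)]] by simp

lemma lipfam_sum:
  assumes "\<And>i. i \<in> A \<Longrightarrow> lipfam I (f i)"
  shows "lipfam I (\<lambda>t u. \<Sum>i\<in>A. f i t u)"
  using assms by (induction A rule: infinite_finite_induct) (auto intro: lipfam_const lipfam_add)

text \<open>Restricted to functions that are constant in time: a kink that moves with time violates
  the bound on mixed differences.\<close>

lemma lipfam_max:
  assumes "lipfam I (\<lambda>_. f)" "lipfam I (\<lambda>_. g)"
  shows "lipfam I (\<lambda>_ u. max (f u) (g u))"
proof -
  obtain M N where M: "M \<ge> 0" "\<And>u. u \<in> I \<Longrightarrow> \<bar>f u\<bar> \<le> M"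
      "\<And>u v. u \<in> I \<Longrightarrow> v \<in> I \<Longrightarrow> \<bar>f u - f v\<bar> \<le> M * \<bar>u - v\<bar>"
    and N: "N \<ge> 0" "\<And>u. u \<in> I \<Longrightarrow> \<bar>g u\<bar> \<le> N"
      "\<And>u v. u \<in> I \<Longrightarrow> v \<in> I \<Longrightarrow> \<bar>g u - g v\<bar> \<le> N * \<bar>u - v\<bar>"
    using assms by (elim lipfamE) (metis atLeastAtMost_iff order_refl zero_le_one)
  show ?thesis
  proof (rule lipfam_lipschitz[of "M + N"])
    show "M + N \<ge> 0" using M(1) N(1) by simp
    show "\<bar>max (f u) (g u)\<bar> \<le> M + N" if "u \<in> I" for u
      using M(1) N(1) M(2)[OF that] N(2)[OF that] by (auto simp: max_def)
    show "\<bar>max (f u) (g u) - max (f v) (g v)\<bar> \<le> (M + N) * \<bar>u - v\<bar>" if "u \<in> I" "v \<in> I" for u v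
      using M(3)[OF that] N(3)[OF that] mult_nonneg_nonneg[OF M(1), of "\<bar>u - v\<bar>"] mult_nonneg_nonneg[OF N(1), of "\<bar>u - v\<bar>"]
      unfolding distrib_right by linarith
  qed
qed

lemma lipfam_min:
  assumes "lipfam I (\<lambda>_. f)" "lipfam I (\<lambda>_. g)"
  shows "lipfam I (\<lambda>_ u. min (f u) (g u))"
proof -
  have "min (f u) (g u) = f u + g u - max (f u) (g u)" for u by (simp add: min_def max_def)
  then show ?thesis using lipfam_diff[OF lipfam_add[OF assms] lipfam_max[OF assms]] by simp
qed

lemma sin_diff_le: "\<bar>sin x - sin y\<bar> \<le> \<bar>x - y\<bar>" for x y :: real
proof -
  have "\<bar>sin x - sin y\<bar> = 2 * (\<bar>sin ((x - y) / 2)\<bar> * \<bar>cos ((x + y) / 2)\<bar>)"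
    by (simp add: sin_diff_sin abs_mult)
  also have "\<dots> \<le> 2 * (\<bar>(x - y) / 2\<bar> * 1)"
    by (intro mult_left_mono mult_mono abs_sin_x_le_abs_x) auto
  finally show ?thesis by simp
qed

lemma lipfam_sin:
  assumes "lipfam I f"
  shows "lipfam I (\<lambda>t u. sin (f t u))"
proof -
  obtain M where M: "M \<ge> 0" "\<And>t u. t \<in> {0..1} \<Longrightarrow> u \<in> I \<Longrightarrow> \<bar>f t u\<bar> \<le> M"
    "\<And>t t' u. t \<in> {0..1} \<Longrightarrow> t' \<in> {0..1} \<Longrightarrow> u \<in> I \<Longrightarrow> \<bar>f t u - f t' u\<bar> \<le> M * \<bar>t - t'\<bar>"
    "\<And>t u v. t \<in> {0..1} \<Longrightarrow> u \<in> I \<Longrightarrow> v \<in> I \<Longrightarrow> \<bar>f t u - f t v\<bar> \<le> M * \<bar>u - v\<bar>"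
    "\<And>t t' u v. t \<in> {0..1} \<Longrightarrow> t' \<in> {0..1} \<Longrightarrow> u \<in> I \<Longrightarrow> v \<in> I \<Longrightarrow>
       \<bar>f t u - f t' u - (f t v - f t' v)\<bar> \<le> M * \<bar>t - t'\<bar> * \<bar>u - v\<bar>"
    using assms by (elim lipfamE) blast
  \<comment> \<open>The points \<open>d\<close>, \<open>c\<close>, \<open>b\<close> are completed to
    a parallelogram by \<open>b + (c - d)\<close>, from which \<open>a\<close> differs by the mixed
    difference. Along two parallel sides of equal length the increments of sine differ by at most
    the product of the side lengths.\<close>
  have mixed: "\<bar>sin a - sin b - (sin c - sin d)\<bar> \<le> \<bar>a - b - (c - d)\<bar> + \<bar>c - d\<bar> * \<bar>b - d\<bar>" for a b c d :: real
  proof -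
    have h: "sin (y + (c - d)) - sin y = 2 * sin ((c - d) / 2) * sin (y + (c - d) / 2 + pi / 2)" for y
      using sin_diff_sin[of "y + (c - d)" y] by (simp add: sin_add add_divide_distrib)
    have "\<bar>(sin (b + (c - d)) - sin b) - (sin (d + (c - d)) - sin d)\<bar>
      = 2 * (\<bar>sin ((c - d) / 2)\<bar> * \<bar>sin (b + (c - d) / 2 + pi / 2) - sin (d + (c - d) / 2 + pi / 2)\<bar>)"
      unfolding h right_diff_distrib[symmetric] abs_mult by simp
    also have "\<dots> \<le> 2 * (\<bar>(c - d) / 2\<bar> * \<bar>(b + (c - d) / 2 + pi / 2) - (d + (c - d) / 2 + pi / 2)\<bar>)"
      by (intro mult_left_mono mult_mono abs_sin_x_le_abs_x sin_diff_le) auto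
    finally have "\<bar>(sin (b + (c - d)) - sin b) - (sin c - sin d)\<bar> \<le> \<bar>c - d\<bar> * \<bar>b - d\<bar>" by simp
    moreover have "\<bar>sin a - sin (b + (c - d))\<bar> \<le> \<bar>a - b - (c - d)\<bar>"
      using sin_diff_le[of a "b + (c - d)"] by (simp add: algebra_simps)
    ultimately show ?thesis by linarith
  qed
  show ?thesis
  proof (rule lipfamI[of "1 + M + M * M"])
    show "1 + M + M * M \<ge> 0" using M(1) by simp
    fix t t' u v :: real assume *: "t \<in> {0..1}" "t' \<in> {0..1}" "u \<in> I" "v \<in> I"
    have le: "x * z \<le> (1 + M + M * M) * z" if "z \<ge> 0" "x \<in> {M, M + M * M}" for x z
      using that M(1) by (intro mult_right_mono) auto
    have 1: "\<bar>sin (f t u)\<bar> \<le> 1 + M + M * M" using M(1) abs_sin_le_one[of "f t u"] mult_nonneg_nonneg[OF M(1) M(1)] by linarith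
    have 2: "\<bar>sin (f t u) - sin (f t' u)\<bar> \<le> (1 + M + M * M) * \<bar>t - t'\<bar>"
      using order_trans[OF sin_diff_le M(3)[OF *(1,2,3)]] le[of "\<bar>t - t'\<bar>" M] by simp
    have 3: "\<bar>sin (f t u) - sin (f t v)\<bar> \<le> (1 + M + M * M) * \<bar>u - v\<bar>"
      using order_trans[OF sin_diff_le M(4)[OF *(1,3,4)]] le[of "\<bar>u - v\<bar>" M] by simp
    have "\<bar>sin (f t u) - sin (f t' u) - (sin (f t v) - sin (f t' v))\<bar> \<le>
       M * \<bar>t - t'\<bar> * \<bar>u - v\<bar> + (M * \<bar>t - t'\<bar>) * (M * \<bar>u - v\<bar>)"
      by (rule order_trans[OF mixed], intro add_mono mult_mono M(3-5) *) (use M(1) in auto)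
    also have "\<dots> = (M + M * M) * (\<bar>t - t'\<bar> * \<bar>u - v\<bar>)" by (simp add: algebra_simps)
    also have "\<dots> \<le> (1 + M + M * M) * (\<bar>t - t'\<bar> * \<bar>u - v\<bar>)" by (intro le) auto
    finally show "\<bar>sin (f t u)\<bar> \<le> 1 + M + M * M \<and> \<bar>sin (f t u) - sin (f t' u)\<bar> \<le> (1 + M + M * M) * \<bar>t - t'\<bar> \<and>
       \<bar>sin (f t u) - sin (f t v)\<bar> \<le> (1 + M + M * M) * \<bar>u - v\<bar> \<and>
       \<bar>sin (f t u) - sin (f t' u) - (sin (f t v) - sin (f t' v))\<bar> \<le> (1 + M + M * M) * \<bar>t - t'\<bar> * \<bar>u - v\<bar>"
      using 1 2 3 by (simp add: mult.assoc)
  qed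
qed

lemma lipfam_cos:
  assumes "lipfam I f"
  shows "lipfam I (\<lambda>t u. cos (f t u))"
proof -
  have "cos x = sin (x + pi / 2)" for x :: real by (simp add: sin_add)
  then show ?thesis using lipfam_sin[OF lipfam_add[OF assms lipfam_const]] by simp
qed

text \<open>The axes of \<open>torus_point\<close> and \<open>tube\<close> differ by this rotation.
  The segment from the identity to the permutation \<open>P\<close> consists of invertible maps:
  with \<open>a = 1 - t\<close>, since the cube of \<open>P\<close> is the identity,
  \<open>(a + t P) (a^2 - a t P + t^2 P^2) = a^3 + t^3\<close>, which also provides the
  inverse.\<close>

lemma ambient_isotopic_permute:
  "ambient_isotopic K ((\<lambda>x. vector [x $ 2, x $ 3, x $ 1] :: real^3) ` K)"
proof -
  define P :: "real^3 \<Rightarrow> real^3" where "P x = vector [x $ 2, x $ 3, x $ 1]" for x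
  define H where "H p = (1 - fst p) *\<^sub>R snd p + fst p *\<^sub>R P (snd p)" for p
  have P: "P x $ 1 = x $ 2" "P x $ 2 = x $ 3" "P x $ 3 = x $ 1" for x by (simp_all add: P_def)
  have contP: "continuous_on UNIV P"
  proof -
    have "P = (\<lambda>x. \<chi> i. x $ (if i = 1 then 2 else if i = 2 then 3 else 1))"
      by (simp add: fun_eq_iff vec_eq_iff forall_3 P)
    then show ?thesis by (simp only:) (intro continuous_intros)
  qed
  have homeo: "\<exists>G. homeomorphism UNIV UNIV (\<lambda>x. H (t, x)) G" if t: "t \<in> {0..1}" for t
  proof -
    define a where "a = 1 - t"
    define D where "D = a^3 + t^3"
    have D: "D > 0"
    proof (cases "t = 0")
      case False
      then have "t^3 > 0" "a^3 \<ge> 0" using t by (auto simp: a_def)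
      then show ?thesis unfolding D_def by (rule add_nonneg_pos[rotated])
    qed (simp add: D_def a_def)
    define G where "G y = (1 / D) *\<^sub>R (a^2 *\<^sub>R y - (a * t) *\<^sub>R P y + t^2 *\<^sub>R P (P y))" for y
    have GH: "G (H (t, x)) = x" for x
    proof -
      have h: "H (t, x) $ 1 = a * x $ 1 + t * x $ 2" "H (t, x) $ 2 = a * x $ 2 + t * x $ 3"
          "H (t, x) $ 3 = a * x $ 3 + t * x $ 1"
        by (simp_all add: H_def a_def P)
      have "a^2 *\<^sub>R H (t, x) - (a * t) *\<^sub>R P (H (t, x)) + t^2 *\<^sub>R P (P (H (t, x))) = D *\<^sub>R x"
        unfolding vec_eq_iff forall_3 D_def
        by (simp add: P h power2_eq_square power3_eq_cube) (simp add: algebra_simps)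
      then show ?thesis using D by (simp add: G_def)
    qed
    have HG: "H (t, G y) = y" for y
    proof -
      have g: "D * G y $ 1 = a^2 * y $ 1 - a * t * y $ 2 + t^2 * y $ 3"
          "D * G y $ 2 = a^2 * y $ 2 - a * t * y $ 3 + t^2 * y $ 1"
          "D * G y $ 3 = a^2 * y $ 3 - a * t * y $ 1 + t^2 * y $ 2"
        using D by (simp_all add: G_def P)
      have "D * (a * G y $ 1 + t * G y $ 2) = D * y $ 1" "D * (a * G y $ 2 + t * G y $ 3) = D * y $ 2"
          "D * (a * G y $ 3 + t * G y $ 1) = D * y $ 3"
        using g unfolding D_def by algebra+
      then show ?thesis using D by (simp add: vec_eq_iff forall_3 H_def P a_def[symmetric])
    qed
    have "continuous_on UNIV G"
      unfolding G_def by (intro continuous_intros continuous_on_compose2[OF contP]) auto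
    moreover have "continuous_on UNIV (\<lambda>x. H (t, x))"
      unfolding H_def by (intro continuous_intros continuous_on_compose2[OF contP]) auto
    ultimately have "homeomorphism UNIV UNIV (\<lambda>x. H (t, x)) G"
      unfolding homeomorphism_def using GH HG by (auto simp: image_def) (metis HG, metis GH)
    then show ?thesis by blast
  qed
  have "continuous_on ({0..1} \<times> UNIV) H"
    unfolding H_def by (intro continuous_intros continuous_on_compose2[OF contP]) auto
  moreover have "(\<lambda>x. H (1, x)) ` K = P ` K" "\<forall>x. H (0, x) = x" by (simp_all add: H_def)
  ultimately show ?thesis using homeo unfolding ambient_isotopic_def P_def by blast
qed



subsection \<open>Coordinates around a circle\<close>

lemma norm3_squared: "(norm (x::real^3))\<^sup>2 = (x $ 1)\<^sup>2 + (x $ 2)\<^sup>2 + (x $ 3)\<^sup>2"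
  unfolding power2_norm_eq_inner by (simp add: inner_vec_def sum_3 power2_eq_square)

lemma chord_bound:
  fixes x :: real
  assumes "\<bar>x\<bar> \<le> 1"
  shows "\<bar>x\<bar> / 2 \<le> \<bar>sin x\<bar>"
proof -
  have *: "x / 2 \<le> sin x" if "0 \<le> x" "x \<le> 1" for x :: real
  proof -
    have "sin 0 - 0 / 2 \<le> sin x - x / 2"
    proof (rule DERIV_nonneg_imp_nondecreasing[OF that(1)])
      fix y :: real assume y: "0 \<le> y" "y \<le> x"
      have "cos (pi / 3) \<le> cos y"
        by (rule cos_monotone_0_pi_le) (use y that pi_gt3 in auto)
      then show "\<exists>d. ((\<lambda>y. sin y - y / 2) has_real_derivative d) (at y) \<and> 0 \<le> d"
        by (intro exI[of _ "cos y - 1/2"]) (auto intro!: derivative_eq_intros simp: cos_60)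
    qed
    then show ?thesis by simp
  qed
  show ?thesis using *[of x] *[of "-x"] assms by (cases "x \<ge> 0") auto
qed

lemma sin_pi_shift: "n \<in> \<int> \<Longrightarrow> \<bar>sin (pi * (x + n))\<bar> = \<bar>sin (pi * x)\<bar>"
proof -
  assume "n \<in> \<int>"
  then obtain k where "n = of_int k" by (elim Ints_cases)
  then show ?thesis by (simp add: distrib_left sin_add abs_mult cos_npi_int sin_npi_int)
qed

text \<open>The angles \<open>A\<close> and \<open>B\<close> are measured in full turns. The core is the circle \<open>\<rho> = 0\<close>; the coordinate axes
  are those of \<^const>\<open>torus_point\<close>, permuted cyclically, so that the third axis meets the core.\<close>

definition tube :: "real \<Rightarrow> real \<Rightarrow> real \<Rightarrow> real^3" where
  "tube \<rho> A B = vector [(2 + \<rho> * cos (2 * pi * B)) * sin (2 * pi * A), \<rho> * sin (2 * pi * B),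
     (2 + \<rho> * cos (2 * pi * B)) * cos (2 * pi * A)]"

lemma tube_nth:
  "tube \<rho> A B $ 1 = (2 + \<rho> * cos (2 * pi * B)) * sin (2 * pi * A)"
  "tube \<rho> A B $ 2 = \<rho> * sin (2 * pi * B)"
  "tube \<rho> A B $ 3 = (2 + \<rho> * cos (2 * pi * B)) * cos (2 * pi * A)"
  by (simp_all add: tube_def)

text \<open>The law of cosines, with the cosine replaced by the squared sine of the half angle. For
  nonnegative radii both summands are nonnegative, so each is a lower bound, and a vanishing
  distance splits into two equations.\<close>

lemma polar_dist:
  fixes R R' a a' :: real
  shows "(R * sin a - R' * sin a')\<^sup>2 + (R * cos a - R' * cos a')\<^sup>2 =
     (R - R')\<^sup>2 + 4 * (R * R') * (sin ((a - a') / 2))\<^sup>2"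
proof -
  have c: "cos (a - a') = 1 - 2 * (sin ((a - a') / 2))\<^sup>2"
  proof -
    have "cos (2 * ((a - a') / 2)) = 1 - 2 * (sin ((a - a') / 2))\<^sup>2" by (rule cos_double_sin)
    moreover have "2 * ((a - a') / 2) = a - a'" by simp
    ultimately show ?thesis by (simp only:)
  qed
  have "(R * sin a - R' * sin a')\<^sup>2 + (R * cos a - R' * cos a')\<^sup>2 =
      (R - R')\<^sup>2 + 2 * (R * R') * (1 - (cos a * cos a' + sin a * sin a'))"
    using sin_cos_squared_add[of a] sin_cos_squared_add[of a'] by algebra
  also have "cos a * cos a' + sin a * sin a' = cos (a - a')" by (simp add: cos_diff)
  finally show ?thesis unfolding c by (simp add: algebra_simps)
qed

lemma tube_radius_ge: "\<bar>\<rho>\<bar> \<le> 1 \<Longrightarrow> 1 \<le> 2 + \<rho> * cos b" for \<rho> b :: real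
proof -
  assume "\<bar>\<rho>\<bar> \<le> 1"
  then have "\<bar>\<rho> * cos b\<bar> \<le> 1 * 1" unfolding abs_mult by (intro mult_mono) auto
  then show ?thesis by linarith
qed

text \<open>\<open>n\<close> removes full turns. The range 1/4 goes with \<open>pi < 4\<close>: it
  brings the argument of the sine down to at most 1, where \<open>chord_bound\<close>
  applies.\<close>

lemma angle_sin_bound:
  fixes A A' n :: real
  assumes n: "n \<in> \<int>" "\<bar>A' - A - n\<bar> \<le> 1/4"
  shows "(A' - A - n)\<^sup>2 \<le> 4 * (sin (pi * (A - A')))\<^sup>2"
proof -
  let ?d = "A' - A - n"
  have "\<bar>pi * ?d\<bar> \<le> 4 * (1/4)" unfolding abs_mult using pi_less_4 n by (intro mult_mono) auto
  then have "\<bar>pi * ?d\<bar> / 2 \<le> \<bar>sin (pi * ?d)\<bar>" by (intro chord_bound) simp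
  also have "\<bar>sin (pi * ?d)\<bar> = \<bar>sin (pi * (A' - A))\<bar>" using sin_pi_shift[of "- n" "A' - A"] n by simp
  also have "\<dots> = \<bar>sin (pi * (A - A'))\<bar>"
    using sin_minus[of "pi * (A' - A)"] by (metis abs_minus_cancel minus_diff_eq mult_minus_right)
  finally have 1: "\<bar>pi * ?d\<bar> \<le> \<bar>2 * sin (pi * (A - A'))\<bar>" by simp
  have "\<bar>?d\<bar> \<le> \<bar>pi * ?d\<bar>" using pi_ge_two by (simp add: abs_mult mult_le_cancel_right1)
  with 1 have "?d\<^sup>2 \<le> (2 * sin (pi * (A - A')))\<^sup>2"
    unfolding abs_le_square_iff[symmetric] by linarith
  then show ?thesis by (simp add: power_mult_distrib)
qed

lemma polar_angle_bound:
  fixes R R' A A' :: real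
  assumes R: "1 \<le> R" "1 \<le> R'" and n: "n \<in> \<int>" "\<bar>A' - A - n\<bar> \<le> 1/4"
  shows "(A' - A - n)\<^sup>2 \<le> (R * sin (2 * pi * A) - R' * sin (2 * pi * A'))\<^sup>2 + (R * cos (2 * pi * A) - R' * cos (2 * pi * A'))\<^sup>2"
proof -
  have h: "(2 * pi * x - 2 * pi * y) / 2 = pi * (x - y)" for x y :: real
    by (simp add: diff_divide_distrib right_diff_distrib)
  have "(A' - A - n)\<^sup>2 \<le> 4 * (1 * 1) * (sin (pi * (A - A')))\<^sup>2" using angle_sin_bound[OF n] by simp
  also have "\<dots> \<le> 4 * (R * R') * (sin (pi * (A - A')))\<^sup>2"
    using R by (intro mult_right_mono mult_left_mono mult_mono) auto
  also have "\<dots> \<le> (R - R')\<^sup>2 + \<dots>" by simp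
  finally show ?thesis unfolding polar_dist h .
qed

text \<open>\<open>polar_dist\<close> twice: around the axis of rotation, then around the core
  within a half-plane.\<close>

lemma tube_dist:
  "(norm (tube \<rho> A B - tube \<rho>' A' B'))\<^sup>2 = (\<rho> - \<rho>')\<^sup>2 + 4 * (\<rho> * \<rho>') * (sin (pi * (B - B')))\<^sup>2
     + 4 * ((2 + \<rho> * cos (2 * pi * B)) * (2 + \<rho>' * cos (2 * pi * B'))) * (sin (pi * (A - A')))\<^sup>2"
proof -
  have h: "(2 * pi * x - 2 * pi * y) / 2 = pi * (x - y)" for x y :: real
    by (simp add: diff_divide_distrib right_diff_distrib)
  let ?R = "2 + \<rho> * cos (2 * pi * B)" and ?R' = "2 + \<rho>' * cos (2 * pi * B')"
  have "(norm (tube \<rho> A B - tube \<rho>' A' B'))\<^sup>2 =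
     ((?R * sin (2 * pi * A) - ?R' * sin (2 * pi * A'))\<^sup>2 + (?R * cos (2 * pi * A) - ?R' * cos (2 * pi * A'))\<^sup>2)
     + (\<rho> * sin (2 * pi * B) - \<rho>' * sin (2 * pi * B'))\<^sup>2"
    by (simp add: norm3_squared tube_nth)
  also have "\<dots> = (\<rho> * sin (2 * pi * B) - \<rho>' * sin (2 * pi * B'))\<^sup>2 + (\<rho> * cos (2 * pi * B) - \<rho>' * cos (2 * pi * B'))\<^sup>2
     + 4 * (?R * ?R') * (sin (pi * (A - A')))\<^sup>2"
    unfolding polar_dist[of ?R] h by simp
  finally show ?thesis unfolding polar_dist h by simp
qed

lemma tube_angle_bound:
  assumes r: "0 \<le> \<rho>" "\<rho> \<le> 1" "0 \<le> \<rho>'" "\<rho>' \<le> 1" and n: "n \<in> \<int>" "\<bar>A' - A - n\<bar> \<le> 1/4"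
  shows "\<bar>A' - A - n\<bar> \<le> norm (tube \<rho> A B - tube \<rho>' A' B')"
proof -
  let ?R = "2 + \<rho> * cos (2 * pi * B)" and ?R' = "2 + \<rho>' * cos (2 * pi * B')"
  have R: "?R \<ge> 1" "?R' \<ge> 1" using r tube_radius_ge[of \<rho> "2 * pi * B"] tube_radius_ge[of \<rho>' "2 * pi * B'"] by auto
  have "(A' - A - n)\<^sup>2 \<le> 4 * (1 * 1) * (sin (pi * (A - A')))\<^sup>2" using angle_sin_bound[OF n] by simp
  also have "\<dots> \<le> 4 * (?R * ?R') * (sin (pi * (A - A')))\<^sup>2"
    using R by (intro mult_right_mono mult_left_mono mult_mono) auto
  also have "\<dots> \<le> (norm (tube \<rho> A B - tube \<rho>' A' B'))\<^sup>2"
    unfolding tube_dist using r by simp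
  finally show ?thesis unfolding abs_le_square_iff[symmetric] by simp
qed

text \<open>The factor \<open>c\<close> reflects that close to the core the meridional angle hardly
  moves a point.\<close>

lemma tube_meridian_bound:
  assumes "\<bar>\<rho>\<bar> \<le> 1" "\<bar>\<rho>'\<bar> \<le> 1" "0 \<le> c" "c \<le> \<rho>" "c \<le> \<rho>'" "\<bar>B' - B\<bar> \<le> 1/4"
  shows "c * \<bar>B' - B\<bar> \<le> norm (tube \<rho> A B - tube \<rho>' A' B')"
proof -
  have "\<bar>pi * (B - B')\<bar> \<le> 4 * (1/4)" unfolding abs_mult using pi_less_4 assms(6) by (intro mult_mono) (auto simp: abs_minus_commute)
  then have "\<bar>pi * (B - B')\<bar> / 2 \<le> \<bar>sin (pi * (B - B'))\<bar>" by (intro chord_bound) simp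
  moreover have "\<bar>B - B'\<bar> \<le> \<bar>pi * (B - B')\<bar>" using pi_ge_two by (simp add: abs_mult mult_le_cancel_right1)
  ultimately have "\<bar>B - B'\<bar> \<le> \<bar>2 * sin (pi * (B - B'))\<bar>" by simp
  then have "(B - B')\<^sup>2 \<le> 4 * (sin (pi * (B - B')))\<^sup>2"
    unfolding abs_le_square_iff by (simp add: power_mult_distrib)
  then have "c\<^sup>2 * (B - B')\<^sup>2 \<le> c\<^sup>2 * (4 * (sin (pi * (B - B')))\<^sup>2)" by (intro mult_left_mono) auto
  also have "\<dots> = 4 * (c * c) * (sin (pi * (B - B')))\<^sup>2" by (simp add: power2_eq_square)
  also have "\<dots> \<le> 4 * (\<rho> * \<rho>') * (sin (pi * (B - B')))\<^sup>2"
    using assms by (intro mult_right_mono mult_left_mono mult_mono) auto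
  also have "\<dots> \<le> (norm (tube \<rho> A B - tube \<rho>' A' B'))\<^sup>2"
  proof -
    have "0 \<le> 4 * ((2 + \<rho> * cos (2 * pi * B)) * (2 + \<rho>' * cos (2 * pi * B'))) * (sin (pi * (A - A')))\<^sup>2"
      using tube_radius_ge[OF assms(1), of "2 * pi * B"] tube_radius_ge[OF assms(2), of "2 * pi * B'"]
      by (intro mult_nonneg_nonneg) auto
    then show ?thesis unfolding tube_dist by simp
  qed
  finally have "(c * (B' - B))\<^sup>2 \<le> (norm (tube \<rho> A B - tube \<rho>' A' B'))\<^sup>2"
    by (simp add: power_mult_distrib power2_commute)
  then show ?thesis unfolding abs_le_square_iff[symmetric] using assms by (simp add: abs_mult)
qed

lemma sin_pi_eq_0_iff: "sin (pi * x) = 0 \<longleftrightarrow> x \<in> \<int>" for x :: real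
proof -
  have "sin (pi * x) = 0 \<longleftrightarrow> (\<exists>i::int. x = of_int i)"
    unfolding sin_zero_iff_int2 by (auto simp: mult.commute)
  then show ?thesis by (auto elim: Ints_cases)
qed

lemma tube_eqD:
  assumes eq: "tube \<rho> A B = tube \<rho>' A' B'" and r: "0 \<le> \<rho>" "\<rho> \<le> 1" "0 \<le> \<rho>'" "\<rho>' \<le> 1"
  shows "\<rho> = \<rho>'" "A' - A \<in> \<int>" "\<rho> = 0 \<or> B' - B \<in> \<int>"
proof -
  let ?R = "2 + \<rho> * cos (2 * pi * B)" and ?R' = "2 + \<rho>' * cos (2 * pi * B')"
  have R: "?R \<ge> 1" "?R' \<ge> 1" using r tube_radius_ge[of \<rho> "2 * pi * B"] tube_radius_ge[of \<rho>' "2 * pi * B'"] by auto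
  define x y z where "x = (\<rho> - \<rho>')\<^sup>2" and "y = 4 * (\<rho> * \<rho>') * (sin (pi * (B - B')))\<^sup>2"
    and "z = 4 * (?R * ?R') * (sin (pi * (A - A')))\<^sup>2"
  have nn: "x \<ge> 0" "y \<ge> 0" "z \<ge> 0"
    unfolding x_def y_def z_def using r R by (auto intro!: mult_nonneg_nonneg)
  have "x + y + z = 0"
    using tube_dist[of \<rho> A B \<rho>' A' B'] by (simp add: eq x_def y_def z_def)
  with nn have 0: "x = 0" "y = 0" "z = 0" by linarith+
  show "\<rho> = \<rho>'" using 0(1) by (simp add: x_def)
  have "sin (pi * (A - A')) = 0" using 0(3) R by (simp add: z_def)
  then show "A' - A \<in> \<int>" unfolding sin_pi_eq_0_iff by (metis Ints_minus minus_diff_eq)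
  show "\<rho> = 0 \<or> B' - B \<in> \<int>"
  proof (cases "\<rho> = 0")
    case False
    then have "sin (pi * (B - B')) = 0" using 0(2) \<open>\<rho> = \<rho>'\<close> by (simp add: y_def)
    then show ?thesis unfolding sin_pi_eq_0_iff by (metis Ints_minus minus_diff_eq)
  qed simp
qed

lemma tube_cong:
  assumes "A' - A \<in> \<int>" "\<rho> = 0 \<or> B' - B \<in> \<int>"
  shows "tube \<rho> A B = tube \<rho> A' B'"
proof -
  have per: "sin (2 * pi * x) = sin (2 * pi * y) \<and> cos (2 * pi * x) = cos (2 * pi * y)" if d: "y - x \<in> \<int>" for x y :: real
  proof -
    obtain k :: int where "y - x = of_int k" using d by (elim Ints_cases)
    then have "2 * pi * y = 2 * pi * x + 2 * pi * of_int k" by (simp add: algebra_simps)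
    then have "sin (2 * pi * y) = sin (2 * pi * x) \<and> cos (2 * pi * y) = cos (2 * pi * x)"
      unfolding sin_cos_eq_iff by blast
    then show ?thesis by simp
  qed
  show ?thesis
  proof (cases "\<rho> = 0")
    case True
    then show ?thesis by (simp add: tube_def per[OF assms(1)])
  next
    case False
    then have "B' - B \<in> \<int>" using assms(2) by simp
    from per[OF this] per[OF assms(1)] show ?thesis unfolding tube_def by (simp only:)
  qed
qed

lemma lipfam_tube:
  assumes "lipfam I \<rho>" "lipfam I A" "lipfam I B"
  shows "lipfam I (\<lambda>t u. tube (\<rho> t u) (A t u) (B t u) $ i)"
proof -
  have "lipfam I (\<lambda>t u. (2 + \<rho> t u * cos (2 * pi * B t u)) * sin (2 * pi * A t u))"
    "lipfam I (\<lambda>t u. \<rho> t u * sin (2 * pi * B t u))"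
    "lipfam I (\<lambda>t u. (2 + \<rho> t u * cos (2 * pi * B t u)) * cos (2 * pi * A t u))"
    by (intro lipfam_add lipfam_mult lipfam_sin lipfam_cos lipfam_const assms)+
  then show ?thesis using exhaust_3[of i] by (elim disjE) (simp_all only: tube_nth)
qed


text \<open>Translates \<open>lipfam_isotopy\<close> into the three coordinates. Near each parameter
  one of the angles has to grow at a definite rate; the meridional one counts only at a definite
  distance from the core. At the seam the longitudinal angle has to grow on both sides.\<close>

lemma tube_family_isotopy:
  fixes \<rho> A B :: "real \<Rightarrow> real \<Rightarrow> real"
  assumes ab: "a < b"
    and lip: "lipfam {a..b} \<rho>" "lipfam {a..b} A" "lipfam {a..b} B"
    and rho: "\<And>t u. t \<in> {0..1} \<Longrightarrow> u \<in> {a..b} \<Longrightarrow> 0 \<le> \<rho> t u \<and> \<rho> t u \<le> 1"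
    and closed: "\<And>t. t \<in> {0..1} \<Longrightarrow> \<rho> t b = \<rho> t a \<and> A t b - A t a \<in> \<int> \<and> (\<rho> t a = 0 \<or> B t b - B t a \<in> \<int>)"
    and inj: "\<And>t u v. t \<in> {0..1} \<Longrightarrow> u \<in> {a..b} \<Longrightarrow> v \<in> {a..b} \<Longrightarrow> u < v \<Longrightarrow> \<rho> t u = \<rho> t v \<Longrightarrow>
       A t v - A t u \<in> \<int> \<Longrightarrow> \<rho> t u = 0 \<or> B t v - B t u \<in> \<int> \<Longrightarrow> u = a \<and> v = b"
    and loc: "\<And>u0. u0 \<in> {a..b} \<Longrightarrow> \<exists>e>0. \<exists>c>0.
       (\<forall>t\<in>{0..1}. \<forall>u\<in>{a..b}. \<forall>v\<in>{a..b}. \<bar>u - u0\<bar> < e \<longrightarrow> \<bar>v - u0\<bar> < e \<longrightarrow> u < v \<longrightarrow> c * (v - u) \<le> A t v - A t u) \<or>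
       (\<forall>t\<in>{0..1}. \<forall>u\<in>{a..b}. \<forall>v\<in>{a..b}. \<bar>u - u0\<bar> < e \<longrightarrow> \<bar>v - u0\<bar> < e \<longrightarrow> u < v \<longrightarrow>
          c * (v - u) \<le> B t v - B t u \<and> c \<le> \<rho> t u \<and> c \<le> \<rho> t v)"
    and seam: "\<exists>e>0. \<exists>c>0. \<forall>t\<in>{0..1}. \<forall>u\<in>{a..b}. \<forall>v\<in>{a..b}. u - a < e \<longrightarrow> b - v < e \<longrightarrow>
       c * (u - a) \<le> A t u - A t a \<and> c * (b - v) \<le> A t b - A t v"
  shows "ambient_isotopic ((\<lambda>u. tube (\<rho> 0 u) (A 0 u) (B 0 u)) ` {a..b}) ((\<lambda>u. tube (\<rho> 1 u) (A 1 u) (B 1 u)) ` {a..b})"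
proof -
  obtain MA where MA: "MA \<ge> 0" "\<And>t u v. t \<in> {0..1} \<Longrightarrow> u \<in> {a..b} \<Longrightarrow> v \<in> {a..b} \<Longrightarrow> \<bar>A t u - A t v\<bar> \<le> MA * \<bar>u - v\<bar>"
    using lip(2) by (elim lipfamE) blast
  obtain MB where MB: "MB \<ge> 0" "\<And>t u v. t \<in> {0..1} \<Longrightarrow> u \<in> {a..b} \<Longrightarrow> v \<in> {a..b} \<Longrightarrow> \<bar>B t u - B t v\<bar> \<le> MB * \<bar>u - v\<bar>"
    using lip(3) by (elim lipfamE) blast
  \<comment> \<open>Within this distance neither angle changes by more than 1/8, so two such changes
    remain in the range 1/4 of the chord bounds.\<close>
  define \<epsilon> where "\<epsilon> = 1 / (8 * (1 + MA + MB))"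
  have \<epsilon>: "\<epsilon> > 0" using MA(1) MB(1) by (simp add: \<epsilon>_def)
  have small: "M * x \<le> 1/8" if "M = MA \<or> M = MB" "x \<le> \<epsilon>" "x \<ge> 0" for M x
  proof -
    have "M * x \<le> (1 + MA + MB) * \<epsilon>" using that MA(1) MB(1) by (intro mult_mono) auto
    also have "\<dots> = 1/8" using MA(1) MB(1) by (simp add: \<epsilon>_def)
    finally show ?thesis .
  qed
  show ?thesis
  proof (rule lipfam_isotopy[OF ab, where F = "\<lambda>t u. tube (\<rho> t u) (A t u) (B t u)"])
    show "lipfam {a..b} (\<lambda>t u. tube (\<rho> t u) (A t u) (B t u) $ i)" for i
      by (rule lipfam_tube[OF lip])
    show "tube (\<rho> t a) (A t a) (B t a) = tube (\<rho> t b) (A t b) (B t b)" if "t \<in> {0..1}" for t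
      using closed[OF that] tube_cong[of "A t b" "A t a" "\<rho> t a" "B t b" "B t a"] by metis
    show "u = a \<and> v = b"
      if "t \<in> {0..1}" "u \<in> {a..b}" "v \<in> {a..b}" "u < v" "tube (\<rho> t u) (A t u) (B t u) = tube (\<rho> t v) (A t v) (B t v)" for t u v
      using tube_eqD[OF that(5)] rho[OF that(1,2)] rho[OF that(1,3)] by (intro inj[OF that(1-4)]) auto
    show "\<exists>e>0. \<exists>c>0. \<forall>t\<in>{0..1}. \<forall>u\<in>{a..b}. \<forall>v\<in>{a..b}. \<bar>u - u0\<bar> < e \<longrightarrow> \<bar>v - u0\<bar> < e \<longrightarrow> u < v \<longrightarrow>
       c * (v - u) \<le> norm (tube (\<rho> t u) (A t u) (B t u) - tube (\<rho> t v) (A t v) (B t v))"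
      if u0: "u0 \<in> {a..b}" for u0
    proof -
      obtain e c where ec: "e > 0" "c > 0" and alt: "(\<forall>t\<in>{0..1}. \<forall>u\<in>{a..b}. \<forall>v\<in>{a..b}. \<bar>u - u0\<bar> < e \<longrightarrow> \<bar>v - u0\<bar> < e \<longrightarrow> u < v \<longrightarrow> c * (v - u) \<le> A t v - A t u) \<or>
       (\<forall>t\<in>{0..1}. \<forall>u\<in>{a..b}. \<forall>v\<in>{a..b}. \<bar>u - u0\<bar> < e \<longrightarrow> \<bar>v - u0\<bar> < e \<longrightarrow> u < v \<longrightarrow>
          c * (v - u) \<le> B t v - B t u \<and> c \<le> \<rho> t u \<and> c \<le> \<rho> t v)"
        using loc[OF u0] by blast
      \<comment> \<open>The meridional alternative pays \<open>c\<close> twice, for the rate and for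
        the distance from the core.\<close>
      have key: "min c (c * c) * (v - u) \<le> norm (tube (\<rho> t u) (A t u) (B t u) - tube (\<rho> t v) (A t v) (B t v))"
        if tuv: "t \<in> {0..1::real}" "u \<in> {a..b}" "v \<in> {a..b}"
          and near: "\<bar>u - u0\<bar> < min e (\<epsilon>/2)" "\<bar>v - u0\<bar> < min e (\<epsilon>/2)" and uv: "u < v" for t u v
      proof -
        have d: "\<bar>u - v\<bar> \<le> \<epsilon>" using near unfolding min_less_iff_conj by linarith
        from alt show "min c (c * c) * (v - u) \<le> norm (tube (\<rho> t u) (A t u) (B t u) - tube (\<rho> t v) (A t v) (B t v))"
        proof
          assume *: "\<forall>t\<in>{0..1}. \<forall>u\<in>{a..b}. \<forall>v\<in>{a..b}. \<bar>u - u0\<bar> < e \<longrightarrow> \<bar>v - u0\<bar> < e \<longrightarrow> u < v \<longrightarrow> c * (v - u) \<le> A t v - A t u"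
          have "min c (c * c) * (v - u) \<le> c * (v - u)" using uv by (intro mult_right_mono) auto
          also have "\<dots> \<le> A t v - A t u" using * tuv near uv by auto
          also have "\<dots> \<le> \<bar>A t v - A t u - 0\<bar>" by simp
          also have "\<dots> \<le> norm (tube (\<rho> t u) (A t u) (B t u) - tube (\<rho> t v) (A t v) (B t v))"
          proof (rule tube_angle_bound)
            show "\<bar>A t v - A t u - 0\<bar> \<le> 1/4"
              using MA(2)[OF tuv] small[of MA "\<bar>u - v\<bar>"] d by (simp add: abs_minus_commute)
          qed (use rho tuv in auto)
          finally show ?thesis .
        next
          assume *: "\<forall>t\<in>{0..1}. \<forall>u\<in>{a..b}. \<forall>v\<in>{a..b}. \<bar>u - u0\<bar> < e \<longrightarrow> \<bar>v - u0\<bar> < e \<longrightarrow> u < v \<longrightarrow>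
            c * (v - u) \<le> B t v - B t u \<and> c \<le> \<rho> t u \<and> c \<le> \<rho> t v"
          have **: "c * (v - u) \<le> B t v - B t u" "c \<le> \<rho> t u" "c \<le> \<rho> t v"
            using *[rule_format, OF tuv _ _ uv] near by simp_all
          have "min c (c * c) * (v - u) \<le> (c * c) * (v - u)" using uv by (intro mult_right_mono) auto
          also have "\<dots> = c * (c * (v - u))" by simp
          also have "\<dots> \<le> c * \<bar>B t v - B t u\<bar>" using **(1) ec by (intro mult_left_mono) auto
          also have "\<dots> \<le> norm (tube (\<rho> t u) (A t u) (B t u) - tube (\<rho> t v) (A t v) (B t v))"
          proof (rule tube_meridian_bound)
            show "\<bar>B t v - B t u\<bar> \<le> 1/4"
              using MB(2)[OF tuv] small[of MB "\<bar>u - v\<bar>"] d by (simp add: abs_minus_commute)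
          qed (use ** ec rho[OF tuv(1,2)] rho[OF tuv(1,3)] in auto)
          finally show ?thesis .
        qed
      qed
      have "0 < min e (\<epsilon>/2)" "0 < min c (c * c)" using ec \<epsilon> by auto
      with key show ?thesis by blast
    qed
    obtain e c where ec: "e > 0" "c > 0" and sm: "\<forall>t\<in>{0..1}. \<forall>u\<in>{a..b}. \<forall>v\<in>{a..b}. u - a < e \<longrightarrow> b - v < e \<longrightarrow>
       c * (u - a) \<le> A t u - A t a \<and> c * (b - v) \<le> A t b - A t v"
      using seam by blast
    have key: "c * ((u - a) + (b - v)) \<le> norm (tube (\<rho> t u) (A t u) (B t u) - tube (\<rho> t v) (A t v) (B t v))"
      if tuv: "t \<in> {0..1::real}" "u \<in> {a..b}" "v \<in> {a..b}"
        and near: "u - a < min e \<epsilon>" "b - v < min e \<epsilon>" for t u v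
    proof -
      \<comment> \<open>Across the seam the longitudinal angles differ from the total number
        \<open>n\<close> of turns by two increments of the same sign, which cannot cancel.\<close>
      define n where "n = A t b - A t a"
      have m: "a \<in> {a..b}" "b \<in> {a..b}" using ab by auto
      have "A t v - A t u - n = - ((A t u - A t a) + (A t b - A t v))" by (simp add: n_def)
      moreover have "\<bar>A t u - A t a\<bar> \<le> 1/8" "\<bar>A t b - A t v\<bar> \<le> 1/8"
        using MA(2)[OF tuv(1,2) m(1)] MA(2)[OF tuv(1) m(2) tuv(3)] small[of MA "\<bar>u - a\<bar>"] small[of MA "\<bar>b - v\<bar>"] near tuv by auto
      moreover have "c * (u - a) \<le> A t u - A t a \<and> c * (b - v) \<le> A t b - A t v"
        using sm tuv near by auto
      ultimately have 1: "\<bar>A t v - A t u - n\<bar> \<le> 1/4" "c * ((u - a) + (b - v)) \<le> \<bar>A t v - A t u - n\<bar>"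
        unfolding distrib_left by linarith+
      have "n \<in> \<int>" using closed[OF tuv(1)] by (simp add: n_def)
      then have "\<bar>A t v - A t u - n\<bar> \<le> norm (tube (\<rho> t u) (A t u) (B t u) - tube (\<rho> t v) (A t v) (B t v))"
        using rho[OF tuv(1,2)] rho[OF tuv(1,3)] 1 by (intro tube_angle_bound) auto
      with 1 show ?thesis by linarith
    qed
    have "0 < min e \<epsilon>" using ec \<epsilon> by auto
    with key ec(2) show "\<exists>e>0. \<exists>c>0. \<forall>t\<in>{0..1}. \<forall>u\<in>{a..b}. \<forall>v\<in>{a..b}. u - a < e \<longrightarrow> b - v < e \<longrightarrow>
       c * ((u - a) + (b - v)) \<le> norm (tube (\<rho> t u) (A t u) (B t u) - tube (\<rho> t v) (A t v) (B t v))" by blast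
  qed
qed

text \<open>The difference is \<open>2 * sin (pi * (q - p)) * cos (pi * (q + p))\<close>. Near an
  integer the cosine is at least 1/2, and the sine is at least half its argument.\<close>

lemma sin_near_int:
  fixes n :: int and p q :: real
  assumes "\<bar>p - n\<bar> \<le> 1/8" "\<bar>q - n\<bar> \<le> 1/8" "p \<le> q"
  shows "q - p \<le> sin (2 * pi * q) - sin (2 * pi * p)"
proof -
  have 1: "pi * (q - p) \<le> 1"
  proof -
    have "q - p \<le> 1/4" using assms by linarith
    then have "pi * (q - p) \<le> 4 * (1/4)" using assms pi_less_4 by (intro mult_mono) auto
    then show ?thesis by simp
  qed
  have 2: "pi * (q - p) / 2 \<le> sin (pi * (q - p))"
  proof -
    have "0 \<le> pi * (q - p)" "pi * (q - p) \<le> pi" using 1 pi_gt3 assms by (simp, linarith)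
    then have "sin (pi * (q - p)) \<ge> 0" by (rule sin_ge_zero)
    then show ?thesis using chord_bound[of "pi * (q - p)"] 1 assms by (simp del: pi_neq_zero)
  qed
  have 3: "1/2 \<le> cos (pi * (q + p))"
  proof -
    define x where "x = \<bar>pi * (q + p - 2 * n)\<bar>"
    have "\<bar>q + p - 2 * n\<bar> \<le> 1/4" using assms(1,2) by linarith
    then have "x \<le> pi * (1/4)" unfolding x_def abs_mult by (intro mult_mono) auto
    then have "cos (pi / 3) \<le> cos x" by (intro cos_monotone_0_pi_le) (auto simp: x_def)
    also have "cos x = cos (pi * (q + p - 2 * n))" by (simp add: x_def)
    also have "\<dots> = cos (pi * (q + p) - 2 * pi * of_int n)" by (simp add: algebra_simps)
    also have "\<dots> = cos (pi * (q + p))" by (simp add: cos_diff)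
    finally show ?thesis by (simp add: cos_60)
  qed
  have "q - p \<le> pi * (q - p) / 2" using pi_ge_two mult_right_mono[of 2 pi "q - p"] assms by simp
  also have "\<dots> = 2 * ((pi * (q - p) / 2) * (1/2))" by simp
  also have "\<dots> \<le> 2 * (sin (pi * (q - p)) * cos (pi * (q + p)))"
    using 2 3 assms by (intro mult_left_mono mult_mono) (auto intro: order_trans[OF _ 2])
  also have "\<dots> = sin (2 * pi * q) - sin (2 * pi * p)"
    unfolding sin_diff_sin by (simp add: algebra_simps diff_divide_distrib add_divide_distrib)
  finally show ?thesis .
qed

lemma sin_2pi_sign:
  fixes f :: real
  shows "0 < f \<Longrightarrow> f < 1/2 \<Longrightarrow> sin (2 * pi * f) > 0" "1/2 < f \<Longrightarrow> f < 1 \<Longrightarrow> sin (2 * pi * f) < 0"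
proof -
  show "0 < f \<Longrightarrow> f < 1/2 \<Longrightarrow> sin (2 * pi * f) > 0" by (intro sin_gt_zero) auto
  assume f: "1/2 < f" "f < 1"
  show "sin (2 * pi * f) < 0" by (intro sin_lt_zero) (use f in auto)
qed

lemma sin_cos_2pi_Ints:
  fixes x n :: real
  assumes "n \<in> \<int>"
  shows "sin (2 * pi * (n + x)) = sin (2 * pi * x)" "cos (2 * pi * (n + x)) = cos (2 * pi * x)"
proof -
  obtain k :: int where "n = of_int k" using assms by (elim Ints_cases)
  then have "2 * pi * (n + x) = 2 * pi * x + 2 * pi * of_int k" by (simp add: algebra_simps)
  then have "sin (2 * pi * (n + x)) = sin (2 * pi * x) \<and> cos (2 * pi * (n + x)) = cos (2 * pi * x)"
    unfolding sin_cos_eq_iff by blast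
  then show "sin (2 * pi * (n + x)) = sin (2 * pi * x)" "cos (2 * pi * (n + x)) = cos (2 * pi * x)" by auto
qed

subsection \<open>The spiral\<close>

definition clamp01 :: "real \<Rightarrow> real" where "clamp01 x = max 0 (min 1 x)"

text \<open>The parameter interval is \<open>[0, m + 1]\<close>. On \<open>[i, i + 1]\<close> with \<open>i < m\<close> the curve makes one meridional turn, together
  with a longitudinal turn if \<open>d i = 1\<close>. The closing turn on \<open>[m, m + 1]\<close> is longitudinal. The small
  oscillation in \<open>ang\<close> makes the sign of the first coordinate agree with that of \<open>sin (2 \<pi> p)\<close> also during
  purely meridional turns. In the closing turn \<open>rad_core\<close> drops early, so that the second half of this
  turn runs along the core, whereas \<open>rad\<close> drops late. For \<open>m = 0\<close> both vanish, since \<open>x / 0 = 0\<close>.\<close>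

locale spiral =
  fixes m :: nat and d :: "nat \<Rightarrow> real"
  assumes d01: "\<And>i. d i = 0 \<or> d i = 1" and dm: "d m = 1"
begin

text \<open>The initial value 1 is the column in which the staircase of a torus knot starts.\<close>

definition lvl :: "real \<Rightarrow> real" where "lvl p = 1 + (\<Sum>i\<le>m. d i * clamp01 (p - real i))"

definition lev :: "nat \<Rightarrow> real" where "lev i = 1 + (\<Sum>k<i. d k)"

definition ang :: "real \<Rightarrow> real" where "ang p = lvl p + sin (2 * pi * min p (real m)) / 8"

definition rad_core :: "real \<Rightarrow> real" where
  "rad_core p = min p (real m) / real m * (1 - min 1 (2 * max 0 (p - real m)))"

definition rad :: "real \<Rightarrow> real" where
  "rad p = min p (real m) / real m * (1 - 4 * max 0 (p - real m - 3/4))"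

lemma lev_Ints: "lev i \<in> \<int>"
  unfolding lev_def using d01 by (intro Ints_add Ints_sum) (metis Ints_0 Ints_1, metis Ints_0 Ints_1)

lemma lev_Suc: "lev (Suc i) = lev i + d i" by (simp add: lev_def)

lemma lev_0: "lev 0 = 1" by (simp add: lev_def)

lemma lvl_eq:
  assumes "i \<le> m" "real i \<le> p" "p \<le> real i + 1"
  shows "lvl p = lev i + d i * (p - real i)"
proof -
  have "(\<Sum>j\<le>m. d j * clamp01 (p - real j)) = (\<Sum>j\<le>m. if j < i then d j else if j = i then d i * (p - real i) else 0)"
    using assms by (intro sum.cong refl) (auto simp: clamp01_def)
  also have "\<dots> = (\<Sum>j\<in>{..<i} \<union> {i}. if j < i then d j else if j = i then d i * (p - real i) else 0)"
    using assms by (intro sum.mono_neutral_right) auto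
  also have "\<dots> = (\<Sum>j<i. d j) + d i * (p - real i)" by simp
  finally show ?thesis by (simp add: lvl_def lev_def)
qed

lemma lvl_mono: "p \<le> q \<Longrightarrow> lvl p \<le> lvl q"
proof -
  assume "p \<le> q"
  moreover have "d i \<ge> 0" for i using d01[of i] by auto
  ultimately show ?thesis unfolding lvl_def
    by (intro add_left_mono sum_mono mult_left_mono) (auto simp: clamp01_def)
qed

lemma unit_interval:
  assumes "0 \<le> p" "p \<le> real m"
  obtains i where "p = real m \<and> i = m \<or> i < m \<and> real i \<le> p \<and> p < real i + 1"
proof (cases "p = real m")
  case False
  have "real (nat \<lfloor>p\<rfloor>) \<le> p" "p < real (nat \<lfloor>p\<rfloor>) + 1" using assms by linarith+
  moreover have "nat \<lfloor>p\<rfloor> < m" using assms False by linarith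
  ultimately show ?thesis using that by blast
qed (use that in blast)

lemma ang_eq:
  assumes "i < m" "real i \<le> p" "p \<le> real i + 1"
  shows "ang p = lev i + d i * (p - real i) + sin (2 * pi * p) / 8"
proof -
  have "min p (real m) = p" using assms by (simp add: min_def)
  then show ?thesis using lvl_eq[of i p] assms by (simp add: ang_def)
qed

lemma ang_last:
  assumes "real m \<le> p" "p \<le> real m + 1"
  shows "ang p = lev m + (p - real m)"
  using assms lvl_eq[of m p] dm sin_cos_2pi_Ints(1)[of "real m" 0] by (simp add: ang_def min_absorb2)

lemma ang_nat: "i \<le> m \<Longrightarrow> ang (real i) = lev i"
  using ang_eq[of i "real i"] ang_last[of "real m"] sin_cos_2pi_Ints(1)[of "real i" 0] by (cases "i = m") auto

lemma ang_end: "ang (real m + 1) = lev m + 1"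
  using ang_last[of "real m + 1"] by simp

text \<open>This determines where the spiral meets the plane of vanishing first coordinate: exactly
  at half-integral \<open>p\<close>, which become the strands. At the fraction \<open>f\<close> of a
  turn, the angle has to stay on the same side of the half turn as \<open>f\<close>. The amplitude
  1/8 achieves this, because the absolute value of \<open>sin (2 * pi * f)\<close> is at most
  \<open>2 * pi\<close>, hence less than 8, times the distance of \<open>f\<close> from 1/2.\<close>

lemma sgn_ang:
  assumes "0 \<le> p" "p \<le> real m"
  shows "sgn (sin (2 * pi * ang p)) = sgn (sin (2 * pi * p))"
proof -
  obtain i where i: "p = real m \<and> i = m \<or> i < m \<and> real i \<le> p \<and> p < real i + 1"
    using unit_interval[OF assms] .
  then show ?thesis
  proof
    assume "p = real m \<and> i = m"
    then show ?thesis
      using ang_nat[of m] sin_cos_2pi_Ints(1)[OF lev_Ints, of m 0] sin_cos_2pi_Ints(1)[of "real m" 0] by simp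
  next
    assume i: "i < m \<and> real i \<le> p \<and> p < real i + 1"
    define f where "f = p - real i"
    have f: "0 \<le> f" "f < 1" using i by (auto simp: f_def)
    define g where "g = d i * f + sin (2 * pi * f) / 8"
    have p: "sin (2 * pi * p) = sin (2 * pi * f)"
      using sin_cos_2pi_Ints(1)[of "real i" f] by (simp add: f_def)
    have "ang p = lev i + g" using ang_eq[of i p] i p by (simp add: g_def f_def)
    then have a: "sin (2 * pi * ang p) = sin (2 * pi * g)" using sin_cos_2pi_Ints(1)[OF lev_Ints] by simp
    consider "f = 0" | "0 < f" "f < 1/2" | "f = 1/2" | "1/2 < f" using f by linarith
    then show ?thesis
    proof cases
      case 1
      then show ?thesis by (simp add: a p g_def)
    next
      case 2
      have s: "sin (2 * pi * f) > 0" using sin_2pi_sign(1)[OF 2] .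
      have "sin (2 * pi * f) = sin (pi - 2 * pi * f)" by simp
      also have "pi - 2 * pi * f = 2 * pi * (1/2 - f)" by (simp add: algebra_simps)
      also have "sin \<dots> \<le> 2 * pi * (1/2 - f)" using 2 by (intro sin_x_le_x) auto
      also have "\<dots> < 2 * 4 * (1/2 - f)" using 2 pi_less_4 by (intro mult_strict_right_mono mult_strict_left_mono) auto
      finally have "sin (2 * pi * f) / 8 < 1/2 - f" by simp
      then have "0 < g" "g < 1/2" using s d01[of i] 2 sin_le_one[of "2 * pi * f"] by (auto simp: g_def)
      then show ?thesis using s sin_2pi_sign(1)[of g] by (simp add: a p)
    next
      case 3
      then show ?thesis using d01[of i] by (auto simp: a p g_def 3)
    next
      case 4
      have s: "sin (2 * pi * f) < 0" using sin_2pi_sign(2)[OF 4 f(2)] .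
      have "- sin (2 * pi * f) = sin (2 * pi * f - pi)" by simp
      also have "2 * pi * f - pi = 2 * pi * (f - 1/2)" by (simp add: algebra_simps)
      also have "sin \<dots> \<le> 2 * pi * (f - 1/2)" using 4 by (intro sin_x_le_x) auto
      also have "\<dots> < 2 * 4 * (f - 1/2)" using 4 pi_less_4 by (intro mult_strict_right_mono mult_strict_left_mono) auto
      finally have l: "- sin (2 * pi * f) / 8 < f - 1/2" by simp
      show ?thesis
      proof (cases "d i = 1")
        case True
        then have "1/2 < g" "g < 1" using s l f by (auto simp: g_def)
        then show ?thesis using s sin_2pi_sign(2)[of g] by (simp add: a p)
      next
        case False
        then have "d i = 0" using d01[of i] by simp
        then have "g = sin (2 * pi * f) / 8" by (simp add: g_def)
        \<comment> \<open>Without a longitudinal turn \<open>g\<close> is negative; a full turn is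
          added to reach the interval \<open>(1/2, 1)\<close>.\<close>
        then have "1/2 < 1 + g" "1 + g < 1" using s sin_ge_minus_one[of "2 * pi * f"] by linarith+
        then have "sin (2 * pi * (1 + g)) < 0" by (rule sin_2pi_sign(2))
        then show ?thesis using s sin_cos_2pi_Ints(1)[of 1 g] by (simp add: a p)
      qed
    qed
  qed
qed

lemma ang_lens_last:
  assumes "real m \<le> p" "p \<le> q" "q \<le> real m + 1"
  shows "ang q - ang p = q - p"
  using assms ang_last[of p] ang_last[of q] by simp

text \<open>At integers the oscillation increases, so \<open>ang\<close> does even where
  \<open>lvl\<close> is constant. Among them are the parameters where the meridional angle cannot
  help: 0, which lies on the core, and \<open>m\<close>, after which that angle is constant.\<close>

lemma ang_lens_int:
  fixes i :: int
  assumes "p \<le> q" "q \<le> real m + 1" "\<bar>p - i\<bar> \<le> 1/8" "\<bar>q - i\<bar> \<le> 1/8"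
  shows "(q - p) / 8 \<le> ang q - ang p"
proof -
  have A: "(q - p) / 8 \<le> ang q - ang p" if "p \<le> q" "q \<le> real m" "\<bar>p - i\<bar> \<le> 1/8" "\<bar>q - i\<bar> \<le> 1/8" for p q
    using sin_near_int[of p i q] that lvl_mono[of p q] by (simp add: ang_def min_absorb1)
  have B: "(q - p) / 8 \<le> ang q - ang p" if "real m \<le> p" "p \<le> q" "q \<le> real m + 1" for p q
    using ang_lens_last[OF that] that by simp
  consider "real m \<le> p" | "q \<le> real m" | "p < real m" "real m < q" by linarith
  then show ?thesis
  proof cases
    case 3
    then have "\<bar>real m - i\<bar> \<le> 1/8" using assms by linarith
    then show ?thesis using A[of p "real m"] B[of "real m" q] 3 assms by simp
  qed (use A B assms in auto)
qed

end


section \<open>Sliding the drop along the closing turn\<close>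

context spiral
begin

lemma lipfam_ang: "lipfam {0..real m + 1} (\<lambda>_. ang)"
  unfolding ang_def lvl_def clamp01_def divide_inverse
  by (intro lipfam_add lipfam_sum lipfam_mult lipfam_const lipfam_max lipfam_min lipfam_diff lipfam_id lipfam_sin)

lemma lipfam_rad: "lipfam {0..real m + 1} (\<lambda>_. rad)"
  unfolding rad_def divide_inverse
  by (intro lipfam_add lipfam_mult lipfam_const lipfam_max lipfam_min lipfam_diff lipfam_id)

lemma lipfam_rad_core: "lipfam {0..real m + 1} (\<lambda>_. rad_core)"
  unfolding rad_core_def divide_inverse
  by (intro lipfam_add lipfam_mult lipfam_const lipfam_max lipfam_min lipfam_diff lipfam_id)

lemma rad_le: "p \<le> real m \<Longrightarrow> rad p = p / real m" "p \<le> real m \<Longrightarrow> rad_core p = p / real m"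
  by (simp_all add: rad_def rad_core_def max_def min_def)

lemma rad_ge:
  assumes "m > 0" "real m \<le> p"
  shows "rad p = 1 - 4 * max 0 (p - real m - 3/4)" "rad_core p = 1 - min 1 (2 * (p - real m))"
  using assms by (simp_all add: rad_def rad_core_def min_absorb2 max_absorb2)

lemma rad_range:
  assumes "0 \<le> p" "p \<le> real m + 1"
  shows "0 \<le> rad p" "rad p \<le> 1" "0 \<le> rad_core p" "rad_core p \<le> 1"
proof -
  have "0 \<le> rad p \<and> rad p \<le> 1 \<and> 0 \<le> rad_core p \<and> rad_core p \<le> 1"
  proof (cases "m = 0")
    case True
    then show ?thesis unfolding rad_def rad_core_def by simp
  next
    case False
    show ?thesis
    proof (cases "p \<le> real m")
      case True
      then show ?thesis using assms False by (simp add: rad_le divide_le_eq)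
    next
      case n: False
      then show ?thesis using rad_ge[of p] assms False by (auto simp: max_def min_def)
    qed
  qed
  then show "0 \<le> rad p" "rad p \<le> 1" "0 \<le> rad_core p" "rad_core p \<le> 1" by auto
qed

lemma rad_end: "rad (real m + 1) = 0" "rad_core (real m + 1) = 0" "rad 0 = 0" "rad_core 0 = 0"
  by (simp_all add: rad_def rad_core_def)

lemma ang_start: "ang 0 = 1" using ang_nat[of 0] by (simp add: lev_0)

text \<open>The projection needs the drop in the last quarter of the closing turn, where the first
  coordinate is negative: only on that side does the position in the plane \<open>y = 0\<close>
  agree with the order prescribed by the final slopes. Moving the drop is harmless because the
  closing turn has an integral meridional angle throughout. Off the core the spiral has one only at
  integers, where its longitudinal angle is integral too, and strictly inside the closing turn the
  latter is not.\<close>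

lemma slide_isotopy:
  assumes m: "m > 0"
  shows "ambient_isotopic ((\<lambda>p. tube (rad_core p) (ang p) (min p (real m))) ` {0..real m + 1})
     ((\<lambda>p. tube (rad p) (ang p) (min p (real m))) ` {0..real m + 1})"
proof -
  define \<rho> where "\<rho> t p = (1 - t) * rad_core p + t * rad p" for t p
  have rho_le: "\<rho> t p = p / real m" if "p \<le> real m" for t p
    by (simp add: \<rho>_def rad_le[OF that] left_diff_distrib del: times_divide_eq_right)
  have rho_m: "\<rho> t (real m) = 1" for t using rho_le[of "real m"] m by simp
  have rho_e: "\<rho> t (real m + 1) = 0" for t by (simp add: \<rho>_def rad_end)
  have "ambient_isotopic ((\<lambda>p. tube (\<rho> 0 p) (ang p) (min p (real m))) ` {0..real m + 1})
     ((\<lambda>p. tube (\<rho> 1 p) (ang p) (min p (real m))) ` {0..real m + 1})"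
  proof (rule tube_family_isotopy[where A = "\<lambda>_. ang" and B = "\<lambda>_ p. min p (real m)"])
    show "lipfam {0..real m + 1} \<rho>" unfolding \<rho>_def
      by (intro lipfam_add lipfam_mult lipfam_diff lipfam_const lipfam_param lipfam_rad lipfam_rad_core)
    show "lipfam {0..real m + 1} (\<lambda>_. ang)" by (rule lipfam_ang)
    show "lipfam {0..real m + 1} (\<lambda>_ p. min p (real m))" by (intro lipfam_min lipfam_id lipfam_const)
    show "0 \<le> \<rho> t p \<and> \<rho> t p \<le> 1" if "t \<in> {0..1}" "p \<in> {0..real m + 1}" for t p
    proof -
      have "\<rho> t p \<le> (1 - t) * 1 + t * 1" "\<rho> t p \<ge> 0"
        unfolding \<rho>_def using that rad_range[of p] by (auto intro!: add_mono mult_left_mono add_nonneg_nonneg simp del: mult_1_right)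
      then show ?thesis by simp
    qed
    show "\<rho> t (real m + 1) = \<rho> t 0 \<and> ang (real m + 1) - ang 0 \<in> \<int> \<and> (\<rho> t 0 = 0 \<or> min (real m + 1) (real m) - min 0 (real m) \<in> \<int>)" for t
      using rho_e[of t] rho_le[of 0 t] lev_Ints[of m] by (simp add: ang_end ang_start)
    show "u = 0 \<and> v = real m + 1"
      if t: "t \<in> {0..1}" and uv: "u \<in> {0..real m + 1}" "v \<in> {0..real m + 1}" "u < v"
        and eq: "\<rho> t u = \<rho> t v" "ang v - ang u \<in> \<int>" "\<rho> t u = 0 \<or> min v (real m) - min u (real m) \<in> \<int>" for t u v
    proof -
      consider "v \<le> real m" | "real m \<le> u" | "u < real m" "real m < v" using uv by linarith
      then show ?thesis
      proof cases
        case 1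
        then show ?thesis using eq(1) uv m by (simp add: rho_le divide_right_mono)
      next
        case 2
        then have "ang v - ang u = v - u" using uv by (intro ang_lens_last) auto
        with eq(2) obtain k :: int where k: "v - u = of_int k" by (auto elim: Ints_cases)
        have "0 < real_of_int k" "real_of_int k \<le> 1" using k uv 2 by auto
        then have "k = 1" by linarith
        then have "v = real m + 1" "u = real m" using k uv 2 by auto
        then show ?thesis using eq(1) rho_m rho_e by simp
      next
        case 3
        have av: "ang v = lev m + (v - real m)" using 3 uv by (intro ang_last) auto
        have au: "ang u \<in> \<int>"
        proof (cases "u = 0")
          case False
          then have "\<rho> t u \<noteq> 0" using rho_le[of u t] 3 m by simp
          then have "real m - u \<in> \<int>" using eq(3) 3 by simp
          then have "u \<in> \<int>" using Ints_diff[of "real m" "real m - u"] by simp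
          then obtain k where "u = of_int k" by (elim Ints_cases)
          then have "u = real (nat k)" "nat k \<le> m" using uv 3 by auto
          then show ?thesis using ang_nat[of "nat k"] lev_Ints by simp
        qed (simp add: ang_start)
        have "v - real m \<in> \<int>" using Ints_diff[OF Ints_add[OF eq(2) au] lev_Ints[of m]] by (simp add: av)
        then obtain k :: int where k: "v - real m = of_int k" by (elim Ints_cases)
        have "0 < real_of_int k" "real_of_int k \<le> 1" using k uv 3 by auto
        then have "k = 1" by linarith
        then have v: "v = real m + 1" using k by simp
        then have "u / real m = 0" using eq(1) rho_e rho_le[of u t] 3 by simp
        then show ?thesis using v m by simp
      qed
    qed
    show "\<exists>e>0. \<exists>c>0.
       (\<forall>t\<in>{0..1::real}. \<forall>u\<in>{0..real m + 1}. \<forall>v\<in>{0..real m + 1}. \<bar>u - u0\<bar> < e \<longrightarrow> \<bar>v - u0\<bar> < e \<longrightarrow> u < v \<longrightarrow> c * (v - u) \<le> ang v - ang u) \<or>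
       (\<forall>t\<in>{0..1}. \<forall>u\<in>{0..real m + 1}. \<forall>v\<in>{0..real m + 1}. \<bar>u - u0\<bar> < e \<longrightarrow> \<bar>v - u0\<bar> < e \<longrightarrow> u < v \<longrightarrow>
          c * (v - u) \<le> min v (real m) - min u (real m) \<and> c \<le> \<rho> t u \<and> c \<le> \<rho> t v)"
      if u0: "u0 \<in> {0..real m + 1}" for u0
    proof -
      consider i :: int where "u0 = of_int i" | "real m < u0" | "0 < u0" "u0 < real m"
        using u0 by (metis atLeastAtMost_iff linorder_less_linear of_int_0 of_int_of_nat_eq order_le_less)
      then show ?thesis
      proof cases
        case (1 i)
        have "(1/8) * (v - u) \<le> ang v - ang u" if "v \<le> real m + 1" "\<bar>u - u0\<bar> < 1/8" "\<bar>v - u0\<bar> < 1/8" "u < v" for u v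
          using ang_lens_int[of u v i] that 1 by simp
        then show ?thesis by (intro exI[of _ "1/8::real"] conjI disjI1) simp_all
      next
        case 2
        have "1 * (v - u) \<le> ang v - ang u" if "v \<le> real m + 1" "\<bar>u - u0\<bar> < u0 - real m" "u < v" for u v
          using ang_lens_last[of u v] that 2 by simp
        then have "0 < u0 - real m \<and> (\<exists>c>0. \<forall>t\<in>{0..1::real}. \<forall>u\<in>{0..real m + 1}. \<forall>v\<in>{0..real m + 1}. \<bar>u - u0\<bar> < u0 - real m \<longrightarrow> \<bar>v - u0\<bar> < u0 - real m \<longrightarrow> u < v \<longrightarrow> c * (v - u) \<le> ang v - ang u)"
          using 2 by (intro conjI exI[of _ 1]) auto
        then show ?thesis by blast
      next
        case 3
        define e where "e = min (u0 / 2) (real m - u0)"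
        define c where "c = min 1 (u0 / (2 * real m))"
        have e: "e > 0" "c > 0" using 3 m by (auto simp: e_def c_def)
        have "c * (v - u) \<le> min v (real m) - min u (real m) \<and> c \<le> \<rho> t u \<and> c \<le> \<rho> t v"
          if "\<bar>u - u0\<bar> < e" "\<bar>v - u0\<bar> < e" "u < v" for t u v
        proof -
          have uv: "u0 / 2 \<le> u" "u0 / 2 \<le> v" "u \<le> real m" "v \<le> real m" using that unfolding e_def min_less_iff_conj by linarith+
          have "u0 / (2 * real m) \<le> u / real m" "u0 / (2 * real m) \<le> v / real m"
            using divide_right_mono[OF uv(1), of "real m"] divide_right_mono[OF uv(2), of "real m"] by simp_all
          moreover have "c * (v - u) \<le> 1 * (v - u)" using that by (intro mult_right_mono) (auto simp: c_def)
          ultimately show ?thesis using uv by (auto simp: rho_le c_def min_absorb1 intro: order_trans[OF min.cobounded2])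
        qed
        with e show ?thesis by blast
      qed
    qed
    have "(1/8) * (u - 0) \<le> ang u - ang 0 \<and> (1/8) * (real m + 1 - v) \<le> ang (real m + 1) - ang v"
      if "u \<in> {0..real m + 1}" "v \<in> {0..real m + 1}" "u - 0 < 1/8" "real m + 1 - v < 1/8" for u v
      using ang_lens_int[of 0 u 0] ang_lens_last[of v "real m + 1"] that by simp
    moreover have "(0::real) < 1/8" by simp
    ultimately show "\<exists>e>0. \<exists>c>0. \<forall>t\<in>{0..1::real}. \<forall>u\<in>{0..real m + 1}. \<forall>v\<in>{0..real m + 1}. u - 0 < e \<longrightarrow> real m + 1 - v < e \<longrightarrow>
       c * (u - 0) \<le> ang u - ang 0 \<and> c * (real m + 1 - v) \<le> ang (real m + 1) - ang v"
      by blast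
  qed simp
  then show ?thesis by (simp add: \<rho>_def)
qed

end

section \<open>Local injectivity of the projection to the xz-plane\<close>

lemma deriv_lens:
  fixes f f' :: "real \<Rightarrow> real"
  assumes der: "\<And>x. a < x \<Longrightarrow> x < b \<Longrightarrow> (f has_real_derivative f' x) (at x)"
    and "a < u0" "u0 < b" "isCont f' u0" "f' u0 \<noteq> 0"
  shows "\<exists>e>0. \<exists>c>0. \<forall>u v. \<bar>u - u0\<bar> < e \<longrightarrow> \<bar>v - u0\<bar> < e \<longrightarrow> u < v \<longrightarrow> c * (v - u) \<le> \<bar>f v - f u\<bar>"
proof -
  define c where "c = \<bar>f' u0\<bar> / 2"
  have c: "c > 0" using assms by (simp add: c_def)
  obtain e0 where e0: "e0 > 0" "\<And>x. \<bar>x - u0\<bar> < e0 \<Longrightarrow> \<bar>f' x - f' u0\<bar> < c"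
    using assms(4) c unfolding continuous_at_eps_delta by (metis dist_real_def real_norm_def)
  define e where "e = min e0 (min (u0 - a) (b - u0))"
  have e: "e > 0" using e0 assms by (simp add: e_def)
  have "c * (v - u) \<le> \<bar>f v - f u\<bar>" if uv: "\<bar>u - u0\<bar> < e" "\<bar>v - u0\<bar> < e" "u < v" for u v
  proof -
    have ab: "a < u" "v < b" using uv unfolding e_def min_less_iff_conj by linarith+
    have "\<exists>z. u < z \<and> z < v \<and> f v - f u = (v - u) * f' z"
      using uv(3) by (intro MVT2 der) (use ab in auto)
    then obtain z where z: "u < z" "z < v" "f v - f u = (v - u) * f' z" by blast
    have "\<bar>f' z - f' u0\<bar> < c" using z uv by (intro e0) (auto simp: e_def)
    then have "c \<le> \<bar>f' z\<bar>" unfolding c_def by linarith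
    then have "c * (v - u) \<le> \<bar>f' z\<bar> * (v - u)" using uv by (intro mult_right_mono) auto
    then show ?thesis using z uv by (simp add: abs_mult mult.commute)
  qed
  with e c show ?thesis by blast
qed

context spiral
begin

text \<open>Distance from the axis of rotation. \<open>Rad\<close> and \<open>ang\<close>, the
  latter in full turns, are polar coordinates of the projection to the xz-plane.\<close>

definition Rad :: "real \<Rightarrow> real" where "Rad p = 2 + rad p * cos (2 * pi * min p (real m))"

lemma Rad_ge_1: "0 \<le> p \<Longrightarrow> p \<le> real m + 1 \<Longrightarrow> 1 \<le> Rad p"
  unfolding Rad_def using rad_range[of p] by (intro tube_radius_ge) auto

lemma ang_interior_lens:
  assumes "i < m" "real i < u0" "u0 < real i + 1" "d i + pi * cos (2 * pi * u0) / 4 \<noteq> 0"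
  shows "\<exists>e>0. \<exists>c>0. \<forall>u v. \<bar>u - u0\<bar> < e \<longrightarrow> \<bar>v - u0\<bar> < e \<longrightarrow> u < v \<longrightarrow> c * (v - u) \<le> \<bar>ang v - ang u\<bar>"
proof (rule deriv_lens[where a = "real i" and b = "real i + 1" and f' = "\<lambda>x. d i + pi * cos (2 * pi * x) / 4"])
  fix x assume x: "real i < x" "x < real i + 1"
  have "((\<lambda>p. lev i + d i * (p - real i) + sin (2 * pi * p) / 8) has_real_derivative d i + pi * cos (2 * pi * x) / 4) (at x)"
    by (auto intro!: derivative_eq_intros)
  then show "(ang has_real_derivative d i + pi * cos (2 * pi * x) / 4) (at x)"
  proof (rule has_field_derivative_transform_within_open[of _ _ _ "{real i<..<real i + 1}"])
    show "lev i + d i * (p - real i) + sin (2 * pi * p) / 8 = ang p" if "p \<in> {real i<..<real i + 1}" for p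
      using ang_eq[of i p] that assms by simp
  qed (use x in auto)
qed (use assms in auto)

lemma Rad_interior_lens:
  assumes "0 < u0" "u0 < real m" "cos (2 * pi * u0) = 0"
  shows "\<exists>e>0. \<exists>c>0. \<forall>u v. \<bar>u - u0\<bar> < e \<longrightarrow> \<bar>v - u0\<bar> < e \<longrightarrow> u < v \<longrightarrow> c * (v - u) \<le> \<bar>Rad v - Rad u\<bar>"
proof (rule deriv_lens[where a = 0 and b = "real m" and
    f' = "\<lambda>x. (cos (2 * pi * x) - x * (2 * pi * sin (2 * pi * x))) / real m"])
  have "sin (2 * pi * u0) \<noteq> 0" using sin_cos_squared_add[of "2 * pi * u0"] assms by auto
  then show "(cos (2 * pi * u0) - u0 * (2 * pi * sin (2 * pi * u0))) / real m \<noteq> 0" using assms by auto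
  fix x assume x: "0 < x" "x < real m"
  have "((\<lambda>p. 2 + (p / real m) * cos (2 * pi * p)) has_real_derivative (cos (2 * pi * x) - x * (2 * pi * sin (2 * pi * x))) / real m) (at x)"
    using x by (auto intro!: derivative_eq_intros simp: field_simps)
  then show "(Rad has_real_derivative (cos (2 * pi * x) - x * (2 * pi * sin (2 * pi * x))) / real m) (at x)"
  proof (rule has_field_derivative_transform_within_open[of _ _ _ "{0<..<real m}"])
    show "2 + (p / real m) * cos (2 * pi * p) = Rad p" if "p \<in> {0<..<real m}" for p
      using that by (simp add: Rad_def rad_le min_absorb1)
  qed (use x in auto)
qed (use assms in \<open>auto intro!: continuous_intros\<close>)

text \<open>The derivative \<open>d i + pi * cos (2 * pi * p) / 4\<close> of \<open>ang\<close> can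
  vanish only if \<open>d i = 0\<close> and the cosine is 0, since \<open>pi < 4\<close>. There the
  sine, and with it the derivative of \<open>Rad\<close>, is nonzero. So the lower bounds on short
  chords come from the xz-plane alone and survive every change of the second coordinate.\<close>

lemma planar_lens:
  assumes u0: "0 \<le> u0" "u0 \<le> real m + 1"
  shows "\<exists>e>0. \<exists>c>0. \<forall>u\<in>{0..real m + 1}. \<forall>v\<in>{0..real m + 1}. \<bar>u - u0\<bar> < e \<longrightarrow> \<bar>v - u0\<bar> < e \<longrightarrow> u < v \<longrightarrow>
     c * (v - u) \<le> \<bar>ang v - ang u\<bar> \<or> c * (v - u) \<le> \<bar>Rad v - Rad u\<bar>"
proof -
  consider i :: int where "u0 = of_int i" | "real m < u0" | i where "i < m" "real i < u0" "u0 < real i + 1"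
  proof (cases "u0 < real m")
    case True
    then obtain i where "i < m" "real i \<le> u0" "u0 < real i + 1" using unit_interval[of u0] u0 by auto
    then show ?thesis using that(1)[of "int i"] that(3)[of i] by fastforce
  next
    case False
    then show ?thesis using that(1)[of "int m"] that(2) by fastforce
  qed
  then show ?thesis
  proof cases
    case (1 i)
    have "(1/8) * (v - u) \<le> \<bar>ang v - ang u\<bar>" if "v \<in> {0..real m + 1}" "\<bar>u - u0\<bar> < 1/8" "\<bar>v - u0\<bar> < 1/8" "u < v" for u v
      using ang_lens_int[of u v i] that 1 by simp
    then show ?thesis by (metis zero_less_divide_1_iff zero_less_numeral)
  next
    case 2
    have "1 * (v - u) \<le> \<bar>ang v - ang u\<bar>" if "v \<in> {0..real m + 1}" "\<bar>u - u0\<bar> < u0 - real m" "u < v" for u v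
      using ang_lens_last[of u v] that 2 by simp
    then show ?thesis using 2 by (metis diff_gt_0_iff_gt zero_less_one)
  next
    case (3 i)
    show ?thesis
    proof (cases "d i + pi * cos (2 * pi * u0) / 4 = 0")
      case True
      have "d i = 0"
      proof (rule ccontr)
        assume "d i \<noteq> 0"
        then have "pi * cos (2 * pi * u0) = -4" using True d01[of i] by simp
        moreover have "pi * cos (2 * pi * u0) \<ge> pi * (-1)" by (intro mult_left_mono) auto
        ultimately show False using pi_less_4 by simp
      qed
      then have "cos (2 * pi * u0) = 0" using True by simp
      moreover have "0 < u0" "u0 < real m" using 3 by auto
      ultimately show ?thesis using Rad_interior_lens[of u0] by blast
    next
      case False
      then show ?thesis using ang_interior_lens[of i u0] 3 by blast
    qed
  qed
qed

end


section \<open>Staircase functions and the first coordinate near its zeros\<close>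

lemma lipfam_compose:
  assumes "lipfam I (\<lambda>_. g)" "lipfam J (\<lambda>_. \<phi>)" "\<And>p. p \<in> J \<Longrightarrow> \<phi> p \<in> I"
  shows "lipfam J (\<lambda>_ p. g (\<phi> p))"
proof -
  obtain M N where M: "M \<ge> 0" "\<And>u. u \<in> I \<Longrightarrow> \<bar>g u\<bar> \<le> M"
      "\<And>u v. u \<in> I \<Longrightarrow> v \<in> I \<Longrightarrow> \<bar>g u - g v\<bar> \<le> M * \<bar>u - v\<bar>"
    and N: "N \<ge> 0" "\<And>u v. u \<in> J \<Longrightarrow> v \<in> J \<Longrightarrow> \<bar>\<phi> u - \<phi> v\<bar> \<le> N * \<bar>u - v\<bar>"
    using assms(1,2) by (elim lipfamE) (metis atLeastAtMost_iff order_refl zero_le_one)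
  show ?thesis
  proof (rule lipfam_lipschitz[of "M + M * N"])
    show "M + M * N \<ge> 0" using M(1) N(1) by simp
    show "\<bar>g (\<phi> u)\<bar> \<le> M + M * N" if "u \<in> J" for u
      using M(2)[OF assms(3)[OF that]] mult_nonneg_nonneg[OF M(1) N(1)] by linarith
    show "\<bar>g (\<phi> u) - g (\<phi> v)\<bar> \<le> (M + M * N) * \<bar>u - v\<bar>" if "u \<in> J" "v \<in> J" for u v
    proof -
      have "\<bar>g (\<phi> u) - g (\<phi> v)\<bar> \<le> M * (N * \<bar>u - v\<bar>)"
        using M(3)[OF assms(3)[OF that(1)] assms(3)[OF that(2)]] mult_left_mono[OF N(2)[OF that] M(1)] by linarith
      also have "\<dots> \<le> (M + M * N) * \<bar>u - v\<bar>"
        using mult_nonneg_nonneg[OF M(1), of "\<bar>u - v\<bar>"] by (simp add: distrib_right mult.assoc)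
      finally show ?thesis .
    qed
  qed
qed

text \<open>The plateaus of half-width \<open>\<delta>\<close> around \<open>k / 2\<close> will make
  the strands straight near the multi-crossing.\<close>

definition stairs :: "(nat \<Rightarrow> real) \<Rightarrow> nat \<Rightarrow> real \<Rightarrow> real \<Rightarrow> real" where
  "stairs \<sigma> K \<delta> p = \<sigma> 0 + (\<Sum>k<K. (\<sigma> (Suc k) - \<sigma> k) * clamp01 ((p - real k / 2 - \<delta>) / (1/2 - 2 * \<delta>)))"

lemma clamp01_mono: "x \<le> y \<Longrightarrow> clamp01 x \<le> clamp01 y"
  by (auto simp: clamp01_def)

context
  fixes \<sigma> :: "nat \<Rightarrow> real" and K :: nat and \<delta> :: real
  assumes \<sigma>: "\<And>k. k < K \<Longrightarrow> \<sigma> k < \<sigma> (Suc k)" and \<delta>: "0 < \<delta>" "\<delta> < 1/8"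
begin

lemma stairs_eq:
  assumes "k < K" "real k / 2 \<le> p" "p \<le> real k / 2 + 1/2"
  shows "stairs \<sigma> K \<delta> p = \<sigma> k + (\<sigma> (Suc k) - \<sigma> k) * clamp01 ((p - real k / 2 - \<delta>) / (1/2 - 2 * \<delta>))"
proof -
  let ?c = "\<lambda>j. clamp01 ((p - real j / 2 - \<delta>) / (1/2 - 2 * \<delta>))"
  have 1: "?c j = 1" if "j < k" for j
  proof -
    have "real j + 1 \<le> real k" using that by linarith
    then have "1/2 - 2 * \<delta> \<le> p - real j / 2 - \<delta>" using assms \<delta> by linarith
    then show ?thesis using \<delta> by (simp add: clamp01_def)
  qed
  have 0: "?c j = 0" if "k < j" for j
  proof -
    have "real k + 1 \<le> real j" using that by linarith
    then have "p - real j / 2 - \<delta> \<le> 0" using assms \<delta> by linarith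
    then have "(p - real j / 2 - \<delta>) / (1/2 - 2 * \<delta>) \<le> 0" using \<delta> by (simp add: divide_nonpos_pos)
    then show ?thesis by (simp add: clamp01_def)
  qed
  have "(\<Sum>j<K. (\<sigma> (Suc j) - \<sigma> j) * ?c j) =
      (\<Sum>j<K. if j < k then \<sigma> (Suc j) - \<sigma> j else if j = k then (\<sigma> (Suc k) - \<sigma> k) * ?c k else 0)"
    using 0 1 by (intro sum.cong refl) (auto simp: not_less le_less)
  also have "\<dots> = (\<Sum>j\<in>{..<k} \<union> {k}. if j < k then \<sigma> (Suc j) - \<sigma> j else if j = k then (\<sigma> (Suc k) - \<sigma> k) * ?c k else 0)"
    using assms by (intro sum.mono_neutral_right) auto
  also have "\<dots> = (\<sigma> k - \<sigma> 0) + (\<sigma> (Suc k) - \<sigma> k) * ?c k"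
    by (simp add: sum_lessThan_telescope)
  finally show ?thesis by (simp add: stairs_def)
qed

lemma stairs_mono: "p \<le> q \<Longrightarrow> stairs \<sigma> K \<delta> p \<le> stairs \<sigma> K \<delta> q"
  unfolding stairs_def using \<sigma> \<delta>
  by (intro add_left_mono sum_mono mult_left_mono clamp01_mono divide_right_mono) (auto simp: less_imp_le)

lemma stairs_plateau:
  assumes "k \<le> K" "\<bar>p - real k / 2\<bar> \<le> \<delta>"
  shows "stairs \<sigma> K \<delta> p = \<sigma> k"
proof -
  have *: "clamp01 ((p - real j / 2 - \<delta>) / (1/2 - 2 * \<delta>)) = (if j < k then 1 else 0)" for j
  proof (cases "j < k")
    case True
    then have "real j + 1 \<le> real k" by linarith
    then have "1/2 - 2 * \<delta> \<le> p - real j / 2 - \<delta>" using assms by linarith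
    then show ?thesis using True \<delta> by (simp add: clamp01_def)
  next
    case False
    then have "real k \<le> real j" by linarith
    then have "p - real j / 2 - \<delta> \<le> 0" using assms by linarith
    then have "(p - real j / 2 - \<delta>) / (1/2 - 2 * \<delta>) \<le> 0" using \<delta> by (simp add: divide_nonpos_pos)
    then show ?thesis using False by (simp add: clamp01_def)
  qed
  have "stairs \<sigma> K \<delta> p = \<sigma> 0 + (\<Sum>j<K. if j < k then \<sigma> (Suc j) - \<sigma> j else 0)"
    by (simp add: stairs_def * if_distrib cong: if_cong)
  also have "(\<Sum>j<K. if j < k then \<sigma> (Suc j) - \<sigma> j else 0) = (\<Sum>j<k. \<sigma> (Suc j) - \<sigma> j)"
    using assms by (intro sum.mono_neutral_cong_right) auto
  finally show ?thesis by (simp add: sum_lessThan_telescope)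
qed

lemma stairs_gt:
  assumes "k < K" "real k / 2 + \<delta> < p"
  shows "\<sigma> k < stairs \<sigma> K \<delta> p"
proof -
  define q where "q = min p (real k / 2 + 1/2)"
  have q: "real k / 2 + \<delta> < q" "q \<le> real k / 2 + 1/2" "q \<le> p" using assms \<delta> by (auto simp: q_def)
  have "0 < (q - real k / 2 - \<delta>) / (1/2 - 2 * \<delta>)" using q \<delta> by (intro divide_pos_pos) auto
  then have "0 < clamp01 ((q - real k / 2 - \<delta>) / (1/2 - 2 * \<delta>))" by (simp add: clamp01_def)
  then have "\<sigma> k < stairs \<sigma> K \<delta> q" using stairs_eq[of k q] q assms \<sigma> \<delta> by simp
  also have "\<dots> \<le> stairs \<sigma> K \<delta> p" by (rule stairs_mono[OF q(3)])
  finally show ?thesis .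
qed

lemma stairs_eqD:
  assumes pq: "0 \<le> p" "p < q" "q \<le> real K / 2" and eq: "stairs \<sigma> K \<delta> p = stairs \<sigma> K \<delta> q"
  obtains k where "k \<le> K" "\<bar>p - real k / 2\<bar> \<le> \<delta>" "\<bar>q - real k / 2\<bar> \<le> \<delta>"
proof -
  note intro_k = that
  define k where "k = nat \<lfloor>2 * p\<rfloor>"
  have k: "real k \<le> 2 * p" "2 * p < real k + 1" using pq unfolding k_def by linarith+
  then have kK: "k < K" using pq by linarith
  have *: thesis if j: "j \<le> K" "\<bar>p - real j / 2\<bar> \<le> \<delta>" for j
  proof (cases "j = K")
    case True
    then have "\<bar>q - real j / 2\<bar> \<le> \<delta>" using j pq \<delta> by linarith
    then show thesis by (rule intro_k[OF j])
  next
    case False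
    have "q \<le> real j / 2 + \<delta>"
    proof (rule ccontr)
      assume "\<not> q \<le> real j / 2 + \<delta>"
      then have "\<sigma> j < stairs \<sigma> K \<delta> q" using j False by (intro stairs_gt) auto
      then show False using stairs_plateau[OF j] eq by simp
    qed
    then have "\<bar>q - real j / 2\<bar> \<le> \<delta>" using j pq by linarith
    then show thesis by (rule intro_k[OF j])
  qed
  consider "p \<le> real k / 2 + \<delta>" | "real k / 2 + 1/2 - \<delta> \<le> p" | "real k / 2 + \<delta> < p" "p < real k / 2 + 1/2 - \<delta>" by linarith
  then show thesis
  proof cases
    case 1
    then have "\<bar>p - real k / 2\<bar> \<le> \<delta>" using k by linarith
    then show thesis using *[of k] kK by simp
  next
    case 2
    have "real (Suc k) / 2 = real k / 2 + 1/2" by (simp add: add_divide_distrib)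
    with 2 have "\<bar>p - real (Suc k) / 2\<bar> \<le> \<delta>" using k by linarith
    then show thesis using *[of "Suc k"] kK by simp
  next
    case 3
    define q' where "q' = min q (real k / 2 + 1/2 - \<delta>)"
    have q': "p < q'" "q' \<le> real k / 2 + 1/2 - \<delta>" "q' \<le> q" using 3 pq by (auto simp: q'_def)
    let ?f = "\<lambda>x. (x - real k / 2 - \<delta>) / (1/2 - 2 * \<delta>)"
    have "?f p < ?f q'" "0 < ?f p" "?f q' \<le> 1" using q' 3 \<delta> by (auto simp: divide_strict_right_mono)
    then have "clamp01 (?f p) < clamp01 (?f q')" by (simp add: clamp01_def)
    moreover have "stairs \<sigma> K \<delta> p = \<sigma> k + (\<sigma> (Suc k) - \<sigma> k) * clamp01 (?f p)"
      "stairs \<sigma> K \<delta> q' = \<sigma> k + (\<sigma> (Suc k) - \<sigma> k) * clamp01 (?f q')"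
      using kK k q' 3 \<delta> by (intro stairs_eq; linarith)+
    ultimately have "stairs \<sigma> K \<delta> p < stairs \<sigma> K \<delta> q'" using \<sigma>[OF kK] by simp
    then show thesis using stairs_mono[OF q'(3)] eq by simp
  qed
qed

end

lemma half_angle_lens:
  fixes k :: int and a b :: real
  assumes "\<bar>a - k / 2\<bar> \<le> 1/8" "\<bar>b - k / 2\<bar> \<le> 1/8"
  shows "\<bar>a - b\<bar> \<le> \<bar>sin (2 * pi * a) - sin (2 * pi * b)\<bar>"
proof -
  have int: "\<bar>a - b\<bar> \<le> \<bar>sin (2 * pi * a) - sin (2 * pi * b)\<bar>"
    if "\<bar>a - n\<bar> \<le> 1/8" "\<bar>b - n\<bar> \<le> 1/8" for a b :: real and n :: int
    using sin_near_int[of a n b] sin_near_int[of b n a] that by linarith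
  show ?thesis
  proof (cases "even k")
    case True
    then obtain n where "k = 2 * n" by blast
    then show ?thesis using int[of a n b] assms by simp
  next
    case False
    then obtain n where n: "k = 2 * n + 1" by (elim oddE)
    have half: "sin (2 * pi * x) = - sin (2 * pi * (x - 1/2))" for x :: real
      by (simp add: right_diff_distrib sin_diff)
    have h: "real_of_int k / 2 = n + 1/2" by (simp add: n add_divide_distrib)
    have "\<bar>(a - 1/2) - n\<bar> \<le> 1/8" "\<bar>(b - 1/2) - n\<bar> \<le> 1/8" using assms unfolding h by linarith+
    then have "\<bar>(a - 1/2) - (b - 1/2)\<bar> \<le> \<bar>sin (2 * pi * (a - 1/2)) - sin (2 * pi * (b - 1/2))\<bar>"
      by (rule int)
    then show ?thesis unfolding half[of a] half[of b] by linarith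
  qed
qed

context spiral
begin

definition xx :: "real \<Rightarrow> real" where "xx p = Rad p * sin (2 * pi * ang p)"
definition yy :: "real \<Rightarrow> real" where "yy p = rad p * sin (2 * pi * min p (real m))"
definition zz :: "real \<Rightarrow> real" where "zz p = Rad p * cos (2 * pi * ang p)"

lemma tube_rad: "tube (rad p) (ang p) (min p (real m)) = vector [xx p, yy p, zz p]"
  by (simp add: tube_def xx_def yy_def zz_def Rad_def)

lemma lipfam_Rad: "lipfam {0..real m + 1} (\<lambda>_. Rad)"
  unfolding Rad_def by (intro lipfam_add lipfam_mult lipfam_const lipfam_rad lipfam_cos lipfam_min lipfam_id)

lemma lipfam_xyz:
  "lipfam {0..real m + 1} (\<lambda>_. xx)" "lipfam {0..real m + 1} (\<lambda>_. yy)" "lipfam {0..real m + 1} (\<lambda>_. zz)"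
  unfolding xx_def yy_def zz_def
  by (intro lipfam_mult lipfam_const lipfam_rad lipfam_Rad lipfam_ang lipfam_cos lipfam_sin lipfam_min lipfam_id)+

lemma ang_half: "k \<le> 2 * m \<Longrightarrow> 2 * ang (real k / 2) \<in> \<int>"
proof (cases "even k")
  case True
  assume "k \<le> 2 * m"
  with True have "ang (real k / 2) = lev (k div 2)" using ang_nat[of "k div 2"] by (simp add: real_of_nat_div)
  then show ?thesis using lev_Ints by simp
next
  case False
  assume k: "k \<le> 2 * m"
  obtain i where i: "k = 2 * i + 1" using False by (elim oddE)
  then have p: "real k / 2 = real i + 1/2" "i < m" using k by (auto simp: add_divide_distrib)
  have "sin (2 * pi * (real i + 1/2)) = 0" using sin_cos_2pi_Ints(1)[of "real i" "1/2"] by simp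
  then have "2 * ang (real k / 2) = 2 * lev i + d i" unfolding p(1) using ang_eq[of i "real i + 1/2"] p(2) by simp
  moreover have "d i \<in> \<int>" using d01[of i] by (elim disjE) simp_all
  ultimately show ?thesis using lev_Ints[of i] by (simp add: Ints_add Ints_mult)
qed

text \<open>On a plateau the slope is constant, so points there have to be separated by
  \<open>xx\<close>. As \<open>sin (2 * pi * ang p)\<close> vanishes at \<open>k / 2\<close>, the
  variation of \<open>Rad\<close> enters \<open>xx\<close> with a small factor and the strict
  monotonicity of \<open>ang\<close> prevails. For odd \<open>k\<close> the derivative of
  \<open>ang\<close> at \<open>k / 2\<close> is \<open>d i - pi / 4\<close>, which is not 0.\<close>

lemma xx_lens:
  assumes k: "k \<le> 2 * m"
  shows "\<exists>e>0. \<forall>p\<in>{0..real m}. \<forall>q\<in>{0..real m}. \<bar>p - real k / 2\<bar> < e \<longrightarrow> \<bar>q - real k / 2\<bar> < e \<longrightarrow> p < q \<longrightarrow> xx p \<noteq> xx q"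
proof -
  define u where "u = real k / 2"
  have u: "u \<in> {0..real m + 1}" using k by (simp add: u_def)
  have "\<exists>e>0. \<exists>c>0. \<forall>p\<in>{0..real m}. \<forall>q\<in>{0..real m}. \<bar>p - u\<bar> < e \<longrightarrow> \<bar>q - u\<bar> < e \<longrightarrow> p < q \<longrightarrow> c * (q - p) \<le> \<bar>ang q - ang p\<bar>"
  proof (cases "even k")
    case True
    then have "u = real_of_int (int (k div 2))" by (simp add: u_def real_of_nat_div)
    then have "(1/8) * (q - p) \<le> \<bar>ang q - ang p\<bar>" if "p \<in> {0..real m}" "q \<in> {0..real m}" "\<bar>p - u\<bar> < 1/8" "\<bar>q - u\<bar> < 1/8" "p < q" for p q
      using ang_lens_int[of p q "int (k div 2)"] that by simp
    then show ?thesis by (metis zero_less_divide_1_iff zero_less_numeral)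
  next
    case False
    obtain i where i: "k = 2 * i + 1" using False by (elim oddE)
    then have p: "u = real i + 1/2" "i < m" using k by (auto simp: u_def add_divide_distrib)
    have "cos (2 * pi * u) = -1" using sin_cos_2pi_Ints(2)[of "real i" "1/2"] p by simp
    then have "d i + pi * cos (2 * pi * u) / 4 \<noteq> 0" using pi_less_4 pi_gt_zero d01[of i] by auto
    then show ?thesis using ang_interior_lens[of i u] p by fastforce
  qed
  then obtain e c where e: "e > 0" and c: "c > 0"
    and lens: "\<And>p q. p \<in> {0..real m} \<Longrightarrow> q \<in> {0..real m} \<Longrightarrow> \<bar>p - u\<bar> < e \<Longrightarrow> \<bar>q - u\<bar> < e \<Longrightarrow> p < q \<Longrightarrow> c * (q - p) \<le> \<bar>ang q - ang p\<bar>"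
    by blast
  obtain MA where MA: "MA \<ge> 0" "\<And>u v. u \<in> {0..real m + 1} \<Longrightarrow> v \<in> {0..real m + 1} \<Longrightarrow> \<bar>ang u - ang v\<bar> \<le> MA * \<bar>u - v\<bar>"
    using lipfam_ang by (elim lipfamE) (metis atLeastAtMost_iff order_refl zero_le_one)
  obtain MR where MR: "MR \<ge> 0" "\<And>u v. u \<in> {0..real m + 1} \<Longrightarrow> v \<in> {0..real m + 1} \<Longrightarrow> \<bar>Rad u - Rad v\<bar> \<le> MR * \<bar>u - v\<bar>"
    using lipfam_Rad by (elim lipfamE) (metis atLeastAtMost_iff order_refl zero_le_one)
  obtain j :: int where j: "2 * ang u = of_int j" using ang_half[OF k] unfolding u_def by (elim Ints_cases)
  have ju: "ang u = j / 2" using j by simp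
  define s where "s p = sin (2 * pi * ang p)" for p
  have su: "s u = 0"
  proof -
    have "2 * pi * ang u = of_int j * pi" using j by (simp add: algebra_simps)
    then show ?thesis unfolding s_def sin_zero_iff_int2 by blast
  qed
  \<comment> \<open>The second bound keeps \<open>ang\<close> within 1/8 of a half-integer, as
    \<open>half_angle_lens\<close> demands; the third makes the contribution of \<open>Rad\<close>
    smaller than that of \<open>ang\<close>.\<close>
  define E where "E = min e (min (1 / (8 * (1 + MA))) (c / (8 * (1 + MA) * (1 + MR))))"
  have E: "E > 0" unfolding E_def using e c MA(1) MR(1) by simp
  have "xx p \<noteq> xx q" if pq: "p \<in> {0..real m}" "q \<in> {0..real m}" "\<bar>p - u\<bar> < E" "\<bar>q - u\<bar> < E" "p < q" for p q
  proof
    assume eq: "xx p = xx q"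
    have near: "\<bar>ang x - ang u\<bar> \<le> 1/8" "\<bar>s x\<bar> * MR < c" if x: "x \<in> {0..real m}" "\<bar>x - u\<bar> < E" for x
    proof -
      have a: "\<bar>ang x - ang u\<bar> \<le> (1 + MA) * \<bar>x - u\<bar>"
        using MA(2)[of x u] x u by (auto simp: distrib_right)
      also have "\<dots> \<le> (1 + MA) * (1 / (8 * (1 + MA)))" using x MA(1) by (intro mult_left_mono) (auto simp: E_def)
      also have "\<dots> = 1/8" using MA(1) by simp
      finally show "\<bar>ang x - ang u\<bar> \<le> 1/8" .
      have "\<bar>s x\<bar> = \<bar>s x - s u\<bar>" by (simp add: su)
      also have "\<dots> \<le> \<bar>2 * pi * ang x - 2 * pi * ang u\<bar>" unfolding s_def by (rule sin_diff_le)
      also have "\<dots> = 2 * pi * \<bar>ang x - ang u\<bar>" by (simp add: abs_mult flip: right_diff_distrib)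
      also have "\<dots> \<le> 2 * 4 * ((1 + MA) * \<bar>x - u\<bar>)" using a pi_less_4 by (intro mult_mono) auto
      also have "\<dots> = 8 * (1 + MA) * \<bar>x - u\<bar>" by simp
      finally have "\<bar>s x\<bar> * MR \<le> (8 * (1 + MA) * \<bar>x - u\<bar>) * (1 + MR)"
        using MA(1) MR(1) by (intro mult_mono) auto
      also have "\<dots> < 8 * (1 + MA) * (c / (8 * (1 + MA) * (1 + MR))) * (1 + MR)"
        using x MA(1) MR(1) by (intro mult_strict_right_mono mult_strict_left_mono) (auto simp: E_def)
      also have "\<dots> = c"
      proof -
        have "a * (c / (a * b)) * b = c" if "a > 0" "b > 0" for a b :: real using that by simp
        from this[of "8 * (1 + MA)" "1 + MR"] show ?thesis using MA(1) MR(1) by simp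
      qed
      finally show "\<bar>s x\<bar> * MR < c" .
    qed
    have "c * (q - p) \<le> \<bar>ang q - ang p\<bar>" using pq by (intro lens) (auto simp: E_def)
    also have "\<dots> = \<bar>ang p - ang q\<bar>" by simp
    also have "\<dots> \<le> \<bar>s p - s q\<bar>" unfolding s_def
      using near(1)[of p] near(1)[of q] pq ju by (intro half_angle_lens[of _ j]) auto
    also have "\<dots> \<le> Rad p * \<bar>s p - s q\<bar>" using mult_right_mono[OF Rad_ge_1[of p], of "\<bar>s p - s q\<bar>"] pq by simp
    also have "\<dots> = \<bar>Rad p * s p - Rad p * s q\<bar>" using Rad_ge_1[of p] pq by (simp add: abs_mult flip: right_diff_distrib)
    also have "Rad p * s p - Rad p * s q = s q * (Rad q - Rad p)" using eq by (simp add: xx_def s_def algebra_simps)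
    also have "\<bar>s q * (Rad q - Rad p)\<bar> \<le> \<bar>s q\<bar> * (MR * (q - p))"
      using MR(2)[of q p] pq by (auto simp: abs_mult intro!: mult_left_mono)
    also have "\<dots> = (\<bar>s q\<bar> * MR) * (q - p)" by simp
    also have "\<dots> < c * (q - p)" using near(2)[of q] pq by (intro mult_strict_right_mono) auto
    finally show False by simp
  qed
  with E show ?thesis unfolding u_def by blast
qed

lemma xx_lens_uniform:
  "\<exists>e>0. e < 1/8 \<and> (\<forall>k\<le>2 * m. \<forall>p\<in>{0..real m}. \<forall>q\<in>{0..real m}. \<bar>p - real k / 2\<bar> \<le> e \<longrightarrow> \<bar>q - real k / 2\<bar> \<le> e \<longrightarrow> p < q \<longrightarrow> xx p \<noteq> xx q)"
proof -
  have "\<forall>k. \<exists>e. k \<le> 2 * m \<longrightarrow> e > 0 \<and> (\<forall>p\<in>{0..real m}. \<forall>q\<in>{0..real m}. \<bar>p - real k / 2\<bar> < e \<longrightarrow> \<bar>q - real k / 2\<bar> < e \<longrightarrow> p < q \<longrightarrow> xx p \<noteq> xx q)"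
    using xx_lens by blast
  then obtain e where e: "\<And>k. k \<le> 2 * m \<Longrightarrow> e k > 0 \<and> (\<forall>p\<in>{0..real m}. \<forall>q\<in>{0..real m}. \<bar>p - real k / 2\<bar> < e k \<longrightarrow> \<bar>q - real k / 2\<bar> < e k \<longrightarrow> p < q \<longrightarrow> xx p \<noteq> xx q)"
    by metis
  define E where "E = min (1/9) (Min (e ` {..2 * m}) / 2)"
  have "Min (e ` {..2 * m}) > 0" using e by (subst Min_gr_iff) auto
  then have E: "E > 0" "E < 1/8" by (auto simp: E_def)
  have "E < e k" if "k \<le> 2 * m" for k
  proof -
    have "Min (e ` {..2 * m}) \<le> e k" using that by (intro Min_le) auto
    then show ?thesis using \<open>Min (e ` {..2 * m}) > 0\<close> unfolding E_def by linarith
  qed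
  then have "\<forall>k\<le>2 * m. \<forall>p\<in>{0..real m}. \<forall>q\<in>{0..real m}. \<bar>p - real k / 2\<bar> \<le> E \<longrightarrow> \<bar>q - real k / 2\<bar> \<le> E \<longrightarrow> p < q \<longrightarrow> xx p \<noteq> xx q"
    using e by (meson le_less_trans)
  with E show ?thesis by blast
qed

end


lemma lipfam_continuous:
  assumes "lipfam I (\<lambda>_. f)"
  shows "continuous_on I f"
proof -
  obtain M where M: "M \<ge> 0" "\<And>u v. u \<in> I \<Longrightarrow> v \<in> I \<Longrightarrow> \<bar>f u - f v\<bar> \<le> M * \<bar>u - v\<bar>"
    using assms by (elim lipfamE) (metis atLeastAtMost_iff order_refl zero_le_one)
  have "M-lipschitz_on I f"
    by (rule lipschitz_onI) (use M in \<open>auto simp: dist_real_def\<close>)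
  then show ?thesis by (rule lipschitz_on_continuous_on)
qed

text \<open>Otherwise the ray from \<open>Q\<close> away from the origin would be a connected
  unbounded set in the complement of \<open>L\<close>, whereas the component of \<open>Q\<close> is
  bounded.\<close>

lemma inside_ray:
  fixes Q :: complex
  assumes Q: "Q \<in> inside L" "Q \<noteq> 0"
  obtains l :: real where "l \<ge> 1" "of_real l * Q \<in> L"
proof (rule ccontr)
  assume "\<not> thesis"
  then have disj: "(\<lambda>l. of_real l * Q) ` {1..} \<subseteq> - L" using that by auto
  have conn: "connected ((\<lambda>l::real. of_real l * Q) ` {1..})"
    by (intro connected_continuous_image continuous_intros) (simp add: is_interval_connected)
  have "(\<lambda>l. of_real l * Q) ` {1..} \<subseteq> connected_component_set (- L) Q"
    by (rule connected_component_maximal[OF _ conn disj]) (auto intro: image_eqI[of _ _ 1])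
  moreover have "bounded (connected_component_set (- L) Q)" using Q by (simp add: inside_def)
  ultimately have "bounded ((\<lambda>l::real. of_real l * Q) ` {1..})" by (meson bounded_subset)
  then obtain B where B: "\<And>l::real. l \<ge> 1 \<Longrightarrow> norm (of_real l * Q) \<le> B" unfolding bounded_iff by auto
  define l where "l = max 1 ((B + 1) / norm Q)"
  have "(B + 1) / norm Q * norm Q \<le> l * norm Q" by (intro mult_right_mono) (auto simp: l_def)
  then have "B + 1 \<le> norm (of_real l * Q)" using Q by (simp add: norm_mult l_def)
  then show False using B[of l] by (simp add: l_def)
qed

lemma homeomorphism_mult:
  fixes c :: complex
  assumes "c \<noteq> 0"
  shows "homeomorphism UNIV UNIV (\<lambda>z. c * z) (\<lambda>z. z / c)"
  by (rule homeomorphismI) (use assms in \<open>auto intro!: continuous_intros\<close>)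

subsection \<open>The petal projection of the spiral\<close>

locale petal_spiral = spiral +
  fixes \<delta> :: real
  assumes \<delta>: "0 < \<delta>" "\<delta> < 1/8"
    and xx_plateau: "\<And>k p q. k \<le> 2 * m \<Longrightarrow> p \<in> {0..real m} \<Longrightarrow> q \<in> {0..real m} \<Longrightarrow>
       \<bar>p - real k / 2\<bar> \<le> \<delta> \<Longrightarrow> \<bar>q - real k / 2\<bar> \<le> \<delta> \<Longrightarrow> p < q \<Longrightarrow> xx p \<noteq> xx q"
begin

text \<open>The lines are equidistant, so that a rotation suffices to bring the strand ends to the
  rays of \<open>uebercrossing_projection\<close>. The shift by 1/2 avoids the vertical line, so
  that all slopes exist.\<close>

definition strand_angle :: "nat \<Rightarrow> real" where
  "strand_angle k = pi * (real k + 1/2) / real (2 * m + 1) - pi / 2"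

definition slope :: "nat \<Rightarrow> real" where "slope k = tan (strand_angle k)"

definition S :: "real \<Rightarrow> real" where "S = stairs slope (2 * m) \<delta>"

definition bump :: "real \<Rightarrow> real" where
  "bump p = max 0 (min (p - real m - 1/4) (real m + 3/4 - p))"

text \<open>The bump moves the middle of the closing loop off the multi-crossing.\<close>

definition Y :: "real \<Rightarrow> real" where
  "Y p = S (min p (real m)) * xx (min p (real m)) +
     (slope (2 * m) * max 0 (xx (max p (real m))) + slope 0 * min 0 (xx (max p (real m)))) + bump p"

definition flat :: "real \<Rightarrow> real \<Rightarrow> real^3" where
  "flat t p = vector [xx p, (1 - t) * yy p + t * Y p, zz p]"

lemma strand_angle_range: "k \<le> 2 * m \<Longrightarrow> - pi / 2 < strand_angle k" "k \<le> 2 * m \<Longrightarrow> strand_angle k < pi / 2"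
proof -
  assume k: "k \<le> 2 * m"
  have h: "0 < (real k + 1/2) / real (2 * m + 1)" "(real k + 1/2) / real (2 * m + 1) < 1" using k by auto
  have "0 < pi * ((real k + 1/2) / real (2 * m + 1))" "pi * ((real k + 1/2) / real (2 * m + 1)) < pi * 1"
    by (rule mult_pos_pos[OF pi_gt_zero h(1)], rule mult_strict_left_mono[OF h(2) pi_gt_zero])
  moreover have "strand_angle k = pi * ((real k + 1/2) / real (2 * m + 1)) - pi / 2" by (simp add: strand_angle_def)
  ultimately show "- pi / 2 < strand_angle k" "strand_angle k < pi / 2" by linarith+
qed

lemma slope_less: "j < k \<Longrightarrow> k \<le> 2 * m \<Longrightarrow> slope j < slope k"
  unfolding slope_def
  using strand_angle_range[of j] strand_angle_range[of k]
  by (intro tan_monotone) (auto simp: strand_angle_def divide_strict_right_mono)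

lemma S_mono: "p \<le> q \<Longrightarrow> S p \<le> S q"
  unfolding S_def using slope_less \<delta> by (intro stairs_mono) auto

lemma S_plateau: "k \<le> 2 * m \<Longrightarrow> \<bar>p - real k / 2\<bar> \<le> \<delta> \<Longrightarrow> S p = slope k"
  unfolding S_def using slope_less \<delta> by (intro stairs_plateau) auto

lemma S_half: "k \<le> 2 * m \<Longrightarrow> S (real k / 2) = slope k"
  using S_plateau[of k "real k / 2"] \<delta> by simp

lemma S_eqD:
  assumes "0 \<le> p" "p < q" "q \<le> real m" "S p = S q"
  obtains k where "k \<le> 2 * m" "\<bar>p - real k / 2\<bar> \<le> \<delta>" "\<bar>q - real k / 2\<bar> \<le> \<delta>"
  by (rule stairs_eqD[of "2 * m" slope \<delta> p q]) (use slope_less \<delta> assms that in \<open>auto simp: S_def\<close>)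

lemma bump_le: "p \<le> real m + 1/4 \<Longrightarrow> bump p = 0" "real m + 3/4 \<le> p \<Longrightarrow> bump p = 0"
  by (auto simp: bump_def)

lemma bump_nonneg: "bump p \<ge> 0" by (simp add: bump_def)

lemma sgn_xx:
  assumes "0 \<le> p" "p \<le> real m"
  shows "sgn (xx p) = sgn (sin (2 * pi * p))"
  using sgn_ang[OF assms] Rad_ge_1[of p] assms by (simp add: xx_def sgn_mult)

lemma xx_last:
  assumes "real m \<le> p" "p \<le> real m + 1"
  shows "xx p = Rad p * sin (2 * pi * (p - real m))" "Rad p = 2 + rad p" "yy p = 0"
proof -
  show "xx p = Rad p * sin (2 * pi * (p - real m))"
    using ang_last[OF assms] sin_cos_2pi_Ints(1)[OF lev_Ints, of m "p - real m"] by (simp add: xx_def)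
  show "Rad p = 2 + rad p" "yy p = 0"
    using sin_cos_2pi_Ints[of "real m" 0] assms by (simp_all add: Rad_def yy_def min_absorb2)
qed

lemma xx_m: "xx (real m) = 0" using xx_last(1)[of "real m"] by simp

lemma Y_le: "p \<le> real m \<Longrightarrow> Y p = S p * xx p"
  by (simp add: Y_def min_absorb1 max_absorb2 xx_m bump_le)

text \<open>The closing loop leaves to the right along the steepest line and returns from the left
  along the line of strand 0. In between it passes above the crossing, through the sector around the
  positive vertical axis, which is kept free of the other loops.\<close>

lemma Y_ge: "real m \<le> p \<Longrightarrow> Y p = slope (2 * m) * max 0 (xx p) + slope 0 * min 0 (xx p) + bump p"
  by (simp add: Y_def min_absorb2 max_absorb1 xx_m)

lemma lipfam_Y: "lipfam {0..real m + 1} (\<lambda>_. Y)"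
proof -
  have S: "lipfam {0..real m + 1} (\<lambda>_. S)"
    unfolding S_def stairs_def clamp01_def divide_inverse
    by (intro lipfam_add lipfam_sum lipfam_mult lipfam_const lipfam_max lipfam_min lipfam_diff lipfam_id)
  have mn: "lipfam {0..real m + 1} (\<lambda>_ p. min p (real m))" "lipfam {0..real m + 1} (\<lambda>_ p. max p (real m))"
    by (intro lipfam_min lipfam_max lipfam_id lipfam_const)+
  have 1: "lipfam {0..real m + 1} (\<lambda>_ p. S (min p (real m)))" "lipfam {0..real m + 1} (\<lambda>_ p. xx (min p (real m)))"
    "lipfam {0..real m + 1} (\<lambda>_ p. xx (max p (real m)))"
    by (rule lipfam_compose[OF S mn(1)] lipfam_compose[OF lipfam_xyz(1) mn(1)] lipfam_compose[OF lipfam_xyz(1) mn(2)]; auto)+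
  show ?thesis
    unfolding Y_def bump_def
    by (intro lipfam_add lipfam_mult lipfam_const lipfam_max lipfam_min lipfam_diff lipfam_id 1)
qed

lemma sin_zero_half: "sin (2 * pi * p) = 0 \<longleftrightarrow> 2 * p \<in> \<int>"
  using sin_pi_eq_0_iff[of "2 * p"] by (simp add: mult.commute mult.left_commute)

lemma sin_pos_le_half:
  assumes "p < real m" "sin (2 * pi * p) > 0"
  shows "p \<le> real m - 1/2"
proof (rule ccontr)
  assume "\<not> ?thesis"
  then have "sin (2 * pi * (p - real m + 1)) < 0" using assms by (intro sin_2pi_sign(2)) auto
  moreover have "sin (2 * pi * p) = sin (2 * pi * (p - real m + 1))"
    using sin_cos_2pi_Ints(1)[of "real m - 1" "p - real m + 1"] by simp
  ultimately show False using assms by simp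
qed

lemma sin_neg_ge_half:
  assumes "0 \<le> p" "sin (2 * pi * p) < 0"
  shows "1/2 < p"
proof (rule ccontr)
  assume "\<not> 1/2 < p"
  then consider "p = 0" | "p = 1/2" | "0 < p" "p < 1/2" using assms(1) by linarith
  then show False using assms(2) sin_2pi_sign(1)[of p] by cases auto
qed

lemma xz_eqD:
  assumes p: "0 \<le> p" "p \<le> real m + 1" and q: "0 \<le> q" "q \<le> real m + 1" and eq: "xx p = xx q" "zz p = zz q"
  shows "Rad p = Rad q" "ang q - ang p \<in> \<int>"
proof -
  have h: "(2 * pi * ang p - 2 * pi * ang q) / 2 = pi * (ang p - ang q)"
    by (simp add: diff_divide_distrib right_diff_distrib)
  have R: "Rad p \<ge> 1" "Rad q \<ge> 1" using Rad_ge_1 p q by auto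
  have "(Rad p - Rad q)\<^sup>2 + 4 * (Rad p * Rad q) * (sin (pi * (ang p - ang q)))\<^sup>2 = 0"
    using polar_dist[of "Rad p" "2 * pi * ang p" "Rad q" "2 * pi * ang q"] eq unfolding h by (simp add: xx_def zz_def)
  moreover have "4 * (Rad p * Rad q) * (sin (pi * (ang p - ang q)))\<^sup>2 \<ge> 0" using R by simp
  ultimately have 0: "(Rad p - Rad q)\<^sup>2 = 0" "4 * (Rad p * Rad q) * (sin (pi * (ang p - ang q)))\<^sup>2 = 0"
    using zero_le_power2[of "Rad p - Rad q"] by linarith+
  show "Rad p = Rad q" using 0(1) by simp
  have "sin (pi * (ang p - ang q)) = 0" using 0(2) R by auto
  then show "ang q - ang p \<in> \<int>" unfolding sin_pi_eq_0_iff by (metis Ints_minus minus_diff_eq)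
qed

text \<open>At a crossing of the projection to the \<open>xz\<close>-plane the later point has the larger \<open>rad\<close>, hence it is farther
  from the plane \<open>y = 0\<close>.\<close>

lemma crossing_order:
  assumes p: "0 \<le> p" "p < q" "q \<le> real m" and eq: "xx p = xx q" "Rad p = Rad q"
  shows "xx p \<noteq> 0" "xx p > 0 \<Longrightarrow> yy p < yy q" "xx p < 0 \<Longrightarrow> yy q < yy p"
proof -
  have m: "m > 0" using p by simp
  define a b where "a = p / real m" and "b = q / real m"
  have ab: "0 \<le> a" "a < b" using p m by (auto simp: a_def b_def divide_strict_right_mono)
  have R: "a * cos (2 * pi * p) = b * cos (2 * pi * q)"
    using eq(2) p by (simp add: Rad_def rad_le min_absorb1 a_def b_def)
  have Y: "yy p = a * sin (2 * pi * p)" "yy q = b * sin (2 * pi * q)"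
    using p by (simp_all add: yy_def rad_le min_absorb1 a_def b_def)
  have "(yy p)\<^sup>2 = a\<^sup>2 - (a * cos (2 * pi * p))\<^sup>2" "(yy q)\<^sup>2 = b\<^sup>2 - (b * cos (2 * pi * q))\<^sup>2"
    by (simp_all add: Y power_mult_distrib sin_squared_eq right_diff_distrib)
  moreover have "a\<^sup>2 < b\<^sup>2" using ab by (intro power_strict_mono) auto
  ultimately have less: "(yy p)\<^sup>2 < (yy q)\<^sup>2" using R by simp
  have sp: "sgn (xx p) = sgn (sin (2 * pi * p))" and sq: "sgn (xx p) = sgn (sin (2 * pi * q))"
    using sgn_xx[of p] sgn_xx[of q] eq p by auto
  show "xx p \<noteq> 0"
  proof
    assume "xx p = 0"
    then have "yy q = 0" using sq Y by (simp add: sgn_zero_iff)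
    then show False using less by simp
  qed
  show "yy p < yy q" if "xx p > 0"
  proof -
    have "sin (2 * pi * p) > 0" "sin (2 * pi * q) > 0" using sp sq that by (metis sgn_greater)+
    then have "yy q \<ge> 0" using ab by (simp add: Y)
    then show ?thesis using less by (metis power2_less_imp_less)
  qed
  show "yy q < yy p" if "xx p < 0"
  proof -
    have "sin (2 * pi * p) < 0" "sin (2 * pi * q) < 0" using sp sq that by (metis sgn_less)+
    then have "0 \<le> - yy q" using ab by (simp add: Y mult_nonneg_nonpos)
    moreover have "(- yy p)\<^sup>2 < (- yy q)\<^sup>2" using less by simp
    ultimately have "- yy p < - yy q" by (rule power2_less_imp_less[rotated])
    then show ?thesis by simp
  qed
qed

text \<open>In the half turn just before \<open>m\<close> the first coordinate is not positive.
  Points where it is positive therefore come early enough to have at most the last slope but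
  one.\<close>

lemma S_less_last:
  assumes "0 \<le> p" "p < real m" "sin (2 * pi * p) > 0"
  shows "S p < slope (2 * m)"
proof -
  have m: "m > 0" using assms by simp
  have "p \<le> real (2 * m - 1) / 2" using sin_pos_le_half[OF assms(2,3)] m by (simp add: of_nat_diff diff_divide_distrib)
  then have "S p \<le> S (real (2 * m - 1) / 2)" by (rule S_mono)
  also have "\<dots> = slope (2 * m - 1)" by (rule S_half) simp
  also have "\<dots> < slope (2 * m)" using m by (intro slope_less) auto
  finally show ?thesis .
qed

lemma S_greater_first:
  assumes "0 \<le> p" "p \<le> real m" "sin (2 * pi * p) < 0"
  shows "slope 0 < S p"
proof -
  have p: "1/2 < p" using sin_neg_ge_half assms by blast
  then have "0 < real m" using assms by linarith
  then have m: "m > 0" by simp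
  have "slope 0 < slope 1" using m by (intro slope_less) auto
  also have "slope 1 = S (real 1 / 2)" using S_half[of 1] m by simp
  also have "\<dots> \<le> S p" using p by (intro S_mono) simp
  finally show ?thesis .
qed

text \<open>The coordinates \<open>xx\<close> and \<open>zz\<close> do not move, so a collision lies
  over a crossing in the xz-plane. At each of these \<open>yy\<close> and \<open>Y\<close> order the
  two points in the same way, hence so does every convex combination. For two points of the spiral
  this is \<open>crossing_order\<close> together with the growth of the slope.\<close>

lemma flat_inj:
  assumes t: "0 \<le> t" "t \<le> 1" and p: "0 \<le> p" "p < q" "q \<le> real m + 1" and eq: "flat t p = flat t q"
  shows "p = 0 \<and> q = real m + 1"
proof -
  have x: "xx p = xx q" and z: "zz p = zz q" and y: "(1 - t) * yy p + t * Y p = (1 - t) * yy q + t * Y q"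
    using eq by (simp_all add: flat_def vec_eq_iff forall_3)
  have R: "Rad p = Rad q" and A: "ang q - ang p \<in> \<int>" using xz_eqD[of p q] p x z by auto
  \<comment> \<open>A strict inequality for \<open>yy\<close> and a weak one for \<open>Y\<close>
    leave only \<open>t = 1\<close> with equality of the latter. On the spiral equal slopes then put
    both points on one plateau, against \<open>xx_plateau\<close>.\<close>
  have comb: "t = 1 \<and> a' = b'" if "a < b" "a' \<le> b'" "(1 - t) * a + t * a' = (1 - t) * b + t * b'" for a b a' b'
  proof -
    have "(1 - t) * (b - a) + t * (b' - a') = 0" using that(3) by (simp add: algebra_simps)
    moreover have "(1 - t) * (b - a) \<ge> 0" "t * (b' - a') \<ge> 0" using that t by auto
    ultimately have "(1 - t) * (b - a) = 0" "t * (b' - a') = 0" by linarith+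
    then show ?thesis using that(1) by auto
  qed
  consider "q \<le> real m" | "real m \<le> p" | "p < real m" "real m < q" by linarith
  then show ?thesis
  proof cases
    case 1
    have Y: "Y p = S p * xx p" "Y q = S q * xx p" using Y_le[of p] Y_le[of q] p 1 x by auto
    have S: "S p \<le> S q" using p by (intro S_mono) simp
    have False
    proof (cases "xx p > 0")
      case True
      have "Y p \<le> Y q" unfolding Y using S True by (intro mult_right_mono) auto
      from comb[OF crossing_order(2)[OF p(1,2) 1 x R True] this y] have "S p = S q" using True by (simp add: Y)
      then show False using S_eqD[OF p(1,2) 1] xx_plateau[of _ p q] p 1 x by auto
    next
      case False
      then have neg: "xx p < 0" using crossing_order(1)[OF p(1,2) 1 x R] by simp
      have "Y q \<le> Y p" unfolding Y using S neg by (intro mult_right_mono_neg) auto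
      from comb[OF crossing_order(3)[OF p(1,2) 1 x R neg] this y[symmetric]] have "S p = S q" using neg by (simp add: Y)
      then show False using S_eqD[OF p(1,2) 1] xx_plateau[of _ p q] p 1 x by auto
    qed
    then show ?thesis ..
  next
    case 2
    then have "ang q - ang p = q - p" using p by (intro ang_lens_last) auto
    then obtain k :: int where k: "q - p = of_int k" using A by (auto elim: Ints_cases)
    have "0 < real_of_int k" "real_of_int k \<le> 1" using k p 2 by auto
    then have "k = 1" by linarith
    then have "q - p = 1" using k by simp
    then have pq: "q = real m + 1" "p = real m" using p 2 by linarith+
    have "m = 0"
    proof (rule ccontr)
      assume "m \<noteq> 0"
      then have "rad (real m) = 1" by (simp add: rad_le)
      then show False using R pq xx_last(2)[of "real m"] xx_last(2)[of "real m + 1"] rad_end(1) by simp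
    qed
    then show ?thesis using pq by simp
  next
    case 3
    then have "0 < real m" using p by linarith
    then have m: "m > 0" by simp
    have "p / real m * cos (2 * pi * p) \<le> p / real m * 1" using p by (intro mult_left_mono) auto
    then have Rp: "Rad p \<le> 2 + p / real m" using 3 by (simp add: Rad_def rad_le min_absorb1)
    have pm: "p / real m < 1" using 3 m by simp
    have Rq: "Rad q = 2 + rad q" "xx q = Rad q * sin (2 * pi * (q - real m))" "yy q = 0" using 3 p by (auto intro: xx_last)
    \<comment> \<open>Before its drop the closing turn is at distance 3 from the axis, farther than
      every earlier point.\<close>
    have w: "real m + 3/4 < q"
    proof (rule ccontr)
      assume "\<not> real m + 3/4 < q"
      then have "rad q = 1" using 3 m by (simp add: rad_ge)
      then show False using Rp pm Rq(1) R by simp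
    qed
    show ?thesis
    proof (cases "q = real m + 1")
      case True
      then have "xx p = 0" using x Rq(2) by simp
      then have "sin (2 * pi * p) = 0" using sgn_xx[of p] p 3 by (simp add: sgn_zero_iff)
      then have "cos (2 * pi * p) \<noteq> 0" using sin_cos_squared_add[of "2 * pi * p"] by auto
      moreover have "p / real m * cos (2 * pi * p) = 0"
        using R Rq(1) True rad_end(1) 3 by (simp add: Rad_def rad_le min_absorb1)
      ultimately have "p = 0" using m by simp
      then show ?thesis using True by simp
    next
      case False
      then have "sin (2 * pi * (q - real m)) < 0" using w p by (intro sin_2pi_sign(2)) auto
      then have neg: "xx q < 0" using Rq(2) Rad_ge_1[of q] 3 p by (simp add: mult_pos_neg)
      have s: "sin (2 * pi * p) < 0" using sgn_xx[of p] p 3 x neg by (metis sgn_less less_imp_le)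
      have p0: "p > 0" using s p by (cases "p = 0") auto
      have "yy p = p / real m * sin (2 * pi * p)" using 3 by (simp add: yy_def rad_le min_absorb1)
      also have "\<dots> < 0" using s p0 m by (intro mult_pos_neg) auto
      also have "0 = yy q" using Rq(3) by simp
      finally have yy: "yy p < yy q" .
      have Yq: "Y q = slope 0 * xx q" using Y_ge[of q] 3 neg w by (simp add: bump_le)
      have "S p * xx q < slope 0 * xx q" using S_greater_first[of p] s p 3 neg by (intro mult_strict_right_mono_neg) auto
      then have "Y p < Y q" using Y_le[of p] 3 x Yq by simp
      then show ?thesis using comb[of "yy p" "yy q" "Y p" "Y q"] yy y by simp
    qed
  qed
qed

text \<open>Both bounds hold already in the xz-plane, hence uniformly in \<open>t\<close>.\<close>

lemma planar_lower:
  assumes "0 \<le> p" "p \<le> real m + 1" "0 \<le> q" "q \<le> real m + 1"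
  shows "n \<in> \<int> \<Longrightarrow> \<bar>ang q - ang p - n\<bar> \<le> 1/4 \<Longrightarrow> \<bar>ang q - ang p - n\<bar> \<le> norm (flat t p - flat t q)"
    "\<bar>Rad q - Rad p\<bar> \<le> norm (flat t p - flat t q)"
proof -
  have R: "Rad p \<ge> 1" "Rad q \<ge> 1" using Rad_ge_1 assms by auto
  have xz: "(xx p - xx q)\<^sup>2 + (zz p - zz q)\<^sup>2 \<le> (norm (flat t p - flat t q))\<^sup>2"
    unfolding norm3_squared by (simp add: flat_def)
  show "\<bar>ang q - ang p - n\<bar> \<le> norm (flat t p - flat t q)" if "n \<in> \<int>" "\<bar>ang q - ang p - n\<bar> \<le> 1/4"
  proof -
    have "(ang q - ang p - n)\<^sup>2 \<le> (xx p - xx q)\<^sup>2 + (zz p - zz q)\<^sup>2"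
      unfolding xx_def zz_def by (rule polar_angle_bound[OF R that])
    then have "(ang q - ang p - n)\<^sup>2 \<le> (norm (flat t p - flat t q))\<^sup>2" using xz by linarith
    then show ?thesis unfolding abs_le_square_iff[symmetric] by simp
  qed
  have "(Rad q - Rad p)\<^sup>2 \<le> (xx p - xx q)\<^sup>2 + (zz p - zz q)\<^sup>2"
    unfolding xx_def zz_def polar_dist using R by (simp add: power2_commute)
  then have "(Rad q - Rad p)\<^sup>2 \<le> (norm (flat t p - flat t q))\<^sup>2" using xz by linarith
  then show "\<bar>Rad q - Rad p\<bar> \<le> norm (flat t p - flat t q)" unfolding abs_le_square_iff[symmetric] by simp
qed

lemma ends: "xx 0 = 0" "xx (real m + 1) = 0" "yy 0 = 0" "yy (real m + 1) = 0" "Y 0 = 0" "Y (real m + 1) = 0"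
  "zz 0 = 2" "zz (real m + 1) = 2"
proof -
  have a: "sin (2 * pi * ang 0) = 0" "cos (2 * pi * ang 0) = 1" using ang_start by simp_all
  have b: "sin (2 * pi * ang (real m + 1)) = 0" "cos (2 * pi * ang (real m + 1)) = 1"
    using ang_end sin_cos_2pi_Ints[OF lev_Ints, of m 1] by simp_all
  have R: "Rad 0 = 2" "Rad (real m + 1) = 2" by (simp_all add: Rad_def rad_end)
  show x: "xx 0 = 0" "xx (real m + 1) = 0" by (simp_all add: xx_def a b)
  show "zz 0 = 2" "zz (real m + 1) = 2" by (simp_all add: zz_def a b R)
  show "yy 0 = 0" "yy (real m + 1) = 0" by (simp_all add: yy_def rad_end)
  show "Y 0 = 0" using Y_le[of 0] x by simp
  show "Y (real m + 1) = 0" using Y_ge[of "real m + 1"] x by (simp add: bump_le)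
qed

lemma flat_isotopy: "ambient_isotopic (flat 0 ` {0..real m + 1}) (flat 1 ` {0..real m + 1})"
proof (rule lipfam_isotopy)
  show "(0::real) < real m + 1" by simp
  obtain MA where MA: "MA \<ge> 0" "\<And>u v. u \<in> {0..real m + 1} \<Longrightarrow> v \<in> {0..real m + 1} \<Longrightarrow> \<bar>ang u - ang v\<bar> \<le> MA * \<bar>u - v\<bar>"
    using lipfam_ang by (elim lipfamE) (metis atLeastAtMost_iff order_refl zero_le_one)
  define \<epsilon> where "\<epsilon> = 1 / (8 * (1 + MA))"
  have \<epsilon>: "\<epsilon> > 0" using MA(1) by (simp add: \<epsilon>_def)
  have small: "MA * x \<le> 1/8" if "x \<le> \<epsilon>" "x \<ge> 0" for x
  proof -
    have "MA * x \<le> (1 + MA) * \<epsilon>" using that MA(1) by (intro mult_mono) auto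
    also have "\<dots> = 1/8" using MA(1) by (simp add: \<epsilon>_def)
    finally show ?thesis .
  qed
  have "lipfam {0..real m + 1} (\<lambda>t u. (1 - t) * yy u + t * Y u)"
    by (intro lipfam_add lipfam_mult lipfam_diff lipfam_const lipfam_param lipfam_xyz lipfam_Y)
  then show "lipfam {0..real m + 1} (\<lambda>t u. flat t u $ i)" for i
    using exhaust_3[of i] lipfam_xyz by (auto simp: flat_def)
  show "flat t 0 = flat t (real m + 1)" for t by (simp add: flat_def ends)
  show "u = 0 \<and> v = real m + 1"
    if "t \<in> {0..1}" "u \<in> {0..real m + 1}" "v \<in> {0..real m + 1}" "u < v" "flat t u = flat t v" for t u v
    using flat_inj[of t u v] that by simp
  show "\<exists>e>0. \<exists>c>0. \<forall>t\<in>{0..1::real}. \<forall>u\<in>{0..real m + 1}. \<forall>v\<in>{0..real m + 1}. \<bar>u - u0\<bar> < e \<longrightarrow> \<bar>v - u0\<bar> < e \<longrightarrow> u < v \<longrightarrow>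
       c * (v - u) \<le> norm (flat t u - flat t v)" if u0: "u0 \<in> {0..real m + 1}" for u0
  proof -
    obtain e c where ec: "e > 0" "c > 0" and lens: "\<And>u v. u \<in> {0..real m + 1} \<Longrightarrow> v \<in> {0..real m + 1} \<Longrightarrow> \<bar>u - u0\<bar> < e \<Longrightarrow> \<bar>v - u0\<bar> < e \<Longrightarrow> u < v \<Longrightarrow>
       c * (v - u) \<le> \<bar>ang v - ang u\<bar> \<or> c * (v - u) \<le> \<bar>Rad v - Rad u\<bar>"
      using planar_lens[of u0] u0 by (metis atLeastAtMost_iff)
    have "c * (v - u) \<le> norm (flat t u - flat t v)"
      if uv: "u \<in> {0..real m + 1}" "v \<in> {0..real m + 1}" "\<bar>u - u0\<bar> < min e (\<epsilon>/2)" "\<bar>v - u0\<bar> < min e (\<epsilon>/2)" "u < v" for t u v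
    proof -
      have "\<bar>v - u\<bar> \<le> \<epsilon>" using uv(3,4) unfolding min_less_iff_conj by linarith
      then have "\<bar>ang v - ang u - 0\<bar> \<le> 1/4" using MA(2)[OF uv(2,1)] small[of "\<bar>v - u\<bar>"] by simp
      then have "\<bar>ang v - ang u\<bar> \<le> norm (flat t u - flat t v)" "\<bar>Rad v - Rad u\<bar> \<le> norm (flat t u - flat t v)"
        using planar_lower(1)[of u v 0 t] planar_lower(2)[of u v t] uv by simp_all
      moreover have "c * (v - u) \<le> \<bar>ang v - ang u\<bar> \<or> c * (v - u) \<le> \<bar>Rad v - Rad u\<bar>"
        using uv by (intro lens) auto
      ultimately show ?thesis by linarith
    qed
    moreover have "0 < min e (\<epsilon>/2)" using ec \<epsilon> by simp
    ultimately show ?thesis using ec(2) by blast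
  qed
  have "1/8 * ((u - 0) + (real m + 1 - v)) \<le> norm (flat t u - flat t v)"
    if uv: "u \<in> {0..real m + 1}" "v \<in> {0..real m + 1}" "u - 0 < min (1/8) \<epsilon>" "real m + 1 - v < min (1/8) \<epsilon>" for t u v
  proof -
    have a: "u / 8 \<le> ang u - ang 0" using ang_lens_int[of 0 u 0] uv by simp
    have b: "real m + 1 - v = ang (real m + 1) - ang v" using ang_lens_last[of v "real m + 1"] uv by simp
    have c: "ang u - ang 0 \<le> 1/8" using MA(2)[of u 0] small[of u] uv by simp
    have d: "ang v - ang u - lev m = - ((ang u - ang 0) + (real m + 1 - v))" unfolding b by (simp add: ang_start ang_end)
    have "\<bar>ang v - ang u - lev m\<bar> \<le> 1/4" unfolding d using a c uv by auto
    then have "\<bar>ang v - ang u - lev m\<bar> \<le> norm (flat t u - flat t v)" using uv lev_Ints by (intro planar_lower) auto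
    moreover have "1/8 * ((u - 0) + (real m + 1 - v)) \<le> \<bar>ang v - ang u - lev m\<bar>" unfolding d using a uv by auto
    ultimately show ?thesis by linarith
  qed
  moreover have "0 < min (1/8) \<epsilon>" "(0::real) < 1/8" using \<epsilon> by simp_all
  ultimately show "\<exists>e>0. \<exists>c>0. \<forall>t\<in>{0..1::real}. \<forall>u\<in>{0..real m + 1}. \<forall>v\<in>{0..real m + 1}. u - 0 < e \<longrightarrow> real m + 1 - v < e \<longrightarrow>
       c * ((u - 0) + (real m + 1 - v)) \<le> norm (flat t u - flat t v)"
    by blast
qed

end


context petal_spiral
begin

definition pt :: "real \<Rightarrow> complex" where "pt p = Complex (xx p) (Y p)"

lemma planar_proj_flat: "planar_proj (flat 1 p) = pt p"
  by (simp add: planar_proj_def flat_def pt_def)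

lemma pt_eq_0_iff:
  assumes p: "0 \<le> p" "p \<le> real m + 1"
  shows "pt p = 0 \<longleftrightarrow> (\<exists>k\<le>2 * m. p = real k / 2) \<or> p = real m + 1"
proof (cases "p \<le> real m")
  case True
  have "pt p = 0 \<longleftrightarrow> xx p = 0" using Y_le[OF True] by (auto simp: pt_def complex_eq_iff)
  also have "\<dots> \<longleftrightarrow> 2 * p \<in> \<int>" using sgn_xx[OF p(1) True] by (metis sgn_zero_iff sin_zero_half)
  also have "\<dots> \<longleftrightarrow> (\<exists>k\<le>2 * m. p = real k / 2)"
  proof
    assume "2 * p \<in> \<int>"
    then obtain i :: int where i: "2 * p = of_int i" by (elim Ints_cases)
    then have "0 \<le> real_of_int i" "real_of_int i \<le> real (2 * m)" using p True by auto
    then have "i \<ge> 0" "i \<le> int (2 * m)" by linarith+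
    then have "nat i \<le> 2 * m \<and> p = real (nat i) / 2" using i by auto
    then show "\<exists>k\<le>2 * m. p = real k / 2" by blast
  next
    assume "\<exists>k\<le>2 * m. p = real k / 2"
    then obtain k where "p = real k / 2" by blast
    then have "2 * p = real k" by simp
    then show "2 * p \<in> \<int>" by simp
  qed
  finally show ?thesis using True by auto
next
  case False
  then have x: "xx p = Rad p * sin (2 * pi * (p - real m))" using p by (intro xx_last) auto
  have no: "\<not> (\<exists>k\<le>2 * m. p = real k / 2)" using False by auto
  show ?thesis
  proof (cases "p = real m + 1")
    case True
    then show ?thesis using ends by (simp add: pt_def complex_eq_iff)
  next
    case n: False
    consider "p - real m < 1/2" | "p - real m = 1/2" | "1/2 < p - real m" by linarith
    then have "pt p \<noteq> 0"
    proof cases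
      case 1
      then have "xx p \<noteq> 0" using x sin_2pi_sign(1)[of "p - real m"] False Rad_ge_1[OF p] by auto
      then show ?thesis by (simp add: pt_def complex_eq_iff)
    next
      case 2
      have "xx p = 0" unfolding x 2 by simp
      then have "Y p = bump p" using Y_ge[of p] False by simp
      also have "\<dots> = 1/4" using 2 by (simp add: bump_def)
      finally show ?thesis by (simp add: pt_def complex_eq_iff)
    next
      case 3
      then have "xx p \<noteq> 0" using x sin_2pi_sign(2)[of "p - real m"] n p Rad_ge_1[OF p] by auto
      then show ?thesis by (simp add: pt_def complex_eq_iff)
    qed
    then show ?thesis using no n by simp
  qed
qed

lemma xx_last_sign:
  assumes "real m \<le> p" "p \<le> real m + 1"
  shows "xx p > 0 \<longleftrightarrow> real m < p \<and> p < real m + 1/2" "xx p < 0 \<longleftrightarrow> real m + 1/2 < p \<and> p < real m + 1"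
proof -
  have R: "Rad p \<ge> 1" using Rad_ge_1[of p] assms by simp
  have x: "xx p = Rad p * sin (2 * pi * (p - real m))" by (rule xx_last(1)[OF assms])
  consider "p = real m" | "real m < p" "p < real m + 1/2" | "p = real m + 1/2" | "real m + 1/2 < p" "p < real m + 1" | "p = real m + 1"
    using assms by linarith
  then have "(xx p > 0 \<longleftrightarrow> real m < p \<and> p < real m + 1/2) \<and> (xx p < 0 \<longleftrightarrow> real m + 1/2 < p \<and> p < real m + 1)"
  proof cases
    case 2
    then have "sin (2 * pi * (p - real m)) > 0" by (intro sin_2pi_sign(1)) auto
    then have "xx p > 0" using x R by simp
    then show ?thesis using 2 by simp
  next
    case 4
    then have "sin (2 * pi * (p - real m)) < 0" by (intro sin_2pi_sign(2)) auto
    then have "xx p < 0" using x R by (simp add: mult_pos_neg)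
    then show ?thesis using 4 by simp
  next
    case 1
    then have "xx p = 0" using x by simp
    then show ?thesis using 1 by simp
  next
    case 3
    then have "xx p = 0" using x by simp
    then show ?thesis using 3 by simp
  next
    case 5
    then have "xx p = 0" using x by simp
    then show ?thesis using 5 by simp
  qed
  then show "xx p > 0 \<longleftrightarrow> real m < p \<and> p < real m + 1/2" "xx p < 0 \<longleftrightarrow> real m + 1/2 < p \<and> p < real m + 1" by auto
qed

text \<open>Where it is positive, \<open>bump\<close> increases strictly on the right side and
  decreases strictly on the left, so equal values put both points where the bump vanishes. There
  \<open>xx\<close> alone is injective: in the first quarter \<open>Rad\<close> is constant and the
  sine increases; in the last one \<open>Rad\<close> does not increase and the absolute value of the
  sine decreases.\<close>

lemma pt_inj_last:
  assumes p: "real m \<le> p" "p < q" "q \<le> real m + 1" and eq: "xx p = xx q" "Y p = Y q"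
  shows "pt p = 0"
proof -
  have m: "real m \<le> q" "p \<le> real m + 1" "0 \<le> p" using p by auto
  have x: "xx p = Rad p * sin (2 * pi * (p - real m))" "xx q = Rad q * sin (2 * pi * (q - real m))"
    using p m by (auto intro: xx_last)
  have b: "bump p = bump q" using Y_ge[of p] Y_ge[of q] eq p m by simp
  consider "xx p > 0" | "xx p < 0" | "xx p = 0" by linarith
  then show ?thesis
  proof cases
    case 1
    then have w: "real m < p" "p < real m + 1/2" "q < real m + 1/2"
      using xx_last_sign(1)[of p] xx_last_sign(1)[of q] p m eq by auto
    have q: "q \<le> real m + 1/4"
    proof (rule ccontr)
      assume "\<not> q \<le> real m + 1/4"
      then have "bump q = q - real m - 1/4" using w by (simp add: bump_def)
      moreover have "bump p \<le> max 0 (p - real m - 1/4)" by (simp add: bump_def)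
      ultimately show False using b p \<open>\<not> q \<le> real m + 1/4\<close> by linarith
    qed
    have "rad p = rad q" using q p by (simp add: rad_def min_absorb2 max_def)
    then have "Rad p = Rad q" using xx_last(2)[of p] xx_last(2)[of q] p m by simp
    then have "sin (2 * pi * (p - real m)) = sin (2 * pi * (q - real m))" using x eq Rad_ge_1[of p] p m by simp
    moreover have "sin (2 * pi * (p - real m)) < sin (2 * pi * (q - real m))"
    proof (rule sin_monotone_2pi)
      have "0 \<le> 2 * pi * (p - real m)" using w by simp
      then show "- (pi / 2) \<le> 2 * pi * (p - real m)" using pi_gt_zero by linarith
      show "2 * pi * (p - real m) < 2 * pi * (q - real m)" using p by simp
      have "2 * pi * (q - real m) \<le> 2 * pi * (1/4)" using q by (intro mult_left_mono) auto
      then show "2 * pi * (q - real m) \<le> pi / 2" by simp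
    qed
    ultimately show ?thesis by simp
  next
    case 2
    then have w: "real m + 1/2 < p" "q < real m + 1"
      using xx_last_sign(2)[of p] xx_last_sign(2)[of q] p m eq by auto
    have q: "real m + 3/4 \<le> p"
    proof (rule ccontr)
      assume "\<not> real m + 3/4 \<le> p"
      then have "bump p = real m + 3/4 - p" using w by (simp add: bump_def)
      moreover have "bump q \<le> max 0 (real m + 3/4 - q)" by (simp add: bump_def)
      ultimately show False using b p \<open>\<not> real m + 3/4 \<le> p\<close> by linarith
    qed
    have per: "sin (2 * pi * (x - real m)) = - sin (2 * pi * (real m + 1 - x))" for x
    proof -
      have "sin (2 * pi * (x - real m)) = sin (2 * pi * (x - real m - 1))"
        using sin_cos_2pi_Ints(1)[of "-1" "x - real m"] by (simp add: algebra_simps)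
      also have "2 * pi * (x - real m - 1) = - (2 * pi * (real m + 1 - x))" by (simp add: algebra_simps)
      finally show ?thesis by simp
    qed
    have s: "sin (2 * pi * (real m + 1 - q)) < sin (2 * pi * (real m + 1 - p))"
    proof (rule sin_monotone_2pi)
      have "0 \<le> 2 * pi * (real m + 1 - q)" using w by simp
      then show "- (pi / 2) \<le> 2 * pi * (real m + 1 - q)" using pi_gt_zero by linarith
      show "2 * pi * (real m + 1 - q) < 2 * pi * (real m + 1 - p)" using p by simp
      have "2 * pi * (real m + 1 - p) \<le> 2 * pi * (1/4)" using q by (intro mult_left_mono) auto
      then show "2 * pi * (real m + 1 - p) \<le> pi / 2" by simp
    qed
    have s0: "0 < sin (2 * pi * (real m + 1 - q))" using w p q by (intro sin_2pi_sign(1)) auto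
    have "rad q \<le> rad p"
      using q p m by (auto simp: rad_def min_absorb2 max_def intro!: mult_left_mono)
    then have R: "Rad q \<le> Rad p" using xx_last(2)[of p] xx_last(2)[of q] p m by simp
    have "Rad q * sin (2 * pi * (real m + 1 - q)) \<le> Rad p * sin (2 * pi * (real m + 1 - q))"
      using R s0 by (intro mult_right_mono) auto
    also have "\<dots> < Rad p * sin (2 * pi * (real m + 1 - p))" using s Rad_ge_1[of p] p m by (intro mult_strict_left_mono) auto
    finally show ?thesis using x eq by (simp add: per)
  next
    case 3
    have "p = real m"
    proof (rule ccontr)
      assume "p \<noteq> real m"
      then have "p = real m + 1/2"
        using 3 xx_last_sign[of p] p m by linarith
      moreover have "xx q = 0" using 3 eq by simp
      ultimately have "q = real m + 1" using xx_last_sign[of q] p m by linarith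
      then show False using b \<open>p = real m + 1/2\<close> by (simp add: bump_def)
    qed
    then show ?thesis using pt_eq_0_iff[of p] p m by (intro iffD2[OF pt_eq_0_iff]) (auto intro!: exI[of _ "2 * m"])
  qed
qed

lemma pt_inj:
  assumes p: "0 \<le> p" "p < q" "q \<le> real m + 1" and eq: "pt p = pt q"
  shows "pt p = 0"
proof -
  have eq: "xx p = xx q" "Y p = Y q" using eq by (auto simp: pt_def)
  consider "q \<le> real m" | "real m \<le> p" | "p < real m" "real m < q" by linarith
  then show ?thesis
  proof cases
    case 1
    have Y: "Y p = S p * xx p" "Y q = S q * xx p" using Y_le[of p] Y_le[of q] 1 p eq by auto
    have "xx p = 0"
    proof (rule ccontr)
      assume "xx p \<noteq> 0"
      then have "S p = S q" using Y eq by simp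
      then show False using S_eqD[OF p(1,2) 1] xx_plateau[of _ p q] p 1 eq by auto
    qed
    then show ?thesis using Y by (simp add: pt_def complex_eq_iff)
  next
    case 2
    then show ?thesis using pt_inj_last p eq by blast
  next
    case 3
    have Yp: "Y p = S p * xx p" using 3 Y_le by simp
    have Yq: "Y q = slope (2 * m) * max 0 (xx q) + slope 0 * min 0 (xx q) + bump q" using 3 Y_ge by simp
    have sg: "sgn (xx p) = sgn (sin (2 * pi * p))" using sgn_xx[of p] p 3 by simp
    consider "xx p > 0" | "xx p < 0" | "xx p = 0" by linarith
    then show ?thesis
    proof cases
      case 1
      then have "S p < slope (2 * m)" using S_less_last[of p] p 3 sg by (metis sgn_greater)
      then have "S p * xx p < slope (2 * m) * xx p" using 1 by simp
      moreover have "Y q = slope (2 * m) * xx p + bump q" using Yq 1 eq by simp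
      ultimately have "Y p < Y q" using Yp bump_nonneg[of q] by linarith
      then show ?thesis using eq by simp
    next
      case 2
      then have "slope 0 < S p" using S_greater_first[of p] p 3 sg by (metis sgn_less less_imp_le)
      then have "S p * xx p < slope 0 * xx p" using 2 by simp
      moreover have "Y q = slope 0 * xx p + bump q" using Yq 2 eq by simp
      ultimately have "Y p < Y q" using Yp bump_nonneg[of q] by linarith
      then show ?thesis using eq by simp
    next
      case 3
      then show ?thesis using Yp by (simp add: pt_def complex_eq_iff)
    qed
  qed
qed

text \<open>Turns the line of strand 0 into the horizontal axis.\<close>

definition rot :: complex where "rot = cis (pi / 2 - pi / (2 * real (2 * m + 1)))"

text \<open>Consecutive strands run in opposite horizontal directions. With
  \<open>n = 2 * m + 1\<close>, the number \<open>k * (n + 1)\<close> is congruent modulo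
  \<open>2 * n\<close> to \<open>k\<close> for even \<open>k\<close> and to \<open>k + n\<close> for
  odd \<open>k\<close>, so odd strands leave through the opposite end of their line.\<close>

definition strand_end :: "nat \<Rightarrow> nat" where "strand_end k = k * (2 * m + 2)"

lemma on_ray_strand:
  assumes k: "k \<le> 2 * m" and Y: "Y p = slope k * xx p"
  shows "0 \<le> (-1) ^ k * xx p \<Longrightarrow> on_ray (pi * real (strand_end k) / real (2 * m + 1)) (rot * pt p)"
    "(-1) ^ k * xx p \<le> 0 \<Longrightarrow> on_ray (pi * real (strand_end k + (2 * m + 1)) / real (2 * m + 1)) (rot * pt p)"
proof -
  define \<theta> where "\<theta> = strand_angle k"
  have c: "cos \<theta> > 0" using strand_angle_range[OF k] by (intro cos_gt_zero_pi) (auto simp: \<theta>_def)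
  have "pt p = of_real (xx p / cos \<theta>) * cis \<theta>"
    using c by (simp add: pt_def Y slope_def \<theta>_def[symmetric] tan_def complex_eq_iff)
  moreover have "rot * cis \<theta> = cis (pi * real k / real (2 * m + 1))"
  proof -
    have "pi / 2 - pi / (2 * real (2 * m + 1)) + \<theta> = pi * real k / real (2 * m + 1)"
      by (simp add: \<theta>_def strand_angle_def divide_simps) (simp add: algebra_simps)
    then show ?thesis by (simp add: rot_def cis_mult)
  qed
  ultimately have r: "rot * pt p = of_real (xx p / cos \<theta>) * cis (pi * real k / real (2 * m + 1))"
    by (simp add: mult.left_commute)
  have "cis (pi * real k) = (-1) ^ k"
    by (simp add: complex_eq_iff mult.commute[of pi])
  moreover have "pi * real (strand_end k) / real (2 * m + 1) = pi * real k + pi * real k / real (2 * m + 1)"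
    by (simp add: strand_end_def divide_simps) (simp add: algebra_simps)
  ultimately have e: "cis (pi * real (strand_end k) / real (2 * m + 1)) = (-1) ^ k * cis (pi * real k / real (2 * m + 1))"
    by (simp flip: cis_mult)
  show "on_ray (pi * real (strand_end k) / real (2 * m + 1)) (rot * pt p)" if "0 \<le> (-1) ^ k * xx p"
    unfolding on_ray_def e r
  proof (intro exI[of _ "(-1) ^ k * xx p / cos \<theta>"] conjI)
    show "0 \<le> (-1) ^ k * xx p / cos \<theta>" using that c by simp
  qed (cases "even k"; simp)
  have "pi * real (strand_end k + (2 * m + 1)) / real (2 * m + 1) = pi * real (strand_end k) / real (2 * m + 1) + pi"
    by (simp add: divide_simps) (simp add: algebra_simps)
  then have e': "cis (pi * real (strand_end k + (2 * m + 1)) / real (2 * m + 1)) = - cis (pi * real (strand_end k) / real (2 * m + 1))"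
    by (simp flip: cis_mult)
  show "on_ray (pi * real (strand_end k + (2 * m + 1)) / real (2 * m + 1)) (rot * pt p)" if "(-1) ^ k * xx p \<le> 0"
    unfolding on_ray_def e' e r
  proof (intro exI[of _ "- ((-1) ^ k * xx p / cos \<theta>)"] conjI)
    show "0 \<le> - ((-1) ^ k * xx p / cos \<theta>)" using that c by (simp add: divide_nonpos_pos)
  qed (cases "even k"; simp)
qed

lemma sin_half_add: "sin (2 * pi * (real k / 2 + x)) = (-1) ^ k * sin (2 * pi * x)"
  by (simp add: distrib_left sin_add mult.commute[of pi])

lemma leaving_strand:
  assumes k: "k \<le> 2 * m" and p: "real k / 2 \<le> p" "p \<le> real k / 2 + \<delta>"
  shows "Y p = slope k * xx p" "0 \<le> (-1) ^ k * xx p"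
proof -
  define x where "x = p - real k / 2"
  have x: "0 \<le> x" "x \<le> \<delta>" using p by (auto simp: x_def)
  have "2 * pi * x \<le> 2 * pi * (1/2)" using x \<delta> by (intro mult_left_mono) auto
  then have s: "sin (2 * pi * x) \<ge> 0" using x by (intro sin_ge_zero) auto
  have "Y p = slope k * xx p \<and> 0 \<le> (-1) ^ k * xx p"
  proof (cases "k = 2 * m")
    case True
    then have pm: "real m \<le> p" "p \<le> real m + 1" "p \<le> real m + 1/4" "x = p - real m" using p \<delta> by (auto simp: x_def)
    then have xp: "0 \<le> xx p" using xx_last(1)[of p] s Rad_ge_1[of p] by simp
    then show ?thesis using Y_ge[of p] pm bump_le(1)[of p] True by simp
  next
    case False
    then have "k + 1 \<le> 2 * m" using k by simp
    then have "real k + 1 \<le> 2 * real m" by linarith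
    then have pm: "p \<le> real m" "0 \<le> p" using p \<delta> by linarith+
    have "sgn (xx p) = sgn ((-1) ^ k * sin (2 * pi * x))"
      using sgn_xx[OF pm(2,1)] sin_half_add[of k x] by (simp add: x_def)
    then have "sgn ((-1) ^ k * xx p) = sgn (sin (2 * pi * x))" by (cases "even k") (auto simp: sgn_minus)
    then have "0 \<le> (-1) ^ k * xx p" using s by (metis sgn_less not_le)
    moreover have "S p = slope k" using S_plateau[OF k, of p] p by auto
    ultimately show ?thesis using Y_le[OF pm(1)] by simp
  qed
  then show "Y p = slope k * xx p" "0 \<le> (-1) ^ k * xx p" by auto
qed

lemma entering_strand:
  assumes k: "0 < k" "k \<le> 2 * m" and p: "real k / 2 - \<delta> \<le> p" "p \<le> real k / 2"
  shows "Y p = slope k * xx p" "(-1) ^ k * xx p \<le> 0"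
proof -
  define x where "x = real k / 2 - p"
  have x: "0 \<le> x" "x \<le> \<delta>" using p by (auto simp: x_def)
  have "2 * pi * x \<le> 2 * pi * (1/2)" using x \<delta> by (intro mult_left_mono) auto
  then have s: "sin (2 * pi * x) \<ge> 0" using x by (intro sin_ge_zero) auto
  have pm: "p \<le> real m" "0 \<le> p" using p \<delta> k by linarith+
  have "sgn (xx p) = sgn ((-1) ^ k * sin (2 * pi * (- x)))"
    using sgn_xx[OF pm(2,1)] sin_half_add[of k "- x"] by (simp add: x_def)
  then have "sgn ((-1) ^ k * xx p) = - sgn (sin (2 * pi * x))" by (cases "even k") (auto simp: sgn_minus)
  then have "sgn (- ((-1) ^ k * xx p)) = sgn (sin (2 * pi * x))" by (simp add: sgn_minus)
  then have "0 \<le> - ((-1) ^ k * xx p)" using s by (metis sgn_less not_le)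
  then show "(-1) ^ k * xx p \<le> 0" by simp
  have "S p = slope k" using S_plateau[OF k(2), of p] p by auto
  then show "Y p = slope k * xx p" using Y_le[OF pm(1)] by simp
qed

lemma entering_first_strand:
  assumes p: "real m + 1 - \<delta> \<le> p" "p \<le> real m + 1"
  shows "Y p = slope 0 * xx p" "xx p \<le> 0"
proof -
  have pm: "real m \<le> p" "real m + 3/4 \<le> p" using p \<delta> by auto
  show "xx p \<le> 0" using xx_last_sign(1)[of p] p pm by linarith
  then show "Y p = slope 0 * xx p" using Y_ge[of p] pm bump_le(2)[of p] by simp
qed

text \<open>The closing turn takes a parameter interval of length 1, the other loops take 1/2; hence
  the exceptional last value.\<close>

definition tm :: "nat \<Rightarrow> real" where
  "tm k = (if k = 2 * m + 1 then 1 else real k / (2 * (real m + 1)))"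

definition curve :: "real \<Rightarrow> real^3" where "curve u = flat 1 ((real m + 1) * u)"

lemma proj_curve: "planar_proj (curve u) = pt ((real m + 1) * u)"
  by (simp add: curve_def planar_proj_flat)

lemma pt_0: "pt 0 = 0" by (simp add: pt_def ends complex_eq_iff)

lemma tm_mult: "(real m + 1) * tm k = (if k = 2 * m + 1 then real m + 1 else real k / 2)"
proof -
  have "a * (x / (2 * a)) = x / 2" if "a > 0" for a x :: real using that by simp
  from this[of "real m + 1" "real k"] show ?thesis by (simp add: tm_def)
qed

lemma tm_scale: "tm k \<le> u \<longleftrightarrow> (real m + 1) * tm k \<le> (real m + 1) * u" "u \<le> tm k \<longleftrightarrow> (real m + 1) * u \<le> (real m + 1) * tm k"
  "u = tm k \<longleftrightarrow> (real m + 1) * u = (real m + 1) * tm k"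
  by simp_all

lemma tm_less:
  assumes "i < j" "j \<le> 2 * m + 1"
  shows "tm i < tm j"
proof -
  have "(real m + 1) * tm i < (real m + 1) * tm j"
    using assms unfolding tm_mult by auto
  then show ?thesis by simp
qed

lemma scale_range: "u \<in> {0..1} \<longleftrightarrow> 0 \<le> (real m + 1) * u \<and> (real m + 1) * u \<le> real m + 1"
  using mult_le_cancel_left_pos[of "real m + 1" u 1] by (auto simp: zero_le_mult_iff)

lemma proj_curve_eq_0:
  assumes "u \<in> {0..1}"
  shows "planar_proj (curve u) = 0 \<longleftrightarrow> u \<in> tm ` {..2 * m + 1}"
proof -
  have "planar_proj (curve u) = 0 \<longleftrightarrow> (\<exists>k\<le>2 * m. (real m + 1) * u = real k / 2) \<or> (real m + 1) * u = real m + 1"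
    unfolding proj_curve using assms scale_range by (intro pt_eq_0_iff) auto
  also have "\<dots> \<longleftrightarrow> (\<exists>k\<le>2 * m + 1. u = tm k)"
  proof
    assume "(\<exists>k\<le>2 * m. (real m + 1) * u = real k / 2) \<or> (real m + 1) * u = real m + 1"
    then consider k where "k \<le> 2 * m" "(real m + 1) * u = real k / 2" | "(real m + 1) * u = real m + 1" by blast
    then show "\<exists>k\<le>2 * m + 1. u = tm k"
    proof cases
      case (1 k)
      then have "u = tm k" unfolding tm_scale(3) tm_mult by simp
      then show ?thesis using 1 by (intro exI[of _ k]) simp
    next
      case 2
      then have "u = tm (2 * m + 1)" unfolding tm_scale(3) tm_mult by simp
      then show ?thesis by blast
    qed
  next
    assume "\<exists>k\<le>2 * m + 1. u = tm k"
    then obtain k where k: "k \<le> 2 * m + 1" "u = tm k" by blast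
    then show "(\<exists>k\<le>2 * m. (real m + 1) * u = real k / 2) \<or> (real m + 1) * u = real m + 1"
      unfolding tm_scale(3) tm_mult by (cases "k = 2 * m + 1") auto
  qed
  finally show ?thesis by auto
qed

lemma knot_curve_curve: "knot_curve curve"
  unfolding knot_curve_def
proof
  have cont: "continuous_on {0..real m + 1} (flat 1)"
  proof -
    have "continuous_on {0..real m + 1} (\<lambda>p. \<chi> i. flat 1 p $ i)"
    proof (rule continuous_on_vec_lambda)
      show "continuous_on {0..real m + 1} (\<lambda>p. flat 1 p $ i)" for i
        using exhaust_3[of i] lipfam_continuous[OF lipfam_xyz(1)] lipfam_continuous[OF lipfam_xyz(3)] lipfam_continuous[OF lipfam_Y]
        by (auto simp: flat_def)
    qed
    then show ?thesis by simp
  qed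
  have "path curve"
    unfolding path_def curve_def
    by (rule continuous_on_compose2[OF cont]) (auto intro!: continuous_intros simp: scale_range)
  moreover have "loop_free curve"
    unfolding loop_free_def
  proof (intro ballI impI)
    fix u v :: real assume uv: "u \<in> {0..1}" "v \<in> {0..1}" "curve u = curve v"
    have *: "u = 0 \<and> v = 1" if "u < v" "u \<in> {0..1}" "v \<in> {0..1}" "curve u = curve v" for u v
    proof -
      have "(real m + 1) * u = 0 \<and> (real m + 1) * v = real m + 1"
        using that scale_range[of u] scale_range[of v] by (intro flat_inj[of 1]) (auto simp: curve_def)
      then show ?thesis by auto
    qed
    show "u = v \<or> u = 0 \<and> v = 1 \<or> u = 1 \<and> v = 0"
      using *[of u v] *[of v u] uv by (cases u v rule: linorder_cases) auto
  qed
  ultimately show "simple_path curve" by (simp add: simple_path_def)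
  show "pathfinish curve = pathstart curve"
    by (simp add: pathfinish_def pathstart_def curve_def flat_def ends)
qed

lemma uebercrossing_curve: "uebercrossing_projection (2 * m + 1) curve tm"
  unfolding uebercrossing_projection_def
proof (intro conjI)
  show "knot_curve curve" by (rule knot_curve_curve)
  show "1 \<le> 2 * m + 1" "tm 0 = 0" "tm (2 * m + 1) = 1" by (simp_all add: tm_def)
  show "strict_mono_on {..2 * m + 1} tm"
    by (intro strict_mono_onI tm_less) auto
  have p0: "planar_proj (curve 0) = 0" by (simp add: proj_curve pt_0)
  show "\<forall>u\<in>{0..1}. planar_proj (curve u) = planar_proj (curve 0) \<longleftrightarrow> u \<in> tm ` {..2 * m + 1}"
    unfolding p0 using proj_curve_eq_0 by blast
  show "inj_on (planar_proj \<circ> curve) ({0..1} - tm ` {..2 * m + 1})"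
  proof (rule inj_onI)
    fix u v assume u: "u \<in> {0..1} - tm ` {..2 * m + 1}" and v: "v \<in> {0..1} - tm ` {..2 * m + 1}"
      and eq: "(planar_proj \<circ> curve) u = (planar_proj \<circ> curve) v"
    have no: "\<not> u < v" if "u \<in> {0..1} - tm ` {..2 * m + 1}" "v \<in> {0..1} - tm ` {..2 * m + 1}"
       "(planar_proj \<circ> curve) u = (planar_proj \<circ> curve) v" for u v
    proof
      assume "u < v"
      then have "pt ((real m + 1) * u) = 0"
        using that scale_range[of u] scale_range[of v] by (intro pt_inj[of _ "(real m + 1) * v"]) (auto simp: proj_curve)
      then have "planar_proj (curve u) = 0" by (simp add: proj_curve)
      then show False using proj_curve_eq_0[of u] that(1) by blast
    qed
    show "u = v" using no[OF u v eq] no[OF v u eq[symmetric]] by simp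
  qed
  show "\<exists>h h' a \<epsilon>. homeomorphism UNIV UNIV h h' \<and> h (planar_proj (curve 0)) = 0 \<and> \<epsilon> > 0 \<and>
        (\<forall>i<2 * m + 1.
           (\<forall>u\<in>{tm i .. tm i + \<epsilon>}. on_ray (pi * real (a i) / real (2 * m + 1)) (h (planar_proj (curve u)))) \<and>
           (\<forall>u\<in>{tm (Suc i) - \<epsilon> .. tm (Suc i)}.
              on_ray (pi * real (a (Suc i mod (2 * m + 1)) + (2 * m + 1)) / real (2 * m + 1)) (h (planar_proj (curve u)))))"
  proof (rule exI[of _ "\<lambda>z. rot * z"], rule exI[of _ "\<lambda>z. z / rot"], rule exI[of _ strand_end],
      rule exI[of _ "\<delta> / (real m + 1)"], intro conjI allI impI ballI)
    have "rot \<noteq> 0" by (simp add: rot_def)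
    then show "homeomorphism UNIV UNIV (\<lambda>z. rot * z) (\<lambda>z. z / rot)" by (rule homeomorphism_mult)
    show "rot * planar_proj (curve 0) = 0" by (simp add: p0)
    show "0 < \<delta> / (real m + 1)" using \<delta> by simp
    have e: "(real m + 1) * (\<delta> / (real m + 1)) = \<delta>" by simp
    fix i assume i: "i < 2 * m + 1"
    show "on_ray (pi * real (strand_end i) / real (2 * m + 1)) (rot * planar_proj (curve u))"
      if u: "u \<in> {tm i .. tm i + \<delta> / (real m + 1)}" for u
    proof -
      define p where "p = (real m + 1) * u"
      have "(real m + 1) * tm i \<le> p" "p \<le> (real m + 1) * (tm i + \<delta> / (real m + 1))"
        unfolding p_def using u by (auto intro!: mult_left_mono simp del: mult_le_cancel_left_pos)
      then have "real i / 2 \<le> p" "p \<le> real i / 2 + \<delta>" using i unfolding distrib_left e tm_mult by auto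
      from leaving_strand[OF _ this] show ?thesis
        unfolding proj_curve p_def[symmetric] using i by (intro on_ray_strand) auto
    qed
    show "on_ray (pi * real (strand_end (Suc i mod (2 * m + 1)) + (2 * m + 1)) / real (2 * m + 1)) (rot * planar_proj (curve u))"
      if u: "u \<in> {tm (Suc i) - \<delta> / (real m + 1) .. tm (Suc i)}" for u
    proof -
      define p where "p = (real m + 1) * u"
      have "(real m + 1) * (tm (Suc i) - \<delta> / (real m + 1)) \<le> p" "p \<le> (real m + 1) * tm (Suc i)"
        unfolding p_def using u by (auto intro!: mult_left_mono simp del: mult_le_cancel_left_pos)
      then have p: "(real m + 1) * tm (Suc i) - \<delta> \<le> p" "p \<le> (real m + 1) * tm (Suc i)"
        unfolding right_diff_distrib e by auto
      show ?thesis
      \<comment> \<open>The last loop returns along strand 0, to which the index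
        \<open>2 * m + 1\<close> is reduced.\<close>
      proof (cases "i = 2 * m")
        case True
        then have "real m + 1 - \<delta> \<le> p" "p \<le> real m + 1" using p by (simp_all add: tm_mult)
        from entering_first_strand[OF this] show ?thesis
          unfolding proj_curve p_def[symmetric] using True on_ray_strand(2)[of 0 p] by simp
      next
        case False
        then have "real (Suc i) / 2 - \<delta> \<le> p" "p \<le> real (Suc i) / 2" using p by (simp_all add: tm_mult)
        from entering_strand[OF _ _ this] show ?thesis
          unfolding proj_curve p_def[symmetric] using False i on_ray_strand(2)[of "Suc i" p] by simp
      qed
    qed
  qed
qed

lemma uber_loop_curve:
  assumes "i \<le> 2 * m"
  shows "uber_loop curve tm i = pt ` (if i = 2 * m then {real m..real m + 1} else {real i / 2..real i / 2 + 1/2})"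
proof -
  have "(\<lambda>u. (real m + 1) * u) ` {tm i..tm (Suc i)} = {(real m + 1) * tm i..(real m + 1) * tm (Suc i)}"
    using tm_less[of i "Suc i"] assms by (intro image_mult_atLeastAtMost) auto
  moreover have "{(real m + 1) * tm i..(real m + 1) * tm (Suc i)} = (if i = 2 * m then {real m..real m + 1} else {real i / 2..real i / 2 + 1/2})"
    using assms unfolding tm_mult by (auto simp: add_divide_distrib)
  moreover have "uber_loop curve tm i = pt ` ((\<lambda>u. (real m + 1) * u) ` {tm i..tm (Suc i)})"
    unfolding uber_loop_def image_image o_def proj_curve ..
  ultimately show ?thesis by simp
qed

text \<open>A parameter of loop \<open>j\<close> whose direction from the crossing occurs in no
  other loop: strictly between two plateaus, or vertical for the closing loop.\<close>

definition mid :: "nat \<Rightarrow> real" where "mid j = (if j = 2 * m then real m + 1/2 else real j / 2 + 1/4)"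

lemma mid_notin_plateau: "k \<le> 2 * m \<Longrightarrow> j < 2 * m \<Longrightarrow> \<not> \<bar>mid j - real k / 2\<bar> \<le> \<delta>"
proof
  assume j: "j < 2 * m" and a: "\<bar>mid j - real k / 2\<bar> \<le> \<delta>"
  have "mid j = real j / 2 + 1/4" using j by (simp add: mid_def)
  then have jk: "real j < real k" "real k < real j + 1" using a \<delta> by linarith+
  then have "j + 1 \<le> k" by simp
  then have "real j + 1 \<le> real k" by linarith
  then show False using jk by linarith
qed

text \<open>On the spiral the direction determines the slope, and off the plateaus the slope
  determines the parameter. The closing loop stays in its own sector.\<close>

lemma mid_direction:
  assumes i: "i \<le> 2 * m" and j: "j \<le> 2 * m" and ij: "i \<noteq> j" and l: "l \<ge> 1"
  shows "of_real l * pt (mid j) \<notin> uber_loop curve tm i"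
proof
  assume "of_real l * pt (mid j) \<in> uber_loop curve tm i"
  then obtain p where p: "p \<in> (if i = 2 * m then {real m..real m + 1} else {real i / 2..real i / 2 + 1/2})"
    and eq: "of_real l * pt (mid j) = pt p"
    unfolding uber_loop_curve[OF i] by blast
  have eq: "xx p = l * xx (mid j)" "Y p = l * Y (mid j)" using eq by (auto simp: pt_def complex_eq_iff)
  show False
  proof (cases "j = 2 * m")
    case True
    then have "xx (mid j) = 0" using xx_last(1)[of "mid j"] by (simp add: mid_def)
    moreover have "Y (mid j) = bump (mid j)" using True \<open>xx (mid j) = 0\<close> Y_ge[of "mid j"] by (simp add: mid_def)
    moreover have "bump (mid j) = 1/4" using True by (simp add: bump_def mid_def)
    moreover have "p \<le> real m"
    proof -
      have "i + 1 \<le> 2 * m" using i ij True by simp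
      then have "real i + 1 \<le> 2 * real m" by linarith
      then show ?thesis using p ij True by (auto split: if_splits)
    qed
    ultimately show False using eq l Y_le[of p] by simp
  next
    case False
    then have j: "j < 2 * m" using j by simp
    then have "j + 1 \<le> 2 * m" by simp
    then have "real j + 1 \<le> 2 * real m" by linarith
    then have q: "0 \<le> mid j" "mid j < real m" "mid j = real j / 2 + 1/4" using False by (auto simp: mid_def)
    have Yq: "Y (mid j) = S (mid j) * xx (mid j)" using q Y_le by simp
    have x: "xx (mid j) \<noteq> 0"
    proof
      assume "xx (mid j) = 0"
      then have "sin (2 * pi * mid j) = 0" using sgn_xx[of "mid j"] q by (simp add: sgn_zero_iff)
      then have "2 * mid j \<in> \<int>" by (simp add: sin_zero_half)
      then obtain k :: int where "2 * mid j = of_int k" by (elim Ints_cases)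
      then have "real_of_int (2 * int j + 1) = real_of_int (2 * k)" using q(3) by simp
      then have "2 * int j + 1 = 2 * k" by (simp only: of_int_eq_iff)
      then show False by presburger
    qed
    have xp: "xx p \<noteq> 0" "sgn (xx p) = sgn (sin (2 * pi * mid j))"
      using eq(1) x l sgn_xx[of "mid j"] q by (simp_all add: sgn_mult)
    have Yp: "Y p = S (mid j) * xx p" using eq Yq by simp
    show False
    proof (cases "i = 2 * m")
      case True
      then have pm: "real m \<le> p" "p \<le> real m + 1" using p by auto
      have Yp': "Y p = slope (2 * m) * max 0 (xx p) + slope 0 * min 0 (xx p) + bump p" using pm Y_ge by simp
      show False
      proof (cases "xx p > 0")
        case True
        then have "S (mid j) < slope (2 * m)" using S_less_last[of "mid j"] q xp(2) by (metis sgn_greater)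
        then have "S (mid j) * xx p < slope (2 * m) * xx p" using True by simp
        moreover have "Y p = slope (2 * m) * xx p + bump p" using Yp' True by simp
        ultimately show False using Yp bump_nonneg[of p] by linarith
      next
        case False
        then have neg: "xx p < 0" using xp by simp
        then have "slope 0 < S (mid j)" using S_greater_first[of "mid j"] q xp(2) by (metis sgn_less less_imp_le)
        then have "S (mid j) * xx p < slope 0 * xx p" using neg by simp
        moreover have "Y p = slope 0 * xx p + bump p" using Yp' neg by simp
        ultimately show False using Yp bump_nonneg[of p] by linarith
      qed
    next
      case False
      then have "i + 1 \<le> 2 * m" using i by simp
      then have "real i + 1 \<le> 2 * real m" by linarith
      then have pm: "0 \<le> p" "p \<le> real m" "real i / 2 \<le> p" "p \<le> real i / 2 + 1/2" using p False by auto
      have "S p = S (mid j)" using Yp Y_le[OF pm(2)] xp by simp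
      moreover have "p \<noteq> mid j"
      proof
        assume "p = mid j"
        then have "real i \<le> real j + 1/2" "real j + 1/2 \<le> real i + 1" using pm q by auto
        then have "i < j + 1" "j < i + 1" by linarith+
        then show False using ij by linarith
      qed
      ultimately obtain k where "k \<le> 2 * m" "\<bar>mid j - real k / 2\<bar> \<le> \<delta>"
        using S_eqD[of p "mid j"] S_eqD[of "mid j" p] pm q by (metis less_imp_le linorder_less_linear)
      then show False using mid_notin_plateau j by blast
    qed
  qed
qed

text \<open>If loop \<open>i\<close> enclosed loop \<open>j\<close>, the ray through the point of
  loop \<open>j\<close> at \<open>mid j\<close> would have to leave through loop
  \<open>i\<close>.\<close>

lemma petal_projection_curve: "petal_projection (2 * m + 1) curve"
  unfolding petal_projection_def
proof (intro exI[of _ tm] conjI allI impI uebercrossing_curve notI)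
  fix i assume i: "i < 2 * m + 1" and "nesting_loop (2 * m + 1) curve tm i"
  then obtain j where j: "j < 2 * m + 1" "j \<noteq> i" "uber_loop curve tm j - {planar_proj (curve 0)} \<subseteq> inside (uber_loop curve tm i)"
    unfolding nesting_loop_def by blast
  have i: "i \<le> 2 * m" and jm: "j \<le> 2 * m" using i j by auto
  have "mid j \<in> (if j = 2 * m then {real m..real m + 1} else {real j / 2..real j / 2 + 1/2})" by (simp add: mid_def)
  then have mem: "pt (mid j) \<in> uber_loop curve tm j" unfolding uber_loop_curve[OF jm] by blast
  have m: "0 \<le> mid j" "mid j \<le> real m + 1" using jm by (auto simp: mid_def)
  have "pt (mid j) \<noteq> 0"
  proof
    assume "pt (mid j) = 0"
    then have "(\<exists>k\<le>2 * m. mid j = real k / 2) \<or> mid j = real m + 1" using pt_eq_0_iff[OF m] by simp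
    then show False
    proof (cases "j = 2 * m")
      case True
      then have "mid j = real m + 1/2" by (simp add: mid_def)
      then show False using \<open>(\<exists>k\<le>2 * m. mid j = real k / 2) \<or> mid j = real m + 1\<close> by auto
    next
      case False
      then have "j < 2 * m" using jm by simp
      then have "real j + 1 \<le> 2 * real m" by linarith
      then have "mid j < real m + 1" using False by (simp add: mid_def)
      then obtain k where "k \<le> 2 * m" "mid j = real k / 2"
        using \<open>(\<exists>k\<le>2 * m. mid j = real k / 2) \<or> mid j = real m + 1\<close> by auto
      then show False using mid_notin_plateau[of k j] \<open>j < 2 * m\<close> \<delta> by simp
    qed
  qed
  moreover have "planar_proj (curve 0) = 0" by (simp add: proj_curve pt_0)
  ultimately have "pt (mid j) \<in> inside (uber_loop curve tm i)" "pt (mid j) \<noteq> 0" using j(3) mem by auto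
  then obtain l :: real where "l \<ge> 1" "of_real l * pt (mid j) \<in> uber_loop curve tm i" by (rule inside_ray)
  then show False using mid_direction[OF i jm] j(2) by metis
qed

lemma path_image_curve: "path_image curve = flat 1 ` {0..real m + 1}"
proof -
  have "(\<lambda>u. (real m + 1) * u) ` {0..1} = {0..real m + 1}"
    using image_mult_atLeastAtMost[of "real m + 1" 0 1] by simp
  then show ?thesis unfolding path_image_def curve_def by (metis image_image)
qed

end

context spiral
begin

lemma petal_projection_spiral:
  "\<exists>\<gamma>. ambient_isotopic ((\<lambda>p. tube (rad p) (ang p) (min p (real m))) ` {0..real m + 1}) (path_image \<gamma>) \<and>
     petal_projection (2 * m + 1) \<gamma>"
proof -
  obtain \<delta> where \<delta>: "\<delta> > 0" "\<delta> < 1/8" "\<forall>k\<le>2 * m. \<forall>p\<in>{0..real m}. \<forall>q\<in>{0..real m}.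
      \<bar>p - real k / 2\<bar> \<le> \<delta> \<longrightarrow> \<bar>q - real k / 2\<bar> \<le> \<delta> \<longrightarrow> p < q \<longrightarrow> xx p \<noteq> xx q"
    using xx_lens_uniform by blast
  interpret petal_spiral m d \<delta>
    by unfold_locales (use \<delta> in auto)
  have eq: "(\<lambda>p. tube (rad p) (ang p) (min p (real m))) = flat 0"
    by (simp add: fun_eq_iff tube_rad flat_def)
  have "ambient_isotopic ((\<lambda>p. tube (rad p) (ang p) (min p (real m))) ` {0..real m + 1}) (path_image curve)"
    unfolding eq path_image_curve by (rule flat_isotopy)
  with petal_projection_curve show ?thesis by blast
qed

end


subsection \<open>From the torus knot to the spiral\<close>

text \<open>The assumptions on \<open>lev\<close> say that at height \<open>v + i\<close> the line of slope \<open>r / s\<close> lies strictly between the columns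
  \<open>lev i - 1\<close> and \<open>lev i\<close>.\<close>

locale torus_spiral = spiral +
  fixes r s v :: nat
  assumes m: "m > 0" and r: "r > 0" and s: "s = v + m" and coprime: "coprime r s"
    and vr: "v * r + 1 \<le> s" and lev_m: "lev m = real r"
    and lev_lower: "\<And>i. 0 < i \<Longrightarrow> i < m \<Longrightarrow> real s * (lev i - 1) + 1 \<le> real (v + i) * real r"
    and lev_upper: "\<And>i. 0 < i \<Longrightarrow> i < m \<Longrightarrow> real (v + i) * real r + 1 \<le> real s * lev i"
begin

text \<open>Multiplied by \<open>s\<close>, the lattice inequalities have slack 1. Since
  \<open>\<eta> * r = 1/8\<close>, moving the meridional angle by up to \<open>\<eta>\<close> does
  not use it up.\<close>

definition \<eta> :: real where "\<eta> = 1 / (8 * real r)"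

text \<open>\<open>U\<close> parametrises the torus knot in step with the spiral, and \<open>V\<close> is the meridional angle of the spiral up to
  integers, wherever \<open>rad_core\<close> does not vanish. On the core \<open>V\<close> makes up for the \<open>v\<close> lost turns.\<close>

definition U :: "real \<Rightarrow> real" where
  "U p = (real v + 2 * \<eta>) + 2 * \<eta> * p + (1 - 4 * \<eta>) * min p (real m) + 2 * \<eta> * max 0 (min p (real m) - 1)
     + 2 * real v * max 0 (p - real m - 1/2)"

definition V :: "real \<Rightarrow> real" where
  "V p = real v + min p (real m) + 2 * real v * max 0 (p - real m - 1/2)"

lemma eta: "0 < \<eta>" "\<eta> \<le> 1/8" "\<eta> * real r = 1/8"
  using r by (simp_all add: \<eta>_def field_simps)

lemma s_pos: "real s > 0" using s m by simp

lemma U_steep: "p \<le> q \<Longrightarrow> 2 * \<eta> * (q - p) \<le> U q - U p"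
proof -
  assume pq: "p \<le> q"
  have "(1 - 4 * \<eta>) * min p (real m) \<le> (1 - 4 * \<eta>) * min q (real m)"
    "2 * \<eta> * max 0 (min p (real m) - 1) \<le> 2 * \<eta> * max 0 (min q (real m) - 1)"
    "2 * real v * max 0 (p - real m - 1/2) \<le> 2 * real v * max 0 (q - real m - 1/2)"
    using pq eta by (intro mult_left_mono; auto)+
  then show ?thesis by (simp add: U_def right_diff_distrib)
qed

lemma U_strict: "p < q \<Longrightarrow> U p < U q"
proof -
  assume "p < q"
  then have "0 < 2 * \<eta> * (q - p)" using eta by simp
  then show ?thesis using U_steep[of p q] \<open>p < q\<close> by linarith
qed

lemma m1: "1 \<le> real m" using m by simp

lemma U_first: "0 \<le> p \<Longrightarrow> p \<le> 1 \<Longrightarrow> U p = real v + p + 2 * \<eta> * (1 - p)"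
  using m1 by (simp add: U_def min_absorb1 max_absorb1 algebra_simps)

lemma U_mid: "1 \<le> p \<Longrightarrow> p \<le> real m \<Longrightarrow> U p = real v + p"
  by (simp add: U_def min_absorb1 max_absorb2 algebra_simps)

text \<open>\<open>V\<close> rests here, but \<open>U\<close> has to keep growing in order to
  parametrise the torus knot injectively.\<close>

lemma U_drop: "real m \<le> p \<Longrightarrow> p \<le> real m + 1/2 \<Longrightarrow> U p = real s + 2 * \<eta> * (p - real m)"
  using m1 by (simp add: U_def min_absorb2 max_absorb2 max_absorb1 s algebra_simps)

lemma U_core: "real m + 1/2 \<le> p \<Longrightarrow> U p = real s + \<eta> + 2 * (real v + \<eta>) * (p - real m - 1/2)"
  using m1 by (simp add: U_def min_absorb2 max_absorb2 s algebra_simps)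

lemma U_ends: "U 0 = real v + 2 * \<eta>" "U (real m + 1) = real v + 2 * \<eta> + real s"
  using U_first[of 0] U_core[of "real m + 1"] by (simp_all add: algebra_simps)

lemma V_le: "p \<le> real m \<Longrightarrow> V p = real v + p" by (simp add: V_def min_absorb1 max_absorb1)

lemma V_drop: "real m \<le> p \<Longrightarrow> p \<le> real m + 1/2 \<Longrightarrow> V p = real s"
  by (simp add: V_def min_absorb2 max_absorb1 s)

lemma V_ends: "V 0 = real v" "V (real m + 1) = real v + real s"
  by (simp_all add: V_def s)

text \<open>The whole core part makes \<open>v + \<eta>\<close> meridional turns of the torus knot,
  hence \<open>(v + \<eta>) * r / s\<close> longitudinal ones, fewer than one because
  \<open>v * r + 1 \<le> s\<close>; on the spiral it makes half a turn. So at no stage does it cover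
  the core twice.\<close>

lemma core_length:
  assumes t: "0 \<le> t" "t \<le> 1" and p: "real m + 1/2 \<le> p" "p < q" "q \<le> real m + 1"
  shows "0 < (1 - t) * ((U q - U p) * real r / real s) + t * (ang q - ang p)"
    "(1 - t) * ((U q - U p) * real r / real s) + t * (ang q - ang p) < 1"
proof -
  have a: "ang q - ang p = q - p" using p by (intro ang_lens_last) auto
  have u: "U q - U p = 2 * (real v + \<eta>) * (q - p)"
    using U_core[of p] U_core[of q] p by (simp add: algebra_simps)
  have pos: "0 < (U q - U p) * real r / real s"
    using U_strict[OF p(2)] r s_pos by simp
  have "2 * (real v + \<eta>) * (q - p) \<le> 2 * (real v + \<eta>) * (1/2)" using p eta by (intro mult_left_mono) auto
  then have "U q - U p \<le> real v + \<eta>" unfolding u by simp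
  then have "(U q - U p) * real r \<le> (real v + \<eta>) * real r" by (rule mult_right_mono) simp
  also have "\<dots> = real (v * r) + 1/8" using eta by (simp add: distrib_right)
  also have "\<dots> < real s" using vr by linarith
  finally have less: "(U q - U p) * real r / real s < 1" using s_pos by simp
  let ?x = "(U q - U p) * real r / real s"
  have conv: "0 < (1 - t) * x + t * y \<and> (1 - t) * x + t * y < 1" if "0 < x" "x < 1" "0 < y" "y < 1" for x y
  proof (cases "t = 0")
    case False
    then have "t > 0" using t by simp
    then have "0 < t * y" "t * y < t" using that by simp_all
    moreover have "0 \<le> (1 - t) * x" "(1 - t) * x \<le> 1 - t" using t that by (simp_all add: mult_left_le)
    ultimately show ?thesis by linarith
  qed (use that in simp)
  from conv[OF pos less, of "q - p"] p
  show "0 < (1 - t) * ?x + t * (ang q - ang p)" "(1 - t) * ?x + t * (ang q - ang p) < 1"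
    unfolding a by auto
qed

lemma not_Ints_between:
  fixes x n :: real
  assumes n: "n \<in> \<int>" "n < x" "x < n + 1"
  shows "x \<notin> \<int>"
proof
  assume "x \<in> \<int>"
  then obtain a :: int where a: "x = of_int a" by (elim Ints_cases)
  obtain b :: int where b: "n = of_int b" using n(1) by (elim Ints_cases)
  have "real_of_int b < real_of_int a" "real_of_int a < real_of_int (b + 1)" using n a b by simp_all
  then have "b < a" "a < b + 1" by (simp_all only: of_int_less_iff)
  then show False by simp
qed

text \<open>For \<open>t > 0\<close> equal distances from the core mean equal values of
  \<open>rad_core\<close>, which increases on the spiral, decreases in the drop and vanishes on the
  rest of the closing turn. So a collision takes place on the core, which \<open>core_length\<close>
  controls, or between the spiral and the drop, which the lattice inequalities exclude. At
  \<open>t = 0\<close> coprimality is used instead.\<close>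

lemma torus_isotopy:
  "ambient_isotopic ((\<lambda>p. tube 1 (U p * real r / real s) (U p)) ` {0..real m + 1})
     ((\<lambda>p. tube (rad_core p) (ang p) (V p)) ` {0..real m + 1})"
proof -
  define \<rho> where "\<rho> t p = (1 - t) + t * rad_core p" for t p
  define A where "A t p = (1 - t) * (U p * real r / real s) + t * ang p" for t p
  define B where "B t p = (1 - t) * U p + t * V p" for t p
  have lipU: "lipfam {0..real m + 1} (\<lambda>_. U)" and lipV: "lipfam {0..real m + 1} (\<lambda>_. V)"
    unfolding U_def V_def by (intro lipfam_add lipfam_mult lipfam_const lipfam_max lipfam_min lipfam_diff lipfam_id)+
  have A_diff: "A t q - A t p = (1 - t) * ((U q - U p) * real r / real s) + t * (ang q - ang p)" for t p q
    by (simp add: A_def algebra_simps diff_divide_distrib)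
  have A_end: "A t (real m + 1) - A t 0 = real r" for t
  proof -
    have "U (real m + 1) - U 0 = real s" "ang (real m + 1) - ang 0 = real r"
      by (simp_all add: U_ends ang_end ang_start lev_m)
    then show ?thesis unfolding A_diff using s_pos by (simp add: left_diff_distrib)
  qed
  have B_end: "B t (real m + 1) - B t 0 = real s" for t
  proof -
    have "U (real m + 1) - U 0 = real s" "V (real m + 1) - V 0 = real s" by (simp_all add: U_ends V_ends)
    moreover have "B t (real m + 1) - B t 0 = (1 - t) * (U (real m + 1) - U 0) + t * (V (real m + 1) - V 0)"
      by (simp add: B_def algebra_simps)
    ultimately show ?thesis by (simp add: left_diff_distrib)
  qed
  have core_Ints: "A t q - A t p \<notin> \<int>" if "t \<in> {0..1}" "real m + 1/2 \<le> p" "p < q" "q \<le> real m + 1" for t p q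
    by (rule not_Ints_between[of 0]) (use core_length[of t p q] that in \<open>auto simp: A_diff\<close>)
  \<comment> \<open>Modulo integers the drop is at the meridional angle \<open>y\<close>, which the
    spiral attains at \<open>p = i + y\<close>. The longitudinal differences \<open>DL\<close> of
    the straight path and \<open>DT\<close> of the staircase lie in the same open interval
    \<open>(N, N + 1)\<close>, and so does the convex combination that occurs at time
    \<open>t\<close>.\<close>
  have spiral_drop: "A t q - A t p \<notin> \<int>"
    if t: "t \<in> {0..1}" and p: "0 < p" "p < real m" and q: "real m < q" "q < real m + 1/2" and Bi: "B t q - B t p \<in> \<int>" for t p q
  proof -
    define w where "w = q - real m"
    have w: "0 < w" "w < 1/2" using q by (auto simp: w_def)
    define x where "x = 2 * \<eta> * w"
    define y where "y = (1 - t) * x"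
    have x: "0 < x" "x < \<eta>" using w eta by (auto simp: x_def)
    have "y \<le> 1 * x" unfolding y_def using t x by (intro mult_right_mono) auto
    then have y: "0 \<le> y" "y \<le> x" using t x by (auto simp: y_def)
    have Uq: "U q = real s + x" using U_drop[of q] q by (simp add: x_def w_def)
    have "B t q = (1 - t) * (real s + x) + t * real s" using Uq V_drop[of q] q by (simp add: B_def)
    then have Bq: "B t q = real s + y" by (simp add: y_def algebra_simps)
    have Bpy: "B t p - y \<in> \<int>"
    proof -
      have "real s - (B t q - B t p) \<in> \<int>" using Bi by simp
      then show ?thesis by (simp add: Bq)
    qed
    have p1: "1 \<le> p"
    proof (rule ccontr)
      assume "\<not> 1 \<le> p"
      then have p1: "p < 1" by simp
      define a where "a = (1 - t) * (2 * \<eta>)"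
      have a: "0 \<le> a" "a \<le> 1/4"
      proof -
        have "a \<le> 1 * (2 * \<eta>)" unfolding a_def using t eta by (intro mult_right_mono) auto
        then show "a \<le> 1/4" using eta by simp
      qed (use t eta in \<open>auto simp: a_def\<close>)
      have "B t p = (1 - t) * (real v + p + 2 * \<eta> * (1 - p)) + t * (real v + p)"
        using U_first[of p] V_le[of p] p p1 by (simp add: B_def)
      then have Bp: "B t p = real v + p + a * (1 - p)" by (simp add: a_def algebra_simps)
      have ya: "y = a * w" by (simp add: y_def x_def a_def)
      have aw: "a * w \<le> a * (1/2)" using a w by (intro mult_left_mono) auto
      have "0 \<le> a * (1/2)" using a by simp
      have "a * p \<le> 1/4 * p" using a p by (intro mult_right_mono) auto
      have eq: "B t p - y = real v + (p + a - a * p - a * w)" by (simp add: Bp ya algebra_simps)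
      have "a * (1 - p) \<le> 1/4 * (1 - p)" using a p1 by (intro mult_right_mono) auto
      then have up: "a - a * p \<le> 1/4 - p/4" by (simp add: algebra_simps)
      have "B t p - y \<notin> \<int>"
      proof (rule not_Ints_between[of "real v"])
        show "real v < B t p - y" unfolding eq using \<open>a * p \<le> 1/4 * p\<close> aw \<open>0 \<le> a * (1/2)\<close> p by linarith
        show "B t p - y < real v + 1" unfolding eq using up p1 a mult_nonneg_nonneg[OF a(1), of w] w by linarith
      qed simp
      then show False using Bpy by blast
    qed
    have Up: "U p = real v + p" using U_mid[of p] p1 p by simp
    then have "B t p = real v + p" using V_le[of p] p by (simp add: B_def algebra_simps)
    then have "p - y \<in> \<int>" using Bpy Ints_diff[of "real v + p - y" "real v"] by simp
    then obtain k :: int where k: "p - y = of_int k" by (elim Ints_cases)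
    have y1: "y < 1" using y x eta by linarith
    have "0 < real_of_int k" "real_of_int k < real m" using k p1 p y y1 by linarith+
    then have kk: "0 < k" "k < int m" by linarith+
    define i where "i = nat k"
    have i: "0 < i" "i < m" "p = real i + y" using kk k by (auto simp: i_def)
    have "sin (2 * pi * p) = sin (2 * pi * y)" using sin_cos_2pi_Ints(1)[of "real i" y] i by simp
    then have ap: "ang p = lev i + d i * y + sin (2 * pi * y) / 8" using ang_eq[of i p] i y y1 by simp
    have aq: "ang q = real r + w" using ang_last[of q] q by (simp add: lev_m w_def)
    define N where "N = real r - lev i"
    have N: "N \<in> \<int>" using lev_Ints[of i] by (simp add: N_def)
    define DL where "DL = (U q - U p) * real r / real s"
    define DT where "DT = ang q - ang p"
    have "DL * real s = (real s + x - (real v + p)) * real r" using s_pos by (simp add: DL_def Uq Up)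
    then have DLs: "DL * real s = real s * real r - real (v + i) * real r + (x - y) * real r"
      by (simp add: i(3) algebra_simps)
    have xr: "0 \<le> (x - y) * real r" "(x - y) * real r < 1"
    proof -
      have "(x - y) * real r \<le> \<eta> * real r" using x y by (intro mult_right_mono) auto
      then show "(x - y) * real r < 1" using eta by simp
    qed (use y in simp)
    have "N * real s < DL * real s"
    proof -
      have "N * real s = real s * real r - real s * lev i" by (simp add: N_def algebra_simps)
      then show ?thesis using DLs lev_upper[OF i(1,2)] xr by linarith
    qed
    then have DL1: "N < DL" using s_pos by simp
    have "DL * real s < (N + 1) * real s"
    proof -
      have "(N + 1) * real s = real s * real r - real s * (lev i - 1)" by (simp add: N_def algebra_simps)
      then show ?thesis using DLs lev_lower[OF i(1,2)] xr by linarith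
    qed
    then have DL2: "DL < N + 1" using s_pos by simp
    have sn: "0 \<le> sin (2 * pi * y)" "sin (2 * pi * y) / 8 \<le> y"
    proof -
      have y8: "y \<le> 1/8" using y x eta by linarith
      then have "2 * pi * y \<le> 2 * pi * (1/2)" by (intro mult_left_mono) auto
      then show "0 \<le> sin (2 * pi * y)" using y by (intro sin_ge_zero) auto
      have "sin (2 * pi * y) \<le> 2 * pi * y" using y by (intro sin_x_le_x) auto
      also have "\<dots> \<le> 2 * 4 * y" using y pi_less_4 by (intro mult_right_mono) auto
      finally show "sin (2 * pi * y) / 8 \<le> y" by simp
    qed
    have dy: "0 \<le> d i * y" "d i * y \<le> y" using d01[of i] y by auto
    have DT: "DT = N + (w - d i * y - sin (2 * pi * y) / 8)" by (simp add: DT_def ap aq N_def)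
    have "2 * x \<le> 4 * (1/8) * w" unfolding x_def using eta w mult_right_mono[OF eta(2), of w] by simp
    then have DT1: "N < DT" "DT < N + 1" unfolding DT using sn dy y w by linarith+
    have comb: "N < (1 - t) * DL + t * DT \<and> (1 - t) * DL + t * DT < N + 1"
    proof (cases "t = 0")
      case False
      then have t0: "t > 0" using t by simp
      have "(1 - t) * N \<le> (1 - t) * DL" "(1 - t) * DL \<le> (1 - t) * (N + 1)"
        using t DL1 DL2 by (auto intro!: mult_left_mono)
      moreover have "t * N < t * DT" "t * DT < t * (N + 1)" using t0 DT1 by auto
      ultimately show ?thesis by (simp add: algebra_simps)
    qed (use DL1 DL2 in simp)
    then show ?thesis unfolding A_diff DL_def[symmetric] DT_def[symmetric]
      by (intro not_Ints_between[OF N]) auto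
  qed
  have rho_le: "\<rho> t p = (1 - t) + t * (p / real m)" if "p \<le> real m" for t p
    using that by (simp add: \<rho>_def rad_le)
  have rho_ge: "\<rho> t p = (1 - t) + t * (1 - min 1 (2 * (p - real m)))" if "real m \<le> p" for t p
    using that m by (simp add: \<rho>_def rad_ge)
  have "ambient_isotopic ((\<lambda>p. tube (\<rho> 0 p) (A 0 p) (B 0 p)) ` {0..real m + 1})
     ((\<lambda>p. tube (\<rho> 1 p) (A 1 p) (B 1 p)) ` {0..real m + 1})"
  proof (rule tube_family_isotopy)
    show "(0::real) < real m + 1" by simp
    show "lipfam {0..real m + 1} \<rho>" "lipfam {0..real m + 1} A" "lipfam {0..real m + 1} B"
      unfolding \<rho>_def A_def B_def divide_inverse
      by (intro lipfam_add lipfam_mult lipfam_diff lipfam_const lipfam_param lipfam_rad_core lipfam_ang lipU lipV)+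
    show "0 \<le> \<rho> t p \<and> \<rho> t p \<le> 1" if "t \<in> {0..1}" "p \<in> {0..real m + 1}" for t p
    proof -
      have "0 \<le> t * rad_core p" "t * rad_core p \<le> t * 1"
        using that rad_range[of p] by (auto intro!: mult_left_mono simp del: mult_1_right)
      then show ?thesis using that by (auto simp: \<rho>_def)
    qed
    show "\<rho> t (real m + 1) = \<rho> t 0 \<and> A t (real m + 1) - A t 0 \<in> \<int> \<and> (\<rho> t 0 = 0 \<or> B t (real m + 1) - B t 0 \<in> \<int>)" for t
      unfolding A_end B_end by (simp add: \<rho>_def rad_end)
    show "p = 0 \<and> q = real m + 1"
      if t: "t \<in> {0..1}" and pq: "p \<in> {0..real m + 1}" "q \<in> {0..real m + 1}" "p < q"
        and eq: "\<rho> t p = \<rho> t q" "A t q - A t p \<in> \<int>" "\<rho> t p = 0 \<or> B t q - B t p \<in> \<int>" for t p q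
    \<comment> \<open>Here the angles are proportional: an integral increment \<open>k\<close> of
      \<open>U\<close> for which \<open>k * r / s\<close> is integral is a multiple of
      \<open>s\<close> by coprimality, and only the whole curve is that long.\<close>
    proof (cases "t = 0")
      case True
      then have "U q - U p \<in> \<int>" using eq(3) by (simp add: \<rho>_def B_def)
      then obtain k :: int where k: "U q - U p = of_int k" by (elim Ints_cases)
      have "A t q - A t p = of_int k * real r / real s" unfolding A_diff k True by simp
      then obtain n :: int where "of_int k * real r / real s = of_int n" using eq(2) by (metis Ints_cases)
      then have "of_int k * real r = of_int n * real s" using s_pos by (simp add: field_simps)
      then have "real_of_int (k * int r) = real_of_int (n * int s)" by simp
      then have "k * int r = n * int s" by (simp only: of_int_eq_iff)
      then have "int s dvd k * int r" by simp
      then have "int s dvd k" using coprime by (simp add: coprime_dvd_mult_left_iff coprime_commute)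
      moreover have "0 < real_of_int k" using k U_strict[OF pq(3)] by linarith
      then have "0 < k" by simp
      ultimately have "int s \<le> k" by (intro zdvd_imp_le)
      then have ge: "real s \<le> U q - U p" using k by linarith
      have "U p \<ge> U 0" "U q \<le> U (real m + 1)"
        using U_strict[of 0 p] U_strict[of q "real m + 1"] pq by (auto simp: le_less)
      moreover have "U (real m + 1) - U 0 = real s" by (simp add: U_ends)
      ultimately have "U p = U 0" "U q = U (real m + 1)" using ge by linarith+
      then show ?thesis using U_strict[of 0 p] U_strict[of q "real m + 1"] pq by force
    next
      case False
      then have t0: "t > 0" using t by simp
      have rc: "rad_core p = rad_core q" using eq(1) t0 by (simp add: \<rho>_def)
      consider "q \<le> real m" | "real m \<le> p" | "p < real m" "real m < q" using pq by linarith
      then show ?thesis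
      proof cases
        case 1
        then show ?thesis using rc pq m by (simp add: rad_le)
      next
        case 2
        then have "min 1 (2 * (p - real m)) = min 1 (2 * (q - real m))" using rc m pq by (simp add: rad_ge)
        then have "real m + 1/2 \<le> p" using pq by (auto simp: min_def split: if_splits)
        then show ?thesis using core_Ints[of t p q] t pq eq(2) by auto
      next
        case 3
        have rq: "rad_core q = 1 - min 1 (2 * (q - real m))" using 3 m by (simp add: rad_ge)
        have rp: "rad_core p = p / real m" using 3 by (simp add: rad_le)
        show ?thesis
        proof (cases "real m + 1/2 \<le> q")
          case True
          then have p0: "p = 0" using rc rq rp m by (simp add: min_absorb1)
          have "q = real m + 1"
          proof (rule ccontr)
            assume "q \<noteq> real m + 1"
            then have "A t (real m + 1) - A t q \<notin> \<int>" using True pq t by (intro core_Ints) auto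
            moreover have "A t (real m + 1) - A t q = real r - (A t q - A t p)" using A_end[of t] p0 by simp
            ultimately show False using eq(2) by simp
          qed
          then show ?thesis using p0 by simp
        next
          case False
          then have q: "q < real m + 1/2" by simp
          then have "rad_core q > 0" using rq 3 by (simp add: min_def)
          then have "0 < p / real m" using rc rp by simp
          then have "p > 0" by (simp add: zero_less_divide_iff)
          moreover have "\<rho> t p > 0"
          proof -
            have "0 < t * rad_core p" using rc \<open>rad_core q > 0\<close> t0 by simp
            then show ?thesis using t by (simp add: \<rho>_def)
          qed
          then have "B t q - B t p \<in> \<int>" using eq(3) by simp
          ultimately show ?thesis using spiral_drop[of t p q] t 3 q eq(2) by blast
        qed
      qed
    qed
    define c where "c = min (2 * \<eta> * real r / real s) (1/8)"
    have c: "c > 0" using eta r s_pos by (simp add: c_def)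
    have A_lens: "c * (q - p) \<le> A t q - A t p" if "t \<in> {0..1}" "p < q" "(q - p) / 8 \<le> ang q - ang p" for t p q
    proof -
      have "c * (q - p) = (1 - t) * (c * (q - p)) + t * (c * (q - p))" by (simp add: algebra_simps)
      also have "\<dots> \<le> (1 - t) * ((U q - U p) * real r / real s) + t * (ang q - ang p)"
      proof (intro add_mono mult_left_mono)
        have "c * (q - p) \<le> (2 * \<eta> * real r / real s) * (q - p)" using that by (intro mult_right_mono) (auto simp: c_def)
        also have "\<dots> = 2 * \<eta> * (q - p) * real r / real s" by simp
        also have "\<dots> \<le> (U q - U p) * real r / real s"
          using U_steep[of p q] that s_pos by (intro divide_right_mono mult_right_mono) auto
        finally show "c * (q - p) \<le> (U q - U p) * real r / real s" .
        have "c * (q - p) \<le> 1/8 * (q - p)" using that by (intro mult_right_mono) (auto simp: c_def)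
        then show "c * (q - p) \<le> ang q - ang p" using that(3) by linarith
      qed (use that in auto)
      finally show ?thesis unfolding A_diff .
    qed
    show "\<exists>e>0. \<exists>c>0.
       (\<forall>t\<in>{0..1}. \<forall>u\<in>{0..real m + 1}. \<forall>w\<in>{0..real m + 1}. \<bar>u - u0\<bar> < e \<longrightarrow> \<bar>w - u0\<bar> < e \<longrightarrow> u < w \<longrightarrow> c * (w - u) \<le> A t w - A t u) \<or>
       (\<forall>t\<in>{0..1}. \<forall>u\<in>{0..real m + 1}. \<forall>w\<in>{0..real m + 1}. \<bar>u - u0\<bar> < e \<longrightarrow> \<bar>w - u0\<bar> < e \<longrightarrow> u < w \<longrightarrow>
          c * (w - u) \<le> B t w - B t u \<and> c \<le> \<rho> t u \<and> c \<le> \<rho> t w)"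
      if u0: "u0 \<in> {0..real m + 1}" for u0
    proof -
      consider i :: int where "u0 = of_int i" | "real m < u0" | "0 < u0" "u0 < real m"
        using u0 by (metis atLeastAtMost_iff linorder_less_linear of_int_0 of_int_of_nat_eq order_le_less)
      then show ?thesis
      proof cases
        case (1 i)
        have "c * (w - u) \<le> A t w - A t u"
          if "t \<in> {0..1}" "w \<in> {0..real m + 1}" "\<bar>u - u0\<bar> < 1/8" "\<bar>w - u0\<bar> < 1/8" "u < w" for t u w
          using ang_lens_int[of u w i] that 1 by (intro A_lens) auto
        moreover have "(0::real) < 1/8" by simp
        ultimately show ?thesis using c by blast
      next
        case 2
        have "c * (w - u) \<le> A t w - A t u"
          if "t \<in> {0..1}" "w \<in> {0..real m + 1}" "\<bar>u - u0\<bar> < u0 - real m" "u < w" for t u w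
          using ang_lens_last[of u w] that 2 by (intro A_lens) auto
        moreover have "0 < u0 - real m" using 2 by simp
        ultimately show ?thesis using c by blast
      next
        case 3
        define e where "e = min (u0 / 2) (real m - u0)"
        define c' where "c' = min (2 * \<eta>) (u0 / (2 * real m))"
        have e: "e > 0" "c' > 0" using 3 m eta by (auto simp: e_def c'_def)
        have "c' * (w - u) \<le> B t w - B t u \<and> c' \<le> \<rho> t u \<and> c' \<le> \<rho> t w"
          if "t \<in> {0..1}" "\<bar>u - u0\<bar> < e" "\<bar>w - u0\<bar> < e" "u < w" for t u w
        proof -
          have uw: "u0 / 2 \<le> u" "u0 / 2 \<le> w" "u \<le> real m" "w \<le> real m" using that unfolding e_def min_less_iff_conj by linarith+
          have rho: "c' \<le> \<rho> t x" if x: "u0 / 2 \<le> x" "x \<le> real m" for x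
          proof -
            have "c' \<le> u0 / (2 * real m)" by (simp add: c'_def)
            also have "\<dots> \<le> x / real m" using divide_right_mono[OF x(1), of "real m"] by simp
            also have "x / real m = (1 - t) * (x / real m) + t * (x / real m)" by (simp add: left_diff_distrib del: times_divide_eq_right)
            also have "\<dots> \<le> (1 - t) * 1 + t * (x / real m)"
              using \<open>t \<in> {0..1}\<close> x m by (intro add_right_mono mult_left_mono) auto
            finally show ?thesis using rho_le[OF x(2), of t] by simp
          qed
          have "c' * (w - u) \<le> 2 * \<eta> * (w - u)" using that by (intro mult_right_mono) (auto simp: c'_def)
          also have "\<dots> = (1 - t) * (2 * \<eta> * (w - u)) + t * (2 * \<eta> * (w - u))" by (simp add: algebra_simps)
          also have "\<dots> \<le> (1 - t) * (U w - U u) + t * (w - u)"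
          proof (intro add_mono mult_left_mono)
            show "2 * \<eta> * (w - u) \<le> U w - U u" using that by (intro U_steep) auto
            have "2 * \<eta> * (w - u) \<le> 1 * (w - u)" using that eta by (intro mult_right_mono) auto
            then show "2 * \<eta> * (w - u) \<le> w - u" by simp
          qed (use that in auto)
          also have "\<dots> = B t w - B t u" using uw by (simp add: B_def V_le algebra_simps)
          finally show ?thesis using rho uw by blast
        qed
        with e show ?thesis by blast
      qed
    qed
    have "c * (u - 0) \<le> A t u - A t 0 \<and> c * (real m + 1 - w) \<le> A t (real m + 1) - A t w"
      if t: "t \<in> {0..1}" and u: "u \<in> {0..real m + 1}" "w \<in> {0..real m + 1}" "u - 0 < 1/8" "real m + 1 - w < 1/8" for t u w
    proof
      show "c * (u - 0) \<le> A t u - A t 0"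
      proof (cases "u = 0")
        case False
        then show ?thesis using ang_lens_int[of 0 u 0] t u by (intro A_lens) auto
      qed simp
      show "c * (real m + 1 - w) \<le> A t (real m + 1) - A t w"
      proof (cases "w = real m + 1")
        case False
        then show ?thesis using ang_lens_last[of w "real m + 1"] t u by (intro A_lens) auto
      qed simp
    qed
    moreover have "(0::real) < 1/8" by simp
    ultimately show "\<exists>e>0. \<exists>c>0. \<forall>t\<in>{0..1}. \<forall>u\<in>{0..real m + 1}. \<forall>w\<in>{0..real m + 1}. u - 0 < e \<longrightarrow> real m + 1 - w < e \<longrightarrow>
       c * (u - 0) \<le> A t u - A t 0 \<and> c * (real m + 1 - w) \<le> A t (real m + 1) - A t w"
      using c by blast
  qed
  then show ?thesis by (simp add: \<rho>_def A_def B_def)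
qed

end


subsection \<open>Petal numbers of torus knots\<close>

lemma petal_number_le:
  assumes "ambient_isotopic K (path_image \<gamma>)" "petal_projection n \<gamma>" "n \<le> n'"
  shows "petal_number K \<le> enat n'"
proof -
  have "petal_number K \<le> enat n" unfolding petal_number_def using assms(1,2) by (intro Inf_lower) blast
  also have "\<dots> \<le> enat n'" using assms(3) by simp
  finally show ?thesis .
qed

lemma torus_knot_permute:
  "(\<lambda>x. vector [x $ 2, x $ 3, x $ 1] :: real^3) ` torus_knot (int r) (int s) = (\<lambda>u. tube 1 (real r * u) (real s * u)) ` {0..1}"
proof -
  have "vector [torus_point a b $ 2, torus_point a b $ 3, torus_point a b $ 1] =
     (vector [(2 + cos b) * sin a, sin b, (2 + cos b) * cos a] :: real^3)" for a b
    by (simp add: torus_point_def)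
  then show ?thesis by (simp add: torus_knot_def image_image tube_def mult.assoc)
qed

text \<open>\<open>U\<close> starts at \<open>U a\<close> instead of 0 and still covers one period
  of the closed curve; full periods change the two angles by multiples of \<open>r\<close> and
  \<open>s\<close>.\<close>

lemma tube_curve_period:
  fixes U :: "real \<Rightarrow> real"
  assumes s: "s > 0" and U: "continuous_on {a..b} U" "a \<le> b" "U b = U a + real s"
    and range: "\<And>p. p \<in> {a..b} \<Longrightarrow> U a \<le> U p \<and> U p \<le> U b"
  shows "(\<lambda>p. tube \<rho> (U p * real r / real s) (U p)) ` {a..b} = (\<lambda>u. tube \<rho> (real r * u) (real s * u)) ` {0..1}"
proof -
  define f where "f u = tube \<rho> (real r * u) (real s * u)" for u
  have per: "f (u + of_int k) = f u" for u k
    unfolding f_def by (rule tube_cong) (auto simp: algebra_simps)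
  have Uf: "tube \<rho> (U p * real r / real s) (U p) = f (U p / real s)" for p
    using s by (simp add: f_def mult.commute)
  have "f ` {0..1} \<subseteq> (\<lambda>p. f (U p / real s)) ` {a..b}"
  proof clarify
    fix u :: real assume u: "u \<in> {0..1}"
    define k where "k = \<lceil>U a / real s - u\<rceil>"
    have k: "U a / real s \<le> u + of_int k" "u + of_int k \<le> U a / real s + 1" unfolding k_def by linarith+
    have "U a \<le> (u + of_int k) * real s" using k(1) s by (simp add: divide_le_eq)
    moreover have "(u + of_int k) * real s \<le> U b"
      using mult_right_mono[OF k(2), of "real s"] s U(3) by (simp add: distrib_right)
    ultimately obtain p where p: "a \<le> p" "p \<le> b" "U p = (u + of_int k) * real s"
      using IVT'[of U a "(u + of_int k) * real s" b] U by blast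
    have "U p / real s = u + of_int k" using p(3) s by simp
    then have "f u = f (U p / real s)" using per[of u k] by simp
    then show "f u \<in> (\<lambda>p. f (U p / real s)) ` {a..b}" using p(1,2) by (intro image_eqI[of _ _ p]) auto
  qed
  moreover have "(\<lambda>p. f (U p / real s)) ` {a..b} \<subseteq> f ` {0..1}"
  proof clarify
    fix p assume "p \<in> {a..b}"
    have "f (U p / real s) = f (frac (U p / real s))"
      using per[of "frac (U p / real s)" "\<lfloor>U p / real s\<rfloor>"] by (simp add: frac_def)
    moreover have "frac (U p / real s) \<in> {0..1}" using frac_lt_1[of "U p / real s"] by (simp add: less_imp_le)
    ultimately show "f (U p / real s) \<in> f ` {0..1}" by simp
  qed
  ultimately show ?thesis unfolding Uf f_def[symmetric] by blast
qed

context torus_spiral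
begin

lemma petal_number_torus_knot: "petal_number (torus_knot (int r) (int s)) \<le> enat (2 * m + 1)"
proof -
  let ?I = "{0..real m + 1}"
  have lipU: "lipfam ?I (\<lambda>_. U)"
    unfolding U_def by (intro lipfam_add lipfam_mult lipfam_const lipfam_max lipfam_min lipfam_diff lipfam_id)
  have U_mono: "U p \<le> U q" if "p \<le> q" for p q using U_strict[of p q] that by (cases "p = q") auto
  have 1: "(\<lambda>x. vector [x $ 2, x $ 3, x $ 1] :: real^3) ` torus_knot (int r) (int s) =
      (\<lambda>p. tube 1 (U p * real r / real s) (U p)) ` ?I"
    unfolding torus_knot_permute
  proof (rule tube_curve_period[symmetric])
    show "U 0 \<le> U p \<and> U p \<le> U (real m + 1)" if "p \<in> ?I" for p using U_mono that by simp
    show "U (real m + 1) = U 0 + real s" by (simp add: U_ends)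
  qed (use s_pos lipfam_continuous[OF lipU] in auto)
  \<comment> \<open>Up to the core \<open>V\<close> exceeds \<open>min p m\<close> by the integer
    \<open>v\<close>, and on the core the meridional angle has no effect. This is where
    \<open>v\<close> turns disappear.\<close>
  have 2: "(\<lambda>p. tube (rad_core p) (ang p) (V p)) ` ?I = (\<lambda>p. tube (rad_core p) (ang p) (min p (real m))) ` ?I"
  proof (rule image_cong[OF refl])
    fix p assume p: "p \<in> ?I"
    show "tube (rad_core p) (ang p) (V p) = tube (rad_core p) (ang p) (min p (real m))"
    proof (rule tube_cong)
      show "rad_core p = 0 \<or> min p (real m) - V p \<in> \<int>"
      proof (cases "p \<le> real m + 1/2")
        case True
        then have "min p (real m) - V p = - real v" by (simp add: V_def max_absorb1)
        then show ?thesis by simp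
      next
        case False
        then show ?thesis using rad_ge(2)[of p] m by (simp add: min_absorb1)
      qed
    qed simp
  qed
  obtain \<gamma> where \<gamma>: "ambient_isotopic ((\<lambda>p. tube (rad p) (ang p) (min p (real m))) ` ?I) (path_image \<gamma>)"
      "petal_projection (2 * m + 1) \<gamma>"
    using petal_projection_spiral by blast
  have "ambient_isotopic (torus_knot (int r) (int s)) ((\<lambda>p. tube 1 (U p * real r / real s) (U p)) ` ?I)"
    unfolding 1[symmetric] by (rule ambient_isotopic_permute)
  from ambient_isotopic_trans[OF this torus_isotopy]
  have "ambient_isotopic (torus_knot (int r) (int s)) ((\<lambda>p. tube (rad_core p) (ang p) (min p (real m))) ` ?I)"
    unfolding 2 .
  from ambient_isotopic_trans[OF ambient_isotopic_trans[OF this slide_isotopy[OF m]] \<gamma>(1)] \<gamma>(2)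
  show ?thesis by (rule petal_number_le) simp
qed

end

text \<open>The staircase \<open>j\<close> runs through the lattice points just below the line of slope \<open>r / s\<close>:
  the point \<open>q\<close> is in column \<open>j q\<close>. A unit step is a longitudinal turn of the spiral, a
  constant step is a meridional turn.\<close>

lemma petal_number_torus_knot_coprime:
  fixes r s :: nat
  assumes r: "r \<ge> 2" and s: "s > 0" and rs: "r \<le> s + 1" and cop: "coprime r s"
  shows "petal_number (torus_knot (int r) (int s)) \<le> enat (2 * (s - s div r) + 1)"
proof -
  define v where "v = s div r"
  define m where "m = s - v"
  \<comment> \<open>The smallest integer above \<open>q * r / s\<close>. At \<open>q = s\<close> the
    path ends on the lattice point of the line itself, hence \<open>r\<close> and not
    \<open>r + 1\<close>.\<close>
  define j where "j q = (if q < s then q * r div s + 1 else r)" for q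
  define d where "d i = (if i < m then real (j (v + i + 1)) - real (j (v + i)) else 1)" for i
  have vs: "v < s" unfolding v_def using r s by (intro div_less_dividend) auto
  then have m: "m > 0" "s = v + m" by (auto simp: m_def)
  have vr: "v * r + 1 \<le> s"
  proof -
    have "\<not> r dvd s" using cop r by (auto simp: coprime_absorb_left)
    then have "s mod r > 0" by (simp add: mod_greater_zero_iff_not_dvd)
    moreover have "v * r + s mod r = s" by (simp add: v_def)
    ultimately show ?thesis by linarith
  qed
  \<comment> \<open>The rows 0 to \<open>v\<close> all lie in column 1. The spiral starts in row
    \<open>v\<close>; the \<open>v\<close> turns before it are, by periodicity, those made along the
    core.\<close>
  have jv: "j v = 1" using vr vs by (simp add: j_def)
  have js: "j s = r" by (simp add: j_def)
  \<comment> \<open>For \<open>r \<le> s\<close> the quotient grows by at most 1 per row, and the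
    exceptional value \<open>r\<close> in row \<open>s\<close> is already reached in the row before.
    For \<open>r = s + 1\<close> every row advances by exactly one column, and the value
    \<open>r\<close> lets row \<open>s\<close> do the same.\<close>
  have step: "j (q + 1) = j q \<or> j (q + 1) = j q + 1" if q: "q < s" for q
  proof (cases "r \<le> s")
    case True
    show ?thesis
    proof (cases "q + 1 < s")
      case lt: True
      have "(q + 1) * r div s \<le> (q * r + s) div s" using True by (intro div_le_mono) simp
      also have "\<dots> = q * r div s + 1" using s by simp
      finally have "(q + 1) * r div s \<le> q * r div s + 1" .
      moreover have "q * r div s \<le> (q + 1) * r div s" by (intro div_le_mono) simp
      ultimately show ?thesis using lt by (auto simp: j_def)
    next
      case False
      then have s': "s = q + 1" using q by simp
      have "q * r = (r - 1) * s + (s - r)"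
      proof -
        obtain r' where "r = Suc r'" using r by (cases r) auto
        then show ?thesis using True by (simp add: s' algebra_simps)
      qed
      then have "q * r div s = r - 1 + (s - r) div s" using s by simp
      also have "(s - r) div s = 0" using r s by simp
      finally show ?thesis using r False q by (simp add: j_def)
    qed
  next
    case False
    then have r': "r = s + 1" using rs by simp
    have dv: "x * r div s = x" if "x < s" for x
    proof -
      have "x * r = x * s + x" by (simp add: r')
      then show ?thesis using that by simp
    qed
    have "j q = q + 1" by (simp only: j_def q if_True dv[OF q])
    moreover have "j (q + 1) = q + 1 + 1"
    proof (cases "q + 1 < s")
      case True
      then show ?thesis by (simp only: j_def if_True dv[OF True])
    next
      case False
      then show ?thesis using q r' by (simp add: j_def)
    qed
    ultimately show ?thesis by simp
  qed
  have d01: "d i = 0 \<or> d i = 1" for i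
    using step[of "v + i"] m by (auto simp: d_def)
  interpret spiral m d
    by unfold_locales (use d01 in \<open>auto simp: d_def\<close>)
  have lev: "lev i = real (j (v + i))" if "i \<le> m" for i
    using that
  proof (induction i)
    case 0
    then show ?case by (simp add: lev_0 jv)
  next
    case (Suc i)
    have di: "d i = real (j (v + i + 1)) - real (j (v + i))" unfolding d_def using Suc.prems by simp
    show ?case unfolding lev_Suc di using Suc by simp
  qed
  have bounds: "real s * (lev i - 1) + 1 \<le> real (v + i) * real r \<and> real (v + i) * real r + 1 \<le> real s * lev i"
    if i: "0 < i" "i < m" for i
  proof -
    define q where "q = v + i"
    have q: "0 < q" "q < s" using i m by (auto simp: q_def)
    have "\<not> s dvd q * r"
    proof
      assume "s dvd q * r"
      then have "s dvd q" using cop by (simp add: coprime_dvd_mult_left_iff coprime_commute)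
      then show False using q by (auto dest: dvd_imp_le)
    qed
    then have "q * r mod s > 0" by (simp add: mod_greater_zero_iff_not_dvd)
    moreover have "q * r mod s < s" using s by simp
    moreover have "s * (q * r div s) + q * r mod s = q * r" by simp
    ultimately have 1: "s * (q * r div s) + 1 \<le> q * r" "q * r + 1 \<le> s * (q * r div s + 1)"
      unfolding add_mult_distrib2 by linarith+
    have l: "lev i = real (q * r div s) + 1" using lev[of i] i q by (simp add: j_def q_def)
    have "real (s * (q * r div s) + 1) \<le> real (q * r)" "real (q * r + 1) \<le> real (s * (q * r div s + 1))"
      using 1 by (simp_all only: of_nat_le_iff)
    then show ?thesis by (simp add: l q_def algebra_simps)
  qed
  interpret torus_spiral m d r s v
    by unfold_locales (use m r vr cop lev[of m] js bounds in \<open>auto simp: mult.commute\<close>)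
  show ?thesis using petal_number_torus_knot by (simp add: m_def v_def)
qed

section \<open>Trivial torus knots\<close>

lemma longitude_isotopy:
  "ambient_isotopic ((\<lambda>u. tube 1 u (real s * u)) ` {0..1}) ((\<lambda>u. tube 0 u (real s * u)) ` {0..1})"
proof -
  have "ambient_isotopic ((\<lambda>u. tube (1 - 0) u (real s * u)) ` {0..1}) ((\<lambda>u. tube (1 - 1) u (real s * u)) ` {0..1})"
  proof (rule tube_family_isotopy[where \<rho> = "\<lambda>t _. 1 - t" and A = "\<lambda>_ u. u" and B = "\<lambda>_ u. real s * u"])
    show "lipfam {0..1} (\<lambda>t _. 1 - t)" "lipfam {0..1} (\<lambda>_ u. u)" "lipfam {0..1} (\<lambda>_ u. real s * u)"
      by (intro lipfam_diff lipfam_mult lipfam_const lipfam_param lipfam_id)+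
    show "u = 0 \<and> v = 1" if uv: "u \<in> {0..1}" "v \<in> {0..1}" "u < v" "v - u \<in> \<int>" for u v :: real
    proof -
      obtain k :: int where k: "v - u = of_int k" using uv(4) by (elim Ints_cases)
      have "0 < real_of_int k" "real_of_int k \<le> 1" using k uv by auto
      then have "k = 1" by linarith
      then have "v - u = 1" using k by simp
      then show ?thesis using uv by auto
    qed
    show "\<exists>e>0. \<exists>c>0.
       (\<forall>t\<in>{0..1::real}. \<forall>u\<in>{0..1}. \<forall>v\<in>{0..1}. \<bar>u - u0\<bar> < e \<longrightarrow> \<bar>v - u0\<bar> < e \<longrightarrow> u < v \<longrightarrow> c * (v - u) \<le> v - u) \<or>
       (\<forall>t\<in>{0..1}. \<forall>u\<in>{0..1}. \<forall>v\<in>{0..1}. \<bar>u - u0\<bar> < e \<longrightarrow> \<bar>v - u0\<bar> < e \<longrightarrow> u < v \<longrightarrow>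
          c * (v - u) \<le> real s * v - real s * u \<and> c \<le> 1 - t \<and> c \<le> 1 - t)" for u0 :: real
      by (intro exI[of _ "1::real"] conjI disjI1) auto
    show "\<exists>e>0. \<exists>c>0. \<forall>t\<in>{0..1::real}. \<forall>u\<in>{0..1::real}. \<forall>v\<in>{0..1::real}. u - 0 < e \<longrightarrow> 1 - v < e \<longrightarrow>
       c * (u - 0) \<le> u - 0 \<and> c * (1 - v) \<le> 1 - v"
      by (intro exI[of _ "1::real"] conjI) auto
  qed auto
  then show ?thesis by simp
qed

text \<open>For \<open>r = 1\<close> the longitudinal angle alone separates points, so the knot can
  be shrunk to the core, which is the spiral with \<open>m = 0\<close>.\<close>

lemma petal_number_longitude: "petal_number (torus_knot 1 (int s)) \<le> enat 1"
proof -
  interpret spiral 0 "\<lambda>_. 1" by unfold_locales auto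
  obtain \<gamma> where \<gamma>: "ambient_isotopic ((\<lambda>p. tube (rad p) (ang p) (min p (real 0))) ` {0..real 0 + 1}) (path_image \<gamma>)"
      "petal_projection (2 * 0 + 1) \<gamma>"
    using petal_projection_spiral by blast
  have "(\<lambda>p. tube (rad p) (ang p) (min p (real 0))) ` {0..real 0 + 1} = (\<lambda>u. tube 0 u (real s * u)) ` {0..1}"
  proof (rule image_cong)
    fix u :: real assume u: "u \<in> {0..1}"
    have "ang u = 1 + u" using ang_last[of u] u by (simp add: lev_0)
    moreover have "rad u = 0" by (simp add: rad_def)
    ultimately show "tube (rad u) (ang u) (min u (real 0)) = tube 0 u (real s * u)"
      by (auto intro!: tube_cong)
  qed simp
  then have "ambient_isotopic ((\<lambda>u. tube 1 (real 1 * u) (real s * u)) ` {0..1}) (path_image \<gamma>)"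
    using ambient_isotopic_trans[OF longitude_isotopy[of s]] \<gamma>(1) by simp
  then have "ambient_isotopic (torus_knot (int 1) (int s)) (path_image \<gamma>)"
    using ambient_isotopic_trans[OF ambient_isotopic_permute[of "torus_knot (int 1) (int s)"]]
    unfolding torus_knot_permute by blast
  then show ?thesis using \<gamma>(2) by (intro petal_number_le[of _ \<gamma> 1]) auto
qed

text \<open>The torus knot of type \<open>(R, 1)\<close>, deformed so that a part of it becomes a segment of the axis of rotation;
  there the longitudinal angle is irrelevant, which makes the value of \<open>R\<close> irrelevant.\<close>

definition unwind_radius :: "real \<Rightarrow> real \<Rightarrow> real" where
  "unwind_radius x u = (1 - x) * (2 + cos (2 * pi * u)) + x * max 0 (1/2 + cos (2 * pi * u))"

definition unwind_curve :: "nat \<Rightarrow> real \<Rightarrow> real \<Rightarrow> real^3" where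
  "unwind_curve R x u =
     vector [unwind_radius x u * cos (2 * pi * real R * ((1 - x) * u + x * clamp01 (3 * u - 1))),
       unwind_radius x u * sin (2 * pi * real R * ((1 - x) * u + x * clamp01 (3 * u - 1))), sin (2 * pi * u)]"

lemma unwind_radius_nonneg: "0 \<le> x \<Longrightarrow> x \<le> 1 \<Longrightarrow> 0 \<le> unwind_radius x u"
proof -
  assume x: "0 \<le> x" "x \<le> 1"
  have "0 \<le> 2 + cos (2 * pi * u)" using cos_ge_minus_one[of "2 * pi * u"] by linarith
  then have "0 \<le> (1 - x) * (2 + cos (2 * pi * u))" "0 \<le> x * max 0 (1/2 + cos (2 * pi * u))"
    using x by (intro mult_nonneg_nonneg; simp)+
  then show ?thesis unfolding unwind_radius_def by (rule add_nonneg_nonneg)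
qed

text \<open>Equal heights leave two opposite values of the cosine, and the radius is strictly larger
  at the positive one. So at every stage radius and height trace a simple closed profile.\<close>

lemma unwind_radius_eqD:
  assumes x: "0 \<le> x" "x \<le> 1" and eq: "unwind_radius x u = unwind_radius x v" "sin (2 * pi * u) = sin (2 * pi * v)"
  shows "cos (2 * pi * u) = cos (2 * pi * v)"
proof -
  define f where "f c = (1 - x) * (2 + c) + x * max 0 (1/2 + c)" for c
  have f: "f c > f (- c)" if "c > 0" for c
  proof -
    have "f c - f (- c) = (1 - x) * (2 * c) + x * (max 0 (1/2 + c) - max 0 (1/2 - c))"
      by (simp add: f_def algebra_simps)
    moreover have "0 \<le> (1 - x) * (2 * c)" "0 \<le> x * (max 0 (1/2 + c) - max 0 (1/2 - c))"
      using x that by (auto intro!: mult_nonneg_nonneg)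
    moreover have "0 < (1 - x) * (2 * c) \<or> 0 < x * (max 0 (1/2 + c) - max 0 (1/2 - c))"
      using x that by (cases "x = 1") auto
    ultimately show ?thesis by linarith
  qed
  have "(cos (2 * pi * u))\<^sup>2 = (cos (2 * pi * v))\<^sup>2" using eq(2) by (simp add: cos_squared_eq)
  then have "cos (2 * pi * u) = cos (2 * pi * v) \<or> cos (2 * pi * u) = - cos (2 * pi * v)"
    by (simp add: power2_eq_iff)
  moreover have "f (cos (2 * pi * u)) = f (cos (2 * pi * v))" using eq(1) by (simp add: f_def unwind_radius_def)
  ultimately show ?thesis using f[of "cos (2 * pi * u)"] f[of "cos (2 * pi * v)"]
    by (cases "cos (2 * pi * v)" "0::real" rule: linorder_cases) auto
qed

text \<open>Rotating two points of a half-plane about its edge by different angles does not bring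
  them closer, so the profile alone controls distances.\<close>

lemma unwind_curve_lower:
  assumes x: "0 \<le> x" "x \<le> 1"
  shows "\<bar>unwind_radius x u - unwind_radius x v\<bar> \<le> norm (unwind_curve R x u - unwind_curve R x v)"
    "\<bar>sin (2 * pi * u) - sin (2 * pi * v)\<bar> \<le> norm (unwind_curve R x u - unwind_curve R x v)"
proof -
  let ?a = "\<lambda>u. 2 * pi * real R * ((1 - x) * u + x * clamp01 (3 * u - 1))"
  have n: "(norm (unwind_curve R x u - unwind_curve R x v))\<^sup>2 =
     ((unwind_radius x u * sin (?a u) - unwind_radius x v * sin (?a v))\<^sup>2 + (unwind_radius x u * cos (?a u) - unwind_radius x v * cos (?a v))\<^sup>2)
      + (sin (2 * pi * u) - sin (2 * pi * v))\<^sup>2"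
    by (simp add: norm3_squared unwind_curve_def)
  have "0 \<le> 4 * (unwind_radius x u * unwind_radius x v) * (sin ((?a u - ?a v) / 2))\<^sup>2"
    using unwind_radius_nonneg[OF x] by simp
  then have "(unwind_radius x u - unwind_radius x v)\<^sup>2 + (sin (2 * pi * u) - sin (2 * pi * v))\<^sup>2 \<le> (norm (unwind_curve R x u - unwind_curve R x v))\<^sup>2"
    unfolding n polar_dist by simp
  then have "(unwind_radius x u - unwind_radius x v)\<^sup>2 \<le> (norm (unwind_curve R x u - unwind_curve R x v))\<^sup>2"
    "(sin (2 * pi * u) - sin (2 * pi * v))\<^sup>2 \<le> (norm (unwind_curve R x u - unwind_curve R x v))\<^sup>2"
    using zero_le_power2[of "unwind_radius x u - unwind_radius x v"] zero_le_power2[of "sin (2 * pi * u) - sin (2 * pi * v)"] by linarith+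
  then show "\<bar>unwind_radius x u - unwind_radius x v\<bar> \<le> norm (unwind_curve R x u - unwind_curve R x v)"
    "\<bar>sin (2 * pi * u) - sin (2 * pi * v)\<bar> \<le> norm (unwind_curve R x u - unwind_curve R x v)"
    unfolding abs_le_square_iff[symmetric] by simp_all
qed

text \<open>The schedule \<open>\<tau>\<close> allows the same deformation to be run
  backwards.\<close>

lemma unwind_isotopy:
  assumes lip: "lipfam {0..1} (\<lambda>t _. \<tau> t)" and \<tau>: "\<And>t. t \<in> {0..1} \<Longrightarrow> 0 \<le> \<tau> t \<and> \<tau> t \<le> 1"
  shows "ambient_isotopic (unwind_curve R (\<tau> 0) ` {0..1}) (unwind_curve R (\<tau> 1) ` {0..1})"
proof (rule lipfam_isotopy[where F = "\<lambda>t. unwind_curve R (\<tau> t)"])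
  show "(0::real) < 1" by simp
  have rad: "lipfam {0..1} (\<lambda>t u. unwind_radius (\<tau> t) u)"
    unfolding unwind_radius_def
    by (intro lipfam_add lipfam_mult lipfam_diff lipfam_const lip lipfam_cos lipfam_id lipfam_max)
  have ang: "lipfam {0..1} (\<lambda>t u. 2 * pi * real R * ((1 - \<tau> t) * u + \<tau> t * clamp01 (3 * u - 1)))"
    unfolding clamp01_def
    by (intro lipfam_add lipfam_mult lipfam_diff lipfam_const lip lipfam_id lipfam_max lipfam_min)
  have sn: "lipfam {0..1} (\<lambda>t u. sin (2 * pi * u))"
    by (intro lipfam_sin lipfam_mult lipfam_const lipfam_id)
  show "lipfam {0..1} (\<lambda>t u. unwind_curve R (\<tau> t) u $ i)" for i
    using exhaust_3[of i] lipfam_mult[OF rad lipfam_cos[OF ang]] lipfam_mult[OF rad lipfam_sin[OF ang]] sn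
    by (auto simp: unwind_curve_def)
  show "unwind_curve R (\<tau> t) 0 = unwind_curve R (\<tau> t) 1" if "t \<in> {0..1}" for t
  proof -
    have "clamp01 2 = 1" "clamp01 (- 1) = 0" by (simp_all add: clamp01_def)
    then show ?thesis using sin_cos_2pi_Ints[of "real R" 0]
      by (simp add: unwind_curve_def unwind_radius_def)
  qed
  show "u = 0 \<and> v = 1"
    if t: "t \<in> {0..1}" and uv: "u \<in> {0..1}" "v \<in> {0..1}" "u < v" and eq: "unwind_curve R (\<tau> t) u = unwind_curve R (\<tau> t) v" for t u v
  proof -
    have x: "0 \<le> \<tau> t" "\<tau> t \<le> 1" using \<tau>[OF t] by auto
    have e: "unwind_radius (\<tau> t) u = unwind_radius (\<tau> t) v" "sin (2 * pi * u) = sin (2 * pi * v)"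
      using unwind_curve_lower[OF x, of u v R] eq by simp_all
    have "cos (2 * pi * u) = cos (2 * pi * v)" by (rule unwind_radius_eqD[OF x e])
    then obtain k :: int where "2 * pi * u = 2 * pi * v + 2 * pi * of_int k"
      using e(2) sin_cos_eq_iff[of "2 * pi * u" "2 * pi * v"] by blast
    then have "2 * pi * (v - u) = 2 * pi * of_int (- k)" by (simp add: algebra_simps)
    then have k: "v - u = of_int (- k)" by (simp only: mult_cancel_left) simp
    then have "0 < real_of_int (- k)" "real_of_int (- k) \<le> 1" using uv by auto
    then have "- k = 1" by linarith
    then have "v - u = 1" using k by simp
    then show ?thesis using uv by auto
  qed
  show "\<exists>e>0. \<exists>c>0. \<forall>t\<in>{0..1}. \<forall>u\<in>{0..1}. \<forall>v\<in>{0..1}. \<bar>u - u0\<bar> < e \<longrightarrow> \<bar>v - u0\<bar> < e \<longrightarrow> u < v \<longrightarrow>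
       c * (v - u) \<le> norm (unwind_curve R (\<tau> t) u - unwind_curve R (\<tau> t) v)" if "u0 \<in> {0..1}" for u0
  proof (cases "cos (2 * pi * u0) = 0")
    case False
    have "\<exists>e>0. \<exists>c>0. \<forall>u v. \<bar>u - u0\<bar> < e \<longrightarrow> \<bar>v - u0\<bar> < e \<longrightarrow> u < v \<longrightarrow> c * (v - u) \<le> \<bar>sin (2 * pi * v) - sin (2 * pi * u)\<bar>"
      by (rule deriv_lens[where a = "u0 - 1" and b = "u0 + 1" and f' = "\<lambda>u. 2 * pi * cos (2 * pi * u)"])
        (use False in \<open>auto intro!: derivative_eq_intros continuous_intros\<close>)
    then obtain e c where ec: "e > 0" "c > 0" and lens: "\<And>u v. \<bar>u - u0\<bar> < e \<Longrightarrow> \<bar>v - u0\<bar> < e \<Longrightarrow> u < v \<Longrightarrow> c * (v - u) \<le> \<bar>sin (2 * pi * v) - sin (2 * pi * u)\<bar>"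
      by blast
    have "c * (v - u) \<le> norm (unwind_curve R (\<tau> t) u - unwind_curve R (\<tau> t) v)"
      if "t \<in> {0..1}" "\<bar>u - u0\<bar> < e" "\<bar>v - u0\<bar> < e" "u < v" for t u v
      using lens[OF that(2-4)] unwind_curve_lower(2)[of "\<tau> t" u v R] \<tau>[OF that(1)] by (simp add: abs_minus_commute)
    with ec show ?thesis by blast
  next
    case True
    have "\<exists>e>0. \<exists>c>0. \<forall>u v. \<bar>u - u0\<bar> < e \<longrightarrow> \<bar>v - u0\<bar> < e \<longrightarrow> u < v \<longrightarrow> c * (v - u) \<le> \<bar>cos (2 * pi * v) - cos (2 * pi * u)\<bar>"
    proof (rule deriv_lens[where a = "u0 - 1" and b = "u0 + 1" and f' = "\<lambda>u. - (2 * pi * sin (2 * pi * u))"])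
      show "- (2 * pi * sin (2 * pi * u0)) \<noteq> 0" using True sin_cos_squared_add[of "2 * pi * u0"] by auto
    qed (auto intro!: derivative_eq_intros continuous_intros)
    then obtain e c where ec: "e > 0" "c > 0" and lens: "\<And>u v. \<bar>u - u0\<bar> < e \<Longrightarrow> \<bar>v - u0\<bar> < e \<Longrightarrow> u < v \<Longrightarrow> c * (v - u) \<le> \<bar>cos (2 * pi * v) - cos (2 * pi * u)\<bar>"
      by blast
    \<comment> \<open>Where the height is stationary the cosine is close to 0, hence above -1/2.
      There the maximum in \<open>unwind_radius\<close> is not 0, and the radius is the cosine up to
      a constant.\<close>
    have pos: "cos (2 * pi * u) > - 1/2" if "\<bar>u - u0\<bar> < 1/16" for u
    proof -
      have "\<bar>cos (2 * pi * u) - cos (2 * pi * u0)\<bar> \<le> \<bar>2 * pi * u - 2 * pi * u0\<bar>"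
        using sin_diff_le[of "2 * pi * u + pi / 2" "2 * pi * u0 + pi / 2"] by (simp add: sin_add)
      also have "\<dots> = 2 * pi * \<bar>u - u0\<bar>" by (simp add: abs_mult flip: right_diff_distrib)
      also have "\<dots> \<le> 2 * 4 * \<bar>u - u0\<bar>" using pi_less_4 by (intro mult_right_mono) auto
      also have "\<dots> < 2 * 4 * (1/16)" using that by simp
      finally show ?thesis using True by simp
    qed
    have "c * (v - u) \<le> norm (unwind_curve R (\<tau> t) u - unwind_curve R (\<tau> t) v)"
      if "t \<in> {0..1}" "\<bar>u - u0\<bar> < min e (1/16)" "\<bar>v - u0\<bar> < min e (1/16)" "u < v" for t u v
    proof -
      have r: "unwind_radius (\<tau> t) w = (2 * (1 - \<tau> t) + \<tau> t / 2) + cos (2 * pi * w)" if "\<bar>w - u0\<bar> < min e (1/16)" for w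
        using pos[of w] that by (simp add: unwind_radius_def max_def) (simp add: algebra_simps)
      have "c * (v - u) \<le> \<bar>cos (2 * pi * v) - cos (2 * pi * u)\<bar>" using that by (intro lens) auto
      also have "\<dots> = \<bar>unwind_radius (\<tau> t) u - unwind_radius (\<tau> t) v\<bar>" unfolding r[OF that(2)] r[OF that(3)] by simp
      finally show ?thesis using unwind_curve_lower(1)[of "\<tau> t" u v R] \<tau>[OF that(1)] by simp
    qed
    moreover have "0 < min e (1/16)" using ec by simp
    ultimately show ?thesis using ec(2) by blast
  qed
  have "1 * ((u - 0) + (1 - v)) \<le> norm (unwind_curve R (\<tau> t) u - unwind_curve R (\<tau> t) v)"
    if "t \<in> {0..1}" "u \<in> {0..1}" "v \<in> {0..1}" "u - 0 < 1/8" "1 - v < 1/8" for t u v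
  proof -
    have "u - (v - 1) \<le> sin (2 * pi * u) - sin (2 * pi * (v - 1))"
      using that sin_near_int[of "v - 1" 0 u] by simp
    also have "sin (2 * pi * (v - 1)) = sin (2 * pi * v)" using sin_cos_2pi_Ints(1)[of "-1" v] by simp
    finally show ?thesis using unwind_curve_lower(2)[of "\<tau> t" u v R] \<tau>[OF that(1)] by simp
  qed
  moreover have "(0::real) < 1/8" by simp
  ultimately show "\<exists>e>0. \<exists>c>0. \<forall>t\<in>{0..1}. \<forall>u\<in>{0..1}. \<forall>v\<in>{0..1}. u - 0 < e \<longrightarrow> 1 - v < e \<longrightarrow>
       c * ((u - 0) + (1 - v)) \<le> norm (unwind_curve R (\<tau> t) u - unwind_curve R (\<tau> t) v)"
    using zero_less_one by blast
qed

lemma unwind_curve_0: "unwind_curve R 0 ` {0..1} = torus_knot (int R) 1"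
  by (simp add: torus_knot_def unwind_curve_def unwind_radius_def torus_point_def mult.assoc)

text \<open>On \<open>[0, 1]\<close> the number \<open>1/2 + cos (2 * pi * u)\<close> is nonpositive
  exactly between 1/3 and 2/3, where \<open>clamp01 (3 * u - 1)\<close> moves from 0 to 1. Outside
  this interval the longitude is a multiple of the full turn for every \<open>R\<close>.\<close>

lemma unwind_curve_1:
  assumes "u \<in> {0..1}"
  shows "unwind_curve R 1 u = vector [max 0 (1/2 + cos (2 * pi * u)), 0, sin (2 * pi * u)]"
proof -
  consider "u < 1/3" | "1/3 \<le> u" "u \<le> 2/3" | "2/3 < u" by linarith
  then show ?thesis
  proof cases
    case 1
    then have "clamp01 (3 * u - 1) = 0" by (simp add: clamp01_def)
    then show ?thesis by (simp add: unwind_curve_def unwind_radius_def)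
  next
    case 2
    define y where "y = \<bar>2 * pi * (u - 1/2)\<bar>"
    have "y = 2 * pi * \<bar>u - 1/2\<bar>" by (simp add: y_def abs_mult)
    also have "\<bar>u - 1/2\<bar> \<le> 1/6" using 2 by linarith
    then have "2 * pi * \<bar>u - 1/2\<bar> \<le> 2 * pi * (1/6)" by (intro mult_left_mono) auto
    finally have "cos (pi / 3) \<le> cos y" by (intro cos_monotone_0_pi_le) (auto simp: y_def)
    also have "cos y = cos (2 * pi * (u - 1/2))" by (simp add: y_def)
    also have "2 * pi * (u - 1/2) = 2 * pi * u - pi" by (simp add: algebra_simps)
    also have "cos (2 * pi * u - pi) = - cos (2 * pi * u)" by (simp add: cos_diff)
    finally have "max 0 (1/2 + cos (2 * pi * u)) = 0" by (simp add: cos_60)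
    then show ?thesis by (simp add: unwind_curve_def unwind_radius_def)
  next
    case 3
    then have c: "clamp01 (3 * u - 1) = 1" by (simp add: clamp01_def)
    show ?thesis using sin_cos_2pi_Ints[of "real R" 0] by (simp add: unwind_curve_def unwind_radius_def c)
  qed
qed

text \<open>The deformation is run forwards for \<open>R\<close> and backwards for 1; both pass
  through the same plane curve.\<close>

lemma torus_knot_one_isotopic: "ambient_isotopic (torus_knot (int R) 1) (torus_knot 1 1)"
proof -
  have "ambient_isotopic (unwind_curve R 0 ` {0..1}) (unwind_curve R 1 ` {0..1})"
    by (rule unwind_isotopy[where \<tau> = "\<lambda>t. t"]) (auto intro: lipfam_param)
  moreover have "unwind_curve R 1 ` {0..1} = unwind_curve 1 (1 - 0) ` {0..1}"
    by (rule image_cong) (simp_all add: unwind_curve_1)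
  moreover have "ambient_isotopic (unwind_curve 1 (1 - 0) ` {0..1}) (unwind_curve 1 (1 - 1) ` {0..1})"
    by (rule unwind_isotopy[where \<tau> = "\<lambda>t. 1 - t"]) (auto intro!: lipfam_diff lipfam_const lipfam_param)
  ultimately show ?thesis
    using ambient_isotopic_trans unwind_curve_0[of R] unwind_curve_0[of 1] by simp
qed

lemma petal_number_isotopic:
  assumes "ambient_isotopic K L"
  shows "petal_number K \<le> petal_number L"
  unfolding petal_number_def using ambient_isotopic_trans[OF assms] by (intro Inf_superset_mono) blast

theorem theorem3:
  fixes r s :: int
  assumes "r > 0" and "s > 0"
    and "[s = 1] (mod r) \<or> [s = - 1] (mod r)"
  shows "petal_number (torus_knot r s)
           \<le> enat (nat (2 * s - 2 * \<lfloor>real_of_int s / real_of_int r\<rfloor> + 1))"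
proof -
  define R S where "R = nat r" and "S = nat s"
  have rs: "r = int R" "s = int S" "R > 0" "S > 0" using assms(1,2) by (auto simp: R_def S_def)
  have fl: "\<lfloor>real_of_int s / real_of_int r\<rfloor> = int (S div R)"
    unfolding floor_divide_of_int_eq by (simp add: rs zdiv_int)
  have le: "S div R \<le> S" by (rule div_le_dividend)
  have bound: "nat (2 * s - 2 * \<lfloor>real_of_int s / real_of_int r\<rfloor> + 1) = 2 * (S - S div R) + 1"
    unfolding fl using le by (simp add: rs nat_eq_iff of_nat_diff)
  have div: "r dvd s - 1 \<or> r dvd s + 1"
    using assms(3) by (auto simp: cong_iff_dvd_diff)
  have "petal_number (torus_knot (int R) (int S)) \<le> enat (2 * (S - S div R) + 1)"
  proof (cases "R = 1")
    case True
    then show ?thesis using order_trans[OF petal_number_longitude[of S], of "enat (2 * (S - S div R) + 1)"] by simp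
  next
    case R1: False
    show ?thesis
    \<comment> \<open>If \<open>s = 1\<close>, every \<open>r\<close> divides \<open>s - 1\<close>,
      so divisibility gives no bound on \<open>r\<close>.\<close>
    proof (cases "S = 1")
      case True
      have "petal_number (torus_knot (int R) 1) \<le> petal_number (torus_knot 1 1)"
        by (rule petal_number_isotopic[OF torus_knot_one_isotopic])
      also have "\<dots> \<le> enat 1" using petal_number_longitude[of 1] by simp
      also have "\<dots> \<le> enat (2 * (S - S div R) + 1)" by simp
      finally show ?thesis using True by simp
    next
      case False
      have "r \<le> s + 1"
        using div
      proof
        assume "r dvd s - 1"
        then have "r \<le> s - 1" using False rs by (intro zdvd_imp_le) auto
        then show ?thesis by simp
      next
        assume "r dvd s + 1"
        then show ?thesis using rs by (intro zdvd_imp_le) auto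
      qed
      moreover have "coprime r s"
      proof (rule coprimeI)
        fix c assume c: "c dvd r" "c dvd s"
        from div show "is_unit c"
        proof
          assume "r dvd s - 1"
          then have "c dvd s - 1" using c(1) dvd_trans by blast
          then have "c dvd s - (s - 1)" using c(2) by (rule dvd_diff[rotated])
          then show ?thesis by simp
        next
          assume "r dvd s + 1"
          then have "c dvd s + 1" using c(1) dvd_trans by blast
          then have "c dvd (s + 1) - s" using c(2) by (rule dvd_diff)
          then show ?thesis by simp
        qed
      qed
      ultimately show ?thesis using R1 rs by (intro petal_number_torus_knot_coprime) auto
    qed
  qed
  then show ?thesis unfolding bound by (simp add: rs)
qed

end
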